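(* Let $n\ge 1$ be an integer and let $\Gamma\subset \mathrm{PO}(n,2)$ be an $\mathrm{AdS}$ quasi-Fuchsian group. If its proximal limit set $\Lambda_\Gamma$ is a $\mathcal{C}^1$ submanifold of $\partial\mathbb{A}\mathrm{d}\mathbb{S}^{n+1}$, then $\Gamma$ is $\mathrm{AdS}$-Fuchsian.
   Context: Let $\langle x\,|\,y\rangle_{n,2}=\sum_{i=1}^n x_iy_i-x_{n+1}y_{n+1}-x_{n+2}y_{n+2}$ on $\mathbb{R}^{n+2}$, let $\mathrm{O}(n,2)$ be its isometry group and $\mathrm{PO}(n,2)=\mathrm{O}(n,2)/\{\pm\mathrm{Id}\}$, acting on $\mathbb{RP}^{n+1}$. Define $\mathbb{A}\mathrm{d}\mathbb{S}^{n+1}=\{[x]\in\mathbb{RP}^{n+1} : \langle x|x\rangle_{n,2}<0\}$ and $\partial\mathbb{A}\mathrm{d}\mathbb{S}^{n+1}=\{[x]\in\mathbb{RP}^{n+1} : \langle x|x\rangle_{n,2}=0\}$ (a smooth quadric). For $\gamma\in\mathrm{PO}(n,2)$ let $\lambda_1(\gamma)\ge\dots\ge\lambda_{n+2}(\gamma)$ be the logarithms of the moduli of the eigenvalues of a lift of $\gamma$ to $\mathrm{O}(n,2)$. The element $\gamma$ is proximal if $\lambda_1(\gamma)>\lambda_2(\gamma)$; its attracting fixed point $\gamma_+\in\partial\mathbb{A}\mathrm{d}\mathbb{S}^{n+1}$ is the eigenline for the eigenvalue of modulus $e^{\lambda_1(\gamma)}$. The proximal limit set $\Lambda_\Gamma$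 of a discrete subgroup $\Gamma\subset\mathrm{PO}(n,2)$ is the closure in $\mathbb{RP}^{n+1}$ of the set of attracting fixed points of proximal elements of $\Gamma$; it is contained in $\partial\mathbb{A}\mathrm{d}\mathbb{S}^{n+1}$. A discrete subgroup $\Gamma\subset\mathrm{PO}(n,2)$ is $\mathrm{AdS}$ convex-cocompact if it acts properly discontinuously and cocompactly on some properly convex closed subset $\mathcal{C}$ of $\mathbb{A}\mathrm{d}\mathbb{S}^{n+1}$ with nonempty interior whose ideal boundary $\overline{\mathcal{C}}\setminus\mathcal{C}$ (closure in $\mathbb{RP}^{n+1}$) does not contain any nontrivial projective segment. (Properly convex: convex and bounded in some affine chart of $\mathbb{RP}^{n+1}$.) A discrete subgroup $\Gamma\subset\mathrm{PO}(n,2)$ is $\mathrm{AdS}$ quasi-Fuchsian if it is $\mathrm{AdS}$ convex-cocompact and $\Lambda_\Gamma$ is homeomorphic to the sphere $\mathbb{S}^{n-1}$. It is $\mathrm{AdS}$-Fuchsian if moreover it preserves a totally geodesic copy of $\mathbb{H}^n$ in $\mathbb{A}\mathrm{d}\mathbb{S}^{n+1}$, i.e. a set $\mathbb{P}(V)\cap\mathbb{A}\mathrm{d}\mathbb{S}^{n+1}$ with $V\subset\mathbb{R}^{n+2}$ a linear subspace on which $\langle\cdot|\cdot\rangle_{n,2}$ has signature $(n,1)$. *)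

theory Defs
  imports
    "HOL-Analysis.Analysis"
    "HOL-Algebra.Coset"
    "HOL-Computational_Algebra.Computational_Algebra"
begin

section \<open>Real projective space\<close>

typedef (overloaded) ('m::finite) rp = "{span {x} | x :: real ^ 'm. x \<noteq> 0}"
  morphisms line_of rp_of_line
proof -
  have "axis undefined 1 \<noteq> (0 :: real ^ 'm)"
    by (simp add: axis_eq_0_iff)
  then show ?thesis by blast
qed

definition rp_class :: "real ^ 'm \<Rightarrow> ('m::finite) rp" where
  "rp_class x = rp_of_line (span {x})"  \<comment> \<open>only meaningful for \<open>x \<noteq> 0\<close>\<close>

text \<open>The quotient topology of \<open>\<real>\<^sup>m - {0}\<close>.\<close>

instantiation rp :: (finite) topological_space
begin

definition open_rp :: "'a rp set \<Rightarrow> bool" where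
  "open_rp U \<longleftrightarrow> open {x :: real ^ 'a. x \<noteq> 0 \<and> rp_class x \<in> U}"

instance
proof
  have "{x :: real ^ 'a. x \<noteq> 0 \<and> rp_class x \<in> UNIV} = - {0}"
    by auto
  then show "open (UNIV :: 'a rp set)"
    by (simp add: open_rp_def open_Compl)
next
  fix S T :: "'a rp set"
  assume "open S" "open T"
  moreover have "{x :: real ^ 'a. x \<noteq> 0 \<and> rp_class x \<in> S \<inter> T} =
      {x. x \<noteq> 0 \<and> rp_class x \<in> S} \<inter> {x. x \<noteq> 0 \<and> rp_class x \<in> T}"
    by auto
  ultimately show "open (S \<inter> T)"
    by (simp only: open_rp_def open_Int)
next
  fix K :: "'a rp set set"
  assume K: "\<forall>S\<in>K. open S"
  have "{x :: real ^ 'a. x \<noteq> 0 \<and> rp_class x \<in> \<Union>K} =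
      (\<Union>S\<in>K. {x. x \<noteq> 0 \<and> rp_class x \<in> S})"
    by auto
  with K show "open (\<Union>K)"
    by (simp add: open_rp_def open_UN)
qed

end

text \<open>
  The affine charts of projective space are the complements of the hyperplanes
  \<open>a \<bullet> x = 0\<close>, \<open>a \<noteq> 0\<close>, identified with the affine hyperplanes \<open>a \<bullet> x = 1\<close>.
\<close>

definition affine_chart :: "real ^ 'm \<Rightarrow> ('m::finite) rp set" where
  "affine_chart a = {rp_class x | x. a \<bullet> x \<noteq> 0}"

definition in_affine_chart :: "real ^ 'm \<Rightarrow> ('m::finite) rp set \<Rightarrow> (real ^ 'm) set" where
  "in_affine_chart a C = {x. a \<bullet> x = 1 \<and> rp_class x \<in> C}"

definition properly_convex :: "('m::finite) rp set \<Rightarrow> bool" where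
  "properly_convex C \<longleftrightarrow>
     (\<exists>a. a \<noteq> 0 \<and> C \<subseteq> affine_chart a \<and>
          convex (in_affine_chart a C) \<and> bounded (in_affine_chart a C))"

text \<open>
  A set contains a nontrivial projective segment iff it contains one with its endpoints;
  the latter are the images of linear segments between representatives of distinct points.
\<close>

definition contains_nontrivial_segment :: "('m::finite) rp set \<Rightarrow> bool" where
  "contains_nontrivial_segment S \<longleftrightarrow>
     (\<exists>x y. x \<noteq> 0 \<and> y \<noteq> 0 \<and> rp_class x \<noteq> rp_class y \<and>
            rp_class ` closed_segment x y \<subseteq> S)"


section \<open>The form of signature \<open>(n, 2)\<close> and its isometry group\<close>

text \<open>
  Throughout \<open>n = CARD('n)\<close> and \<open>\<real>\<^sup>n\<^sup>+\<^sup>2\<close> is indexed by the sum type \<open>'n + 2\<close>: the indices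
  \<open>Inl i\<close> are the positive directions and the two indices \<open>Inr j\<close> the negative ones.
\<close>

definition ads_form :: "real ^ ('n + 2) \<Rightarrow> real ^ ('n::finite + 2) \<Rightarrow> real" where
  "ads_form x y = (\<Sum>i\<in>UNIV. x $ Inl i * y $ Inl i) - (\<Sum>j\<in>UNIV. x $ Inr j * y $ Inr j)"

definition AdS :: "('n::finite + 2) rp set" where
  "AdS = {rp_class x | x. x \<noteq> 0 \<and> ads_form x x < 0}"

definition boundary_AdS :: "('n::finite + 2) rp set" where
  "boundary_AdS = {rp_class x | x. x \<noteq> 0 \<and> ads_form x x = 0}"

definition O_n_2 :: "(real ^ ('n::finite + 2) ^ ('n + 2)) monoid" where
  "O_n_2 = \<lparr>carrier = {A. \<forall>x y. ads_form (A *v x) (A *v y) = ads_form x y},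
            mult = (**), one = mat 1\<rparr>"

abbreviation plus_minus_Id :: "(real ^ ('n::finite + 2) ^ ('n + 2)) set" where
  "plus_minus_Id \<equiv> {mat 1, - mat 1}"

text \<open>The elements of \<open>PO_n_2\<close> are the sets \<open>{A, -A}\<close> of the two lifts.\<close>

definition PO_n_2 :: "(real ^ ('n::finite + 2) ^ ('n + 2)) set monoid" where
  "PO_n_2 = O_n_2 Mod plus_minus_Id"

definition PO_topology :: "(real ^ ('n::finite + 2) ^ ('n + 2)) set topology" where
  "PO_topology = topology (\<lambda>U. U \<subseteq> carrier PO_n_2 \<and>
     openin (top_of_set (carrier O_n_2))
            {A \<in> carrier O_n_2. plus_minus_Id #>\<^bsub>O_n_2\<^esub> A \<in> U})"

lemma openin_PO_topology:
  fixes U :: "(real ^ ('n::finite + 2) ^ ('n + 2)) set set"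
  shows "openin PO_topology U \<longleftrightarrow> U \<subseteq> carrier PO_n_2 \<and>
     openin (top_of_set (carrier O_n_2))
            {A \<in> carrier O_n_2. plus_minus_Id #>\<^bsub>O_n_2\<^esub> A \<in> U}"
proof -
  let ?q = "\<lambda>U :: (real ^ ('n + 2) ^ ('n + 2)) set set. {A \<in> carrier O_n_2. plus_minus_Id #>\<^bsub>O_n_2\<^esub> A \<in> U}"
  have q_Int: "?q (S \<inter> T) = ?q S \<inter> ?q T" for S T
    by auto
  have q_Union: "?q (\<Union>K) = \<Union> (?q ` K)" for K
    by auto
  have "istopology (\<lambda>U. U \<subseteq> carrier PO_n_2 \<and> openin (top_of_set (carrier O_n_2)) (?q U))"
    unfolding istopology_def q_Int q_Union by (blast intro: openin_Int openin_Union)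
  then show ?thesis
    by (simp add: PO_topology_def)
qed

definition discrete_subgroup :: "(real ^ ('n::finite + 2) ^ ('n + 2)) set set \<Rightarrow> bool" where
  "discrete_subgroup \<Gamma> \<longleftrightarrow>
     subgroup \<Gamma> PO_n_2 \<and> subtopology PO_topology \<Gamma> = discrete_topology \<Gamma>"

text \<open>The two lifts of \<open>g\<close> map a line to the same line, which is the union below.\<close>

definition act :: "(real ^ 'm ^ 'm) set \<Rightarrow> ('m::finite) rp \<Rightarrow> 'm rp" where
  "act g p = rp_of_line (\<Union>A\<in>g. (\<lambda>x. A *v x) ` line_of p)"


section \<open>Proximal limit sets\<close>

definition complex_char_poly :: "real ^ 'm ^ 'm \<Rightarrow> complex poly" where
  "complex_char_poly A = det (mat [:0, 1:] - (\<chi> i j. [:complex_of_real (A $ i $ j):]))"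

text \<open>
  Logarithms of the moduli of the complex eigenvalues, counted with algebraic multiplicity;
  \<open>log_modulus A k\<close> is the \<open>k\<close>-th largest one, for \<open>k = 1, \<dots>, n + 2\<close>.  It takes the same
  value at both lifts \<open>A\<close> and \<open>-A\<close> of an element of \<open>PO_n_2\<close>.
\<close>

definition log_modulus :: "real ^ 'm ^ 'm \<Rightarrow> nat \<Rightarrow> real" where
  "log_modulus A k =
     rev (sorted_list_of_multiset
            (image_mset (\<lambda>z. ln (cmod z)) (proots (complex_char_poly A)))) ! (k - 1)"

definition proximal :: "(real ^ 'm ^ 'm) set \<Rightarrow> bool" where
  "proximal g \<longleftrightarrow> (\<exists>A\<in>g. log_modulus A 1 > log_modulus A 2)"

text \<open>For proximal \<open>g\<close> the eigenvalue of largest modulus is simple, hence real.\<close>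

definition attracting_fixed_point :: "(real ^ 'm ^ 'm) set \<Rightarrow> ('m::finite) rp \<Rightarrow> bool" where
  "attracting_fixed_point g p \<longleftrightarrow>
     (\<exists>A\<in>g. \<exists>\<mu> x. \<bar>\<mu>\<bar> = exp (log_modulus A 1) \<and> x \<noteq> 0 \<and> A *v x = \<mu> *\<^sub>R x \<and> p = rp_class x)"

definition limit_set :: "(real ^ 'm ^ 'm) set set \<Rightarrow> ('m::finite) rp set" where
  "limit_set \<Gamma> = closure {p. \<exists>g\<in>\<Gamma>. proximal g \<and> attracting_fixed_point g p}"


section \<open>Convex cocompact, quasi-Fuchsian and Fuchsian groups\<close>

definition preserves :: "(real ^ 'm ^ 'm) set set \<Rightarrow> ('m::finite) rp set \<Rightarrow> bool" where
  "preserves \<Gamma> C \<longleftrightarrow> (\<forall>g\<in>\<Gamma>. act g ` C = C)"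

definition acts_properly_discontinuously_on ::
    "(real ^ 'm ^ 'm) set set \<Rightarrow> ('m::finite) rp set \<Rightarrow> bool" where
  "acts_properly_discontinuously_on \<Gamma> C \<longleftrightarrow>
     (\<forall>K. compact K \<and> K \<subseteq> C \<longrightarrow> finite {g \<in> \<Gamma>. act g ` K \<inter> K \<noteq> {}})"

definition acts_cocompactly_on ::
    "(real ^ 'm ^ 'm) set set \<Rightarrow> ('m::finite) rp set \<Rightarrow> bool" where
  "acts_cocompactly_on \<Gamma> C \<longleftrightarrow> (\<exists>K. compact K \<and> K \<subseteq> C \<and> (\<Union>g\<in>\<Gamma>. act g ` K) = C)"

definition AdS_convex_cocompact :: "(real ^ ('n::finite + 2) ^ ('n + 2)) set set \<Rightarrow> bool" where
  "AdS_convex_cocompact \<Gamma> \<longleftrightarrow> discrete_subgroup \<Gamma> \<and>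
     (\<exists>C. C \<subseteq> AdS \<and> closedin (top_of_set AdS) C \<and> properly_convex C \<and> interior C \<noteq> {} \<and>
          preserves \<Gamma> C \<and> acts_properly_discontinuously_on \<Gamma> C \<and> acts_cocompactly_on \<Gamma> C \<and>
          \<not> contains_nontrivial_segment (closure C - C))"

definition AdS_quasi_Fuchsian :: "(real ^ ('n::finite + 2) ^ ('n + 2)) set set \<Rightarrow> bool" where
  "AdS_quasi_Fuchsian \<Gamma> \<longleftrightarrow>
     AdS_convex_cocompact \<Gamma> \<and> limit_set \<Gamma> homeomorphic sphere (0 :: real ^ 'n) 1"

definition has_signature :: "(real ^ ('n::finite + 2)) set \<Rightarrow> nat \<Rightarrow> nat \<Rightarrow> bool" where
  "has_signature V p q \<longleftrightarrow>
     (\<exists>P N. P \<inter> N = {} \<and> independent (P \<union> N) \<and> span (P \<union> N) = V \<and> card P = p \<and> card N = q \<and>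
            pairwise (\<lambda>x y. ads_form x y = 0) (P \<union> N) \<and>
            (\<forall>x\<in>P. ads_form x x = 1) \<and> (\<forall>x\<in>N. ads_form x x = -1))"

definition projectivization :: "(real ^ 'm) set \<Rightarrow> ('m::finite) rp set" where
  "projectivization V = {rp_class x | x. x \<in> V \<and> x \<noteq> 0}"

definition AdS_Fuchsian :: "(real ^ ('n::finite + 2) ^ ('n + 2)) set set \<Rightarrow> bool" where
  "AdS_Fuchsian \<Gamma> \<longleftrightarrow> AdS_quasi_Fuchsian \<Gamma> \<and>
     (\<exists>V. subspace V \<and> has_signature V CARD('n) 1 \<and> preserves \<Gamma> (projectivization V \<inter> AdS))"


section \<open>Submanifolds of the quadric\<close>

text \<open>
  A \<open>C\<^sup>1\<close> parametrization of an open piece of \<open>boundary_AdS\<close>, i.e. the inverse of a \<open>C\<^sup>1\<close>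
  chart.  It is given through a lift \<open>\<sigma>\<close> to \<open>\<real>\<^sup>n\<^sup>+\<^sup>2 - {0}\<close> (locally, every \<open>C\<^sup>1\<close> map to
  projective space has a \<open>C\<^sup>1\<close> lift).  The kernel of the derivative at \<open>x\<close> of the projection
  to projective space is \<open>span {x}\<close>, so the last condition says that \<open>rp_class \<circ> \<sigma>\<close> is an
  immersion.
\<close>

definition C1_parametrization ::
    "(real ^ 'n) set \<Rightarrow> (real ^ 'n \<Rightarrow> real ^ ('n::finite + 2)) \<Rightarrow> bool" where
  "C1_parametrization W \<sigma> \<longleftrightarrow> open W \<and> 0 \<notin> \<sigma> ` W \<and>
     openin (top_of_set boundary_AdS) ((rp_class \<circ> \<sigma>) ` W) \<and>
     (\<exists>h. homeomorphism W ((rp_class \<circ> \<sigma>) ` W) (rp_class \<circ> \<sigma>) h) \<and>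
     (\<exists>D :: real ^ 'n \<Rightarrow> (real ^ 'n) \<Rightarrow>\<^sub>L (real ^ ('n + 2)).
        continuous_on W D \<and>
        (\<forall>w\<in>W. (\<sigma> has_derivative blinfun_apply (D w)) (at w)) \<and>
        (\<forall>w\<in>W. \<forall>v. blinfun_apply (D w) v \<in> span {\<sigma> w} \<longrightarrow> v = 0))"

text \<open>
  Embedded submanifolds, by slice charts: around each point of \<open>M\<close> there is a \<open>C\<^sup>1\<close> chart of
  the quadric in which \<open>M\<close> is a linear subspace, of a dimension \<open>d\<close> that does not depend on
  the point.
\<close>

definition C1_submanifold_of_boundary :: "('n::finite + 2) rp set \<Rightarrow> bool" where
  "C1_submanifold_of_boundary M \<longleftrightarrow> M \<subseteq> boundary_AdS \<and>
     (\<exists>d. \<forall>p\<in>M. \<exists>W \<sigma> L. C1_parametrization W \<sigma> \<and> p \<in> (rp_class \<circ> \<sigma>) ` W \<and>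
        subspace L \<and> dim L = d \<and> {w \<in> W. rp_class (\<sigma> w) \<in> M} = W \<inter> L)"

end

theory Submission
  imports Defs
begin

text \<open>
  Let \<open>K\<close> be the cone over the closure of the invariant convex set.  The form is nonpositive on
  \<open>K\<close>, and as the ideal boundary contains no segment, distinct isotropic points of \<open>K\<close> are never
  orthogonal.  By Perron--Frobenius a proximal element has its attracting fixed point \<open>p\<close> and its
  repelling fixed point \<open>q\<close> in \<open>K\<close>; in particular the limit set lies in \<open>K\<close>.

  At a point of the limit set where a time function is maximal, the tangent space is spacelike.
  This is an open condition, so it holds at the attracting fixed point \<open>p\<close> of some proximal \<open>A\<close>.
  Then \<open>A\<close> preserves the tangent space \<open>P\<close> of the limit set at \<open>p\<close>, hence also \<open>P + \<real>q\<close>, a space \<open>V\<close>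
  of signature \<open>(n, 1)\<close>, and it acts on the positive definite space \<open>P \<inter> q\<^sup>\<bottom>\<close> by isometries.
  Near \<open>p\<close> the map \<open>A\<close> is thus a homothety up to a compact factor; since the limit set is invariant
  and differentiable at \<open>p\<close>, blowing it up with the powers of \<open>A\<close> shows that it is contained in
  the projectivization of \<open>V\<close>.
\<close>

unbundle no fps_syntax


section \<open>Characteristic polynomials and logarithmic moduli\<close>

text \<open>Acausality does not control tangent spaces: a priori the limit set may still have
  lightlike tangent directions. Hence the detour through one extremal point, whose spacelike tangent
  space spreads to a neighbourhood by continuity of the derivative; attracting fixed points are
  dense in the limit set, so some lie there. The blow-up rests on the eigenvalues. \<open>A\<close>
  acts by \<mu> on \<open>p\<close>, by the inverse of \<mu> on \<open>q\<close>, isometrically on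
  the definite part of \<open>P\<close>, and by 1 or -1 on the normal of \<open>V\<close>. Modulo
  \<open>p\<close>, the tangential and normal parts of an orbit therefore stay comparable, whereas
  tangency makes the normal part negligible near \<open>p\<close>. Perron--Frobenius matters because
  it places \<open>q\<close> in \<open>K\<close>: by acausality a limit point orthogonal to
  \<open>q\<close> is \<open>q\<close> itself, so every other one has a nonzero component along
  \<open>p\<close> and is attracted to it. \<open>V\<close> comes from a single element; it is
  invariant under the whole group because it turns out to be the span of the limit set.\<close>

definition complex_matrix :: "real ^ 'm ^ 'm \<Rightarrow> complex ^ 'm ^ 'm" where
  "complex_matrix A = (\<chi> i j. complex_of_real (A $ i $ j))"

lemma complex_matrix_mult: "complex_matrix (A ** B) = complex_matrix A ** complex_matrix B"
  by (simp add: complex_matrix_def matrix_matrix_mult_def vec_eq_iff)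

lemma complex_matrix_one: "complex_matrix (mat 1) = mat 1"
  by (simp add: complex_matrix_def mat_def vec_eq_iff)

lemma poly_det: "poly (det M) z = det (\<chi> i j. poly (M $ i $ j) z)"
  by (simp add: det_def poly_sum poly_prod poly_of_int)

text \<open>Reduces identities between characteristic polynomials to identities between complex
  determinants, checked at every point \<open>z\<close>.\<close>

lemma poly_complex_char_poly: "poly (complex_char_poly A) z = det (mat z - complex_matrix A)"
proof -
  have "(\<chi> i j. poly ((mat [:0, 1:] - (\<chi> i j. [:complex_of_real (A $ i $ j):])) $ i $ j) z) =
      mat z - complex_matrix A"
    by (simp add: vec_eq_iff mat_def complex_matrix_def)
  then show ?thesis by (simp add: complex_char_poly_def poly_det)
qed

lemma complex_char_poly_conjugate:
  fixes A S T :: "real ^ 'm ^ 'm"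
  assumes "S ** T = mat 1"
  shows "complex_char_poly (S ** A ** T) = complex_char_poly A"
proof -
  have ST: "complex_matrix S ** complex_matrix T = mat 1"
    by (metis assms complex_matrix_mult complex_matrix_one)
  have "poly (complex_char_poly (S ** A ** T)) z = poly (complex_char_poly A) z" for z
  proof -
    have m: "mat z ** X = X ** mat z" for X :: "complex ^ 'm ^ 'm"
      by (simp add: matrix_matrix_mult_def mat_def vec_eq_iff if_distrib if_distribR sum.delta sum.delta' cong: if_cong)
    have d1: "X ** (Y - Z) = X ** Y - X ** Z" and d2: "(Y - Z) ** X = Y ** X - Z ** X"
      for X Y Z :: "complex ^ 'm ^ 'm"
      by (simp_all add: matrix_matrix_mult_def vec_eq_iff algebra_simps sum_subtractf)
    have "mat z = complex_matrix S ** mat z ** complex_matrix T"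
      by (metis ST m matrix_mul_assoc matrix_mul_rid)
    then have "mat z - complex_matrix (S ** A ** T) =
        complex_matrix S ** (mat z - complex_matrix A) ** complex_matrix T"
      by (simp add: complex_matrix_mult d1 d2 matrix_mul_assoc)
    moreover have "det (complex_matrix S) * det (complex_matrix T) = 1"
      by (metis ST det_I det_mul)
    ultimately show ?thesis
      by (simp add: poly_complex_char_poly det_mul mult_ac)
  qed
  then show ?thesis by (simp add: poly_eq_poly_eq_iff[symmetric] fun_eq_iff)
qed

text \<open>The reversed polynomial \<open>Q\<close>, with values det (1 - t A), is 1 at 0, so it is
  nonzero at some \<open>t \<noteq> 0\<close>, where it is a power of \<open>t\<close> times the
  characteristic polynomial at \<open>1 / t\<close>. Nonvanishing is what makes
  \<open>proots\<close> list exactly the roots.\<close>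

lemma complex_char_poly_nonzero:
  fixes A :: "real ^ 'm ^ 'm"
  shows "complex_char_poly A \<noteq> 0"
proof -
  define Q where "Q = det (\<chi> i j. [:if i = j then 1 else 0, - complex_of_real (A $ i $ j):])"
  have Q: "poly Q t = det ((\<chi> i. mat 1 $ i - t *s complex_matrix A $ i))" for t
  proof -
    have "(\<chi> i j. poly ((\<chi> i j. [:if i = j then 1 else 0, - complex_of_real (A $ i $ j):]) $ i $ j) t)
      = (\<chi> i. mat 1 $ i - t *s complex_matrix A $ i)"
      by (simp add: vec_eq_iff mat_def complex_matrix_def)
    then show ?thesis by (simp add: Q_def poly_det)
  qed
  have "(\<chi> i. mat 1 $ i - 0 *s complex_matrix A $ i) = mat 1" by (simp add: vec_eq_iff)
  then have "poly Q 0 = 1" by (simp add: Q)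
  then have "Q \<noteq> 0" by auto
  then have "finite {t. poly Q t = 0}" by (rule poly_roots_finite)
  moreover have "infinite (UNIV - {0 :: complex})" by (simp add: infinite_UNIV_char_0)
  ultimately obtain t where t: "t \<noteq> 0" "poly Q t \<noteq> 0"
    by (metis (mono_tags, lifting) DiffD2 finite_subset insert_iff mem_Collect_eq subsetI)
  have "(\<chi> i. mat 1 $ i - t *s complex_matrix A $ i) = (\<chi> i. t *s (mat (1 / t) - complex_matrix A) $ i)"
    using t by (simp add: vec_eq_iff mat_def field_simps)
  then have "poly Q t = t ^ CARD('m) * poly (complex_char_poly A) (1 / t)"
    by (simp only: Q poly_complex_char_poly det_rows_mul)
      (simp add: vec_lambda_eta flip: vector_minus_component)
  with t show ?thesis by auto
qed

text \<open>Laplace expansion along a row. The minor is kept as a matrix of full size whose row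
  \<open>k\<close> is a basis vector, so the index type does not change and a further expansion can
  follow.\<close>

lemma det_row_axis:
  fixes M :: "'a::comm_ring_1 ^ 'n::finite ^ 'n"
  assumes "\<And>j. j \<noteq> k \<Longrightarrow> M $ k $ j = 0"
  shows "det M = M $ k $ k * det (\<chi> j. if j = k then axis k 1 else M $ j)"
proof -
  have "M = (\<chi> j. if j = k then M $ k $ k *s axis k 1 else M $ j)"
    using assms by (auto simp: vec_eq_iff axis_def)
  then have "det M = det (\<chi> j. if j = k then M $ k $ k *s axis k 1 else M $ j)" by simp
  then show ?thesis by (simp only: det_row_mul)
qed

lemma det_column_axis_dvd:
  fixes M :: "'a::comm_ring_1 ^ 'n::finite ^ 'n"
  assumes "\<And>j. j \<noteq> k \<Longrightarrow> M $ j $ k = 0"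
  shows "M $ k $ k dvd det M"
proof -
  have "det (transpose M) = transpose M $ k $ k * det (\<chi> j. if j = k then axis k 1 else transpose M $ j)"
    using assms by (intro det_row_axis) (simp add: transpose_def)
  then have "det M = M $ k $ k * det (\<chi> j. if j = k then axis k 1 else transpose M $ j)"
    by (simp add: transpose_def[of M, symmetric]) (simp add: transpose_def)
  then show ?thesis by (metis dvd_triv_left)
qed

text \<open>Row \<open>k\<close> and column \<open>i\<close> of \<open>T\<close> vanish off the
  diagonal. Expanding along row \<open>k\<close> keeps this property of column \<open>i\<close>,
  because \<open>i \<noteq> k\<close>, so the second linear factor divides the remaining
  determinant.\<close>

lemma complex_char_poly_axis_factors:
  fixes T :: "real ^ 'm ^ 'm"
  assumes T: "T *v axis i 1 = \<mu> *\<^sub>R axis i 1" and Tt: "transpose T *v axis k 1 = \<nu> *\<^sub>R axis k 1"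
    and "i \<noteq> k"
  shows "[:- complex_of_real \<mu>, 1:] * [:- complex_of_real \<nu>, 1:] dvd complex_char_poly T"
proof -
  have col: "T $ j $ i = (if j = i then \<mu> else 0)" for j
    using arg_cong[OF T, of "\<lambda>v. v $ j"]
    by (simp add: matrix_vector_mul_component inner_axis) (auto simp: axis_def)
  have row: "T $ k $ j = (if j = k then \<nu> else 0)" for j
    using arg_cong[OF Tt, of "\<lambda>v. v $ j"]
    by (simp add: matrix_vector_mul_component inner_axis transpose_def
        del: transpose_matrix_vector) (auto simp: axis_def)
  define M where "M = mat [:0, 1:] - (\<chi> i j. [:complex_of_real (T $ i $ j):])"
  define N where "N = (\<chi> j. if j = k then axis k 1 else M $ j)"
  have "det M = M $ k $ k * det N"
    unfolding N_def by (intro det_row_axis) (simp add: M_def mat_def row)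
  moreover have "N $ i $ i dvd det N"
    using \<open>i \<noteq> k\<close> by (intro det_column_axis_dvd) (simp add: N_def M_def mat_def col axis_def)
  moreover have "M $ k $ k = [:- complex_of_real \<nu>, 1:]" "N $ i $ i = [:- complex_of_real \<mu>, 1:]"
    using \<open>i \<noteq> k\<close> by (simp_all add: N_def M_def mat_def row col)
  ultimately show ?thesis
    by (metis M_def complex_char_poly_def dvd_refl mult.commute mult_dvd_mono)
qed

text \<open>
  In the flag spanned by an eigenvector and the kernel of the eigenfunctional, both eigenvalues
  occur on the diagonal.
\<close>

lemma complex_char_poly_eigen_pair:
  fixes A :: "real ^ 'm ^ 'm"
  assumes y: "A *v y = \<mu> *\<^sub>R y" "y \<noteq> 0" and r: "transpose A *v r = \<nu> *\<^sub>R r" "r \<noteq> 0"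
    and ry: "r \<bullet> y = 0"
  shows "[:- complex_of_real \<mu>, 1:] * [:- complex_of_real \<nu>, 1:] dvd complex_char_poly A"
proof -
  note transpose_matrix_vector [simp del]
  fix i :: 'm
  have "norm (y /\<^sub>R norm y) = 1" using y by simp
  \<comment> \<open>An orthogonal change of basis treats \<open>A\<close> and its transpose alike:
    \<open>r\<close> is transported by the same matrix as \<open>y\<close>, and
    \<open>r \<bullet> y = 0\<close> becomes \<open>s $ i = 0\<close>.\<close>
  then obtain S where S: "orthogonal_matrix S" "S *v axis i 1 = y /\<^sub>R norm y"
    using orthogonal_matrix_exists_basis by metis
  have SS: "transpose S ** S = mat 1" "S ** transpose S = mat 1"
    using S(1) by (simp_all add: orthogonal_matrix_def)
  define B where "B = transpose S ** A ** S"
  define s where "s = transpose S *v r"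
  have cB: "complex_char_poly B = complex_char_poly A"
    unfolding B_def by (rule complex_char_poly_conjugate[OF SS(1)])
  have "B *v axis i 1 = transpose S *v (A *v (y /\<^sub>R norm y))"
    by (simp add: B_def S flip: matrix_vector_mul_assoc)
  also have "\<dots> = \<mu> *\<^sub>R (transpose S *v (S *v axis i 1))"
    by (simp add: S y matrix_vector_mult_scaleR scaleR_left_commute)
  finally have Bi: "B *v axis i 1 = \<mu> *\<^sub>R axis i 1"
    by (simp add: matrix_vector_mul_assoc SS)
  have "transpose B *v s = (transpose S ** transpose A) *v ((S ** transpose S) *v r)"
    by (simp add: B_def s_def matrix_transpose_mul matrix_vector_mul_assoc matrix_mul_assoc)
  then have Bs: "transpose B *v s = \<nu> *\<^sub>R s"
    by (simp add: SS r s_def matrix_vector_mult_scaleR flip: matrix_vector_mul_assoc)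
  have "S *v s = r" by (simp add: s_def matrix_vector_mul_assoc SS)
  then have "s \<noteq> 0" using r by auto
  then obtain k where k: "s $ k \<noteq> 0" by (metis vec_eq_iff zero_index)
  have "s $ i = s \<bullet> axis i 1" by (simp add: inner_axis)
  also have "\<dots> = r \<bullet> (S *v axis i 1)" by (simp add: s_def dot_lmul_matrix flip: vector_transpose_matrix)
  also have "\<dots> = 0" by (simp add: S ry)
  finally have si: "s $ i = 0" .
  then have ik: "i \<noteq> k" using k by auto
  \<comment> \<open>A change of coordinates whose \<open>k\<close>-th coordinate is the functional
    \<open>s\<close>, admissible since \<open>s $ k\<close> is nonzero. It fixes
    \<open>axis i 1\<close> because \<open>s $ i = 0\<close>, so the eigenvector stays in
    place.\<close>
  define F :: "real ^ 'm ^ 'm" where "F = (\<chi> j. if j = k then s else axis j 1)"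
  have Fv: "(F *v x) $ j = (if j = k then s \<bullet> x else x $ j)" for x j
    by (simp add: F_def matrix_vector_mul_component inner_axis')
  have "inj ((*v) F)"
  proof (subst linear_injective_0[OF matrix_vector_mul_linear], safe)
    fix x assume x: "F *v x = 0"
    have 0: "x $ j = 0" if "j \<noteq> k" for j using Fv[of x j] x that by simp
    have "s \<bullet> x = (\<Sum>j\<in>UNIV. if j = k then s $ k * x $ k else 0)"
      unfolding inner_vec_def by (rule sum.cong) (auto simp: 0)
    then have "s $ k * x $ k = 0" using Fv[of x k] x by simp
    then show "x = 0" using 0 k by (metis mult_eq_0_iff vec_eq_iff zero_index)
  qed
  then obtain G where G: "G ** F = mat 1"
    using matrix_left_invertible_injective by blast
  then have FG: "F ** G = mat 1" by (simp add: matrix_left_right_inverse)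
  define T where "T = F ** B ** G"
  have "F *v axis i 1 = axis i 1"
    using ik si by (simp add: vec_eq_iff Fv inner_axis) (simp add: axis_def)
  then have Gi: "G *v axis i 1 = axis i 1"
    by (metis G matrix_vector_mul_assoc matrix_vector_mul_lid)
  have Ti: "T *v axis i 1 = \<mu> *\<^sub>R axis i 1"
    by (simp add: T_def Gi Bi matrix_vector_mult_scaleR \<open>F *v axis i 1 = axis i 1\<close> flip: matrix_vector_mul_assoc)
  have Fk: "transpose F *v axis k 1 = s"
    by (simp add: F_def vec_eq_iff matrix_vector_mul_component inner_axis transpose_def)
  have "transpose G *v s = (transpose G ** transpose F) *v axis k 1"
    by (simp add: Fk flip: matrix_vector_mul_assoc)
  then have Gk: "transpose G *v s = axis k 1"
    by (simp add: FG flip: matrix_transpose_mul)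
  have "transpose T *v axis k 1 = transpose G *v (transpose B *v (transpose F *v axis k 1))"
    by (simp add: T_def matrix_transpose_mul matrix_vector_mul_assoc matrix_mul_assoc)
  then have Tk: "transpose T *v axis k 1 = \<nu> *\<^sub>R axis k 1"
    by (simp add: Fk Bs Gk matrix_vector_mult_scaleR)
  have "complex_char_poly T = complex_char_poly A"
    unfolding T_def by (simp add: complex_char_poly_conjugate[OF FG] cB)
  with complex_char_poly_axis_factors[OF Ti Tk ik] show ?thesis by simp
qed

section \<open>The two largest entries of the sorted list of log moduli\<close>

lemma log_modulus_ge_root:
  assumes "poly (complex_char_poly A) z = 0"
  shows "ln (cmod z) \<le> log_modulus A 1"
proof -
  define M where "M = image_mset (\<lambda>z. ln (cmod z)) (proots (complex_char_poly A))"
  define l where "l = rev (sorted_list_of_multiset M)"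
  have "z \<in># proots (complex_char_poly A)"
    using assms by (simp add: complex_char_poly_nonzero)
  then have "ln (cmod z) \<in># M" by (auto simp: M_def)
  moreover have "set l = set_mset M" by (simp add: l_def)
  ultimately obtain i where i: "i < length l" "l ! i = ln (cmod z)"
    by (metis in_set_conv_nth)
  have "sorted (rev l)" by (simp add: l_def)
  from sorted_rev_nth_mono[OF this _ i(1), of 0] i show ?thesis
    by (simp add: log_modulus_def l_def M_def)
qed

text \<open>Divisibility by the product also covers a double root \<open>z = w\<close>, which two
  separate root hypotheses would miss. The multiset contains its maximum twice, so the descending
  list begins with it twice.\<close>

lemma log_modulus_double_root:
  assumes dvd: "[:- z, 1:] * [:- w, 1:] dvd complex_char_poly A"
    and z: "ln (cmod z) = log_modulus A 1" and w: "ln (cmod w) = log_modulus A 1"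
  shows "log_modulus A 2 = log_modulus A 1"
proof -
  define M where "M = image_mset (\<lambda>z. ln (cmod z)) (proots (complex_char_poly A))"
  define l where "l = rev (sorted_list_of_multiset M)"
  define m where "m = log_modulus A 1"
  obtain q where q: "complex_char_poly A = [:- z, 1:] * [:- w, 1:] * q" using dvd by (elim dvdE)
  have "q \<noteq> 0" using q complex_char_poly_nonzero[of A] by auto
  then have "proots (complex_char_poly A) = {#z#} + {#w#} + proots q"
    unfolding q by (subst proots_mult; simp del: mult_pCons_left mult_pCons_right)+
  then have M: "M = {#m, m#} + image_mset (\<lambda>z. ln (cmod z)) (proots q)"
    using z w by (simp add: M_def m_def)
  have ml: "mset l = M" by (simp add: l_def)
  have sl: "sorted (rev l)" by (simp add: l_def)
  have l0: "l ! 0 = m" and l1: "l ! 1 = log_modulus A 2"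
    by (simp_all add: m_def log_modulus_def l_def M_def)
  have "length l = size M" by (simp flip: ml)
  then have "length l \<ge> 2" by (simp add: M)
  then obtain a b r where l: "l = a # b # r"
    by (cases l; cases "tl l") auto
  have "b = m"
  proof (rule ccontr)
    assume "b \<noteq> m"
    then have b: "b < m" using sl l l0 by (simp add: sorted_append)
    moreover have "x \<le> b" if "x \<in> set r" for x using sl l that by (auto simp: sorted_append)
    ultimately have "m \<notin> set (b # r)" by force
    then have "count (mset l) m = 1" using l l0 by (simp add: not_in_iff[symmetric])
    then show False by (simp add: ml M)
  qed
  then show ?thesis using l l1 by (simp add: m_def)
qed

section \<open>Invariance of the log moduli under conjugation and change of lift\<close>

lemma log_modulus_conjugate:
  fixes A S T :: "real ^ 'm ^ 'm"
  assumes "S ** T = mat 1"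
  shows "log_modulus (S ** A ** T) k = log_modulus A k"
  by (simp add: log_modulus_def complex_char_poly_conjugate[OF assms])

lemma proots_pcompose_uminus:
  fixes p :: "complex poly"
  assumes "p \<noteq> 0"
  shows "proots (pcompose p [:0, -1:]) = image_mset uminus (proots p)"
proof -
  have "proots (pcompose (\<Prod>x\<in>#A. [:- x, 1:]) [:0, -1:]) = image_mset uminus A"
    for A :: "complex multiset"
  proof (induction A)
    case (add x A)
    have 1: "pcompose [:- x, 1:] [:0, -1:] = - [:x, 1:]"
      by (simp add: pcompose_pCons)
    have "(\<Prod>x\<in>#A. [:- x, 1:]) \<noteq> 0" by (auto simp: prod_mset_zero_iff)
    then have "pcompose (\<Prod>x\<in>#A. [:- x, 1:]) [:0, -1:] \<noteq> 0"
      by (subst pcompose_eq_0_iff) auto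
    then have "proots (pcompose [:- x, 1:] [:0, -1:] * pcompose (\<Prod>x\<in>#A. [:- x, 1:]) [:0, -1:]) =
        {#- x#} + image_mset uminus A"
      by (subst proots_mult) (simp_all only: 1 proots_uminus proots_linear_factor add.IH, auto)
    then show ?case by (simp add: pcompose_mult del: mult_pCons_left mult_pCons_right)
  qed (simp add: pcompose_1)
  note * = this[of "proots p"]
  have "p = smult (lead_coeff p) (\<Prod>x\<in>#proots p. [:- x, 1:])"
    by (simp add: complex_poly_decompose_multiset)
  then have "pcompose p [:0, -1:] = smult (lead_coeff p) (pcompose (\<Prod>x\<in>#proots p. [:- x, 1:]) [:0, -1:])"
    by (metis pcompose_smult)
  with * assms show ?thesis by simp
qed

text \<open>Needed because \<open>proximal\<close> and \<open>attracting_fixed_point\<close> may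
  pick different lifts of the same element. Up to sign, the characteristic polynomial of
  \<open>- A\<close> is that of \<open>A\<close> with X replaced by -X.\<close>

lemma log_modulus_uminus:
  fixes A :: "real ^ 'm ^ 'm"
  shows "log_modulus (- A) k = log_modulus A k"
proof -
  have "poly (complex_char_poly (- A)) z =
      poly (smult ((- 1) ^ CARD('m)) (pcompose (complex_char_poly A) [:0, -1:])) z" for z
  proof -
    have "mat z - complex_matrix (- A) = (\<chi> i. (- 1) *s (mat (- z) - complex_matrix A) $ i)"
      by (simp add: vec_eq_iff complex_matrix_def mat_def)
    then show ?thesis
      by (simp only: poly_complex_char_poly det_rows_mul) (simp add: poly_pcompose poly_complex_char_poly vec_lambda_eta
        flip: vector_minus_component)
  qed
  then have "poly (complex_char_poly (- A)) =
      poly (smult ((- 1) ^ CARD('m)) (pcompose (complex_char_poly A) [:0, -1:]))"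
    by (rule ext)
  then have "complex_char_poly (- A) = smult ((- 1) ^ CARD('m)) (pcompose (complex_char_poly A) [:0, -1:])"
    by (simp only: poly_eq_poly_eq_iff)
  then have "proots (complex_char_poly (- A)) = image_mset uminus (proots (complex_char_poly A))"
    by (simp add: proots_pcompose_uminus[OF complex_char_poly_nonzero])
  then show ?thesis by (simp add: log_modulus_def image_mset.compositionality o_def)
qed


section \<open>Perron--Frobenius theory for cones\<close>

lemma convex_cone_add_interior:
  fixes K :: "'a::real_normed_vector set"
  assumes K: "convex K" "cone K" and x: "x \<in> K" and z: "z \<in> interior K"
  shows "x + z \<in> interior K"
proof -
  have "(+) x ` interior K \<subseteq> interior K"
  proof (rule interior_maximal)
    show "(+) x ` interior K \<subseteq> K"
      using K x interior_subset[of K] convex_cone[of K] by auto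
    show "open ((+) x ` interior K)"
      by (simp add: open_translation)
  qed
  with z show ?thesis by blast
qed

lemma scaleR_interior_cone:
  fixes K :: "'a::real_normed_vector set"
  assumes "cone K" "z \<in> interior K" "c > 0"
  shows "c *\<^sub>R z \<in> interior K"
proof -
  have "(*\<^sub>R) c ` interior K \<subseteq> interior K"
  proof (rule interior_maximal)
    show "(*\<^sub>R) c ` interior K \<subseteq> K"
      using assms interior_subset[of K] by (auto simp: cone_def)
    show "open ((*\<^sub>R) c ` interior K)"
      using assms by (simp add: open_scaling)
  qed
  with assms show ?thesis by blast
qed

text \<open>On the unit vectors of \<open>K\<close> the functional attains a positive minimum;
  homogeneity gives the rest. The bound makes the slice \<open>a \<bullet> x = 1\<close> of the cone
  compact.\<close>

lemma salient_cone_norm_bound: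
  fixes K :: "'a::euclidean_space set"
  assumes K: "closed K" "cone K" and pos: "\<And>x. x \<in> K \<Longrightarrow> x \<noteq> 0 \<Longrightarrow> 0 < a \<bullet> x"
  obtains c where "0 < c" "\<And>x. x \<in> K \<Longrightarrow> c * norm x \<le> a \<bullet> x"
proof (cases "K \<inter> sphere 0 1 = {}")
  case True
  have "x = 0" if "x \<in> K" for x
  proof (rule ccontr)
    assume "x \<noteq> 0"
    then have "x /\<^sub>R norm x \<in> K \<inter> sphere 0 1" using that K(2) by (auto simp: cone_def)
    then show False using True by blast
  qed
  then have "1 * norm x \<le> a \<bullet> x" if "x \<in> K" for x using that by fastforce
  then show thesis by (intro that[of 1]) simp_all
next
  case False
  have "compact (K \<inter> sphere 0 1)" using K by (simp add: closed_Int_compact)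
  moreover have "continuous_on (K \<inter> sphere 0 1) (\<lambda>x. a \<bullet> x)" by (intro continuous_intros)
  ultimately obtain u where u: "u \<in> K \<inter> sphere 0 1"
    and min: "\<And>x. x \<in> K \<inter> sphere 0 1 \<Longrightarrow> a \<bullet> u \<le> a \<bullet> x"
    using continuous_attains_inf[of "K \<inter> sphere 0 1" "\<lambda>x. a \<bullet> x"] False by blast
  show thesis
  proof (rule that)
    show "0 < a \<bullet> u" using u pos[of u] by fastforce
    fix x assume x: "x \<in> K"
    show "(a \<bullet> u) * norm x \<le> a \<bullet> x"
    proof (cases "x = 0")
      case False
      then have "x /\<^sub>R norm x \<in> K \<inter> sphere 0 1" using x K(2) by (auto simp: cone_def)
      from min[OF this] False show ?thesis by (simp add: field_simps)
    qed simp
  qed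
qed

text \<open>Strict positivity makes the eigenvector interior, so that it is an order unit.\<close>

lemma strictly_positive_operator_eigenvector:
  fixes K :: "'a::euclidean_space set"
  assumes K: "closed K" "convex K" "cone K" and pos: "\<And>x. x \<in> K \<Longrightarrow> x \<noteq> 0 \<Longrightarrow> 0 < a \<bullet> x"
    and lin: "linear f" and strict: "\<And>x. x \<in> K \<Longrightarrow> x \<noteq> 0 \<Longrightarrow> f x \<in> interior K"
    and z: "z \<in> K" "z \<noteq> 0" and a: "a \<noteq> 0"
  obtains x r where "x \<in> interior K" "a \<bullet> x = 1" "0 < r" "f x = r *\<^sub>R x"
proof -
  define S where "S = {x \<in> K. a \<bullet> x = 1}"
  obtain c where c: "c > 0" "\<And>x. x \<in> K \<Longrightarrow> c * norm x \<le> a \<bullet> x"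
    using salient_cone_norm_bound[OF K(1,3) pos] by blast
  have "norm x \<le> 1 / c" if "x \<in> S" for x
    using c(1) c(2)[of x] that by (simp add: S_def field_simps)
  then have "bounded S" unfolding bounded_iff by blast
  moreover have "closed S"
    unfolding S_def using K closed_hyperplane[of a 1]
    by (metis (full_types) Collect_conj_eq Collect_mem_eq closed_Int)
  ultimately have "compact S" by (simp add: compact_eq_bounded_closed)
  moreover have "convex S"
    unfolding S_def using K convex_hyperplane[of a 1]
    by (metis (full_types) Collect_conj_eq Collect_mem_eq convex_Int)
  moreover have "z /\<^sub>R (a \<bullet> z) \<in> S"
    using K z pos[of z] by (auto simp: S_def cone_def)
  moreover have fS: "f x \<in> interior K \<and> f x \<in> K \<and> 0 < a \<bullet> f x" if "x \<in> S" for x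
  proof -
    have x: "x \<in> K" "x \<noteq> 0" using that by (auto simp: S_def)
    then have i: "f x \<in> interior K" by (rule strict)
    then have "f x \<in> K" using interior_subset by blast
    \<comment> \<open>Zero is not interior to \<open>K\<close>: otherwise a small negative multiple
      of \<open>a\<close> would lie in \<open>K\<close>, against \<open>pos\<close>.\<close>
    moreover have "f x \<noteq> 0"
    proof
      assume "f x = 0"
      then have "0 \<in> interior K" using i by simp
      then obtain e where e: "e > 0" "ball 0 e \<subseteq> K" by (auto simp: mem_interior)
      define y where "y = - (e / 2 / norm a) *\<^sub>R a"
      have "norm y = e / 2" using e a by (simp add: y_def)
      then have "y \<in> K" "y \<noteq> 0" using e by (auto simp: subset_eq)
      then have "a \<bullet> y > 0" by (rule pos)
      moreover have "a \<bullet> y \<le> 0" using e by (simp add: y_def)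
      ultimately show False by simp
    qed
    ultimately show ?thesis using pos i by blast
  qed
  \<comment> \<open>Rescaled to the slice, \<open>f\<close> is a continuous self-map of the compact
    convex set \<open>S\<close>; a Brouwer fixed point is an eigenvector with eigenvalue
    \<open>a \<bullet> f x\<close>.\<close>
  moreover have "continuous_on S (\<lambda>x. f x /\<^sub>R (a \<bullet> f x))"
    using lin fS by (intro continuous_intros linear_continuous_on) (force simp: linear_conv_bounded_linear)+
  moreover have "(\<lambda>x. f x /\<^sub>R (a \<bullet> f x)) \<in> S \<rightarrow> S"
    using fS K(3) by (fastforce simp: S_def cone_def)
  ultimately obtain x where x: "x \<in> S" "f x /\<^sub>R (a \<bullet> f x) = x"
    using brouwer[of S "\<lambda>x. f x /\<^sub>R (a \<bullet> f x)"] by blast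
  show thesis
  proof
    show 1: "0 < a \<bullet> f x" using fS x by blast
    show "f x = (a \<bullet> f x) *\<^sub>R x"
    proof -
      have "(a \<bullet> f x) *\<^sub>R x = (a \<bullet> f x) *\<^sub>R (f x /\<^sub>R (a \<bullet> f x))" by (simp only: x(2))
      also have "\<dots> = f x" using 1 by simp
      finally show ?thesis ..
    qed
    have "inverse (a \<bullet> f x) *\<^sub>R f x \<in> interior K"
      using fS[OF x(1)] 1 by (intro scaleR_interior_cone K) auto
    then show "x \<in> interior K" using x(2) by simp
    show "a \<bullet> x = 1" using x by (simp add: S_def)
  qed
qed

text \<open>In the order defined by \<open>K\<close>, the interior vector \<open>x\<close> dominates
  s p and -s p for small s, and f x is at most r x. Iterating, r^k x dominates s \<mu>^k p with
  either sign. If |\<mu>| exceeded \<open>r\<close>, dividing by |\<mu>|^k and passing to the limit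
  would put both s p and -s p into the salient cone.\<close>

lemma cone_order_unit_eigenvalue_bound:
  fixes K :: "'a::euclidean_space set"
  assumes K: "closed K" "convex K" "cone K" and pos: "\<And>x. x \<in> K \<Longrightarrow> x \<noteq> 0 \<Longrightarrow> 0 < a \<bullet> x"
    and lin: "linear f" and fK: "f ` K \<subseteq> K" and x: "x \<in> interior K" and r: "0 < r"
    and fx: "r *\<^sub>R x - f x \<in> K" and p: "p \<noteq> 0" "f p = \<mu> *\<^sub>R p"
  shows "\<bar>\<mu>\<bar> \<le> r"
proof (rule ccontr)
  assume "\<not> \<bar>\<mu>\<bar> \<le> r"
  then have gt: "\<bar>\<mu>\<bar> > r" by simp
  have addK: "u + v \<in> K" if "u \<in> K" "v \<in> K" for u v
    using K that convex_cone by blast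
  have scK: "c *\<^sub>R u \<in> K" if "u \<in> K" "c \<ge> 0" for u c
    using K that by (simp add: cone_def)
  obtain e where e: "e > 0" "ball x e \<subseteq> K" using x by (auto simp: mem_interior)
  define s where "s = e / 2 / norm p"
  have s: "s > 0" "norm (s *\<^sub>R p) < e" using e p by (auto simp: s_def)
  have iter: "r ^ k *\<^sub>R x + (s * \<mu> ^ k) *\<^sub>R p \<in> K \<and> r ^ k *\<^sub>R x - (s * \<mu> ^ k) *\<^sub>R p \<in> K" for k
  proof (induction k)
    case 0
    have "x + s *\<^sub>R p \<in> ball x e" "x - s *\<^sub>R p \<in> ball x e"
      using s by (auto simp: dist_norm)
    then show ?case using e by auto
  next
    case (Suc k)
    have *: "r ^ Suc k *\<^sub>R x + (s' * \<mu> ^ Suc k) *\<^sub>R p \<in> K"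
      if "r ^ k *\<^sub>R x + (s' * \<mu> ^ k) *\<^sub>R p \<in> K" for s'
    proof -
      have "f (r ^ k *\<^sub>R x + (s' * \<mu> ^ k) *\<^sub>R p) \<in> K" using that fK by blast
      then have "r ^ k *\<^sub>R f x + (s' * \<mu> ^ Suc k) *\<^sub>R p \<in> K"
        using lin p by (simp add: linear_add linear_scale mult_ac)
      moreover have "r ^ k *\<^sub>R (r *\<^sub>R x - f x) \<in> K" using fx r by (intro scK) auto
      ultimately have "(r ^ k *\<^sub>R f x + (s' * \<mu> ^ Suc k) *\<^sub>R p) + r ^ k *\<^sub>R (r *\<^sub>R x - f x) \<in> K"
        by (rule addK)
      then show ?thesis by (simp add: algebra_simps)
    qed
    show ?case using *[of s] *[of "-s"] Suc by simp
  qed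
  let ?t = "\<bar>\<mu>\<bar> / r"
  have t: "?t > 1" using gt r by simp
  have lim: "(\<lambda>k. inverse ?t ^ k) \<longlonglongrightarrow> 0"
    using t gt r by (intro LIMSEQ_power_zero) (simp add: field_simps)
  have mem: "inverse ?t ^ k *\<^sub>R x + s *\<^sub>R p \<in> K \<and> inverse ?t ^ k *\<^sub>R x - s *\<^sub>R p \<in> K" for k
  proof -
    define m where "m = \<bar>\<mu>\<bar> ^ k"
    have m: "m > 0" using gt r by (simp add: m_def)
    have abs: "\<bar>\<mu> ^ k\<bar> = m" by (simp add: m_def power_abs)
    have it: "r ^ k *\<^sub>R x + (s * m) *\<^sub>R p \<in> K" "r ^ k *\<^sub>R x - (s * m) *\<^sub>R p \<in> K"
      using iter[of k] abs by (auto simp: abs_if split: if_splits)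
    have 1: "inverse m * (s * m) = s" using m by simp
    have 2: "inverse m * r ^ k = inverse ?t ^ k"
      by (simp add: m_def power_divide power_inverse divide_inverse mult.commute power_mult_distrib)
    have "inverse m *\<^sub>R (r ^ k *\<^sub>R x + (s * m) *\<^sub>R p) \<in> K"
      "inverse m *\<^sub>R (r ^ k *\<^sub>R x - (s * m) *\<^sub>R p) \<in> K"
      using it m by (auto intro!: scK)
    then show ?thesis
      by (simp only: scaleR_add_right scaleR_diff_right scaleR_scaleR 1 2)
  qed
  have "(\<lambda>k. inverse ?t ^ k *\<^sub>R x + s *\<^sub>R p) \<longlonglongrightarrow> 0 *\<^sub>R x + s *\<^sub>R p"
    "(\<lambda>k. inverse ?t ^ k *\<^sub>R x - s *\<^sub>R p) \<longlonglongrightarrow> 0 *\<^sub>R x - s *\<^sub>R p"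
    by (intro tendsto_intros lim)+
  then have "s *\<^sub>R p \<in> K" "- (s *\<^sub>R p) \<in> K"
    using closed_sequentially[OF K(1)] mem by fastforce+
  then have "a \<bullet> (s *\<^sub>R p) > 0" "a \<bullet> - (s *\<^sub>R p) > 0" using pos p s by (metis neg_equal_0_iff_equal scaleR_eq_0_iff less_irrefl)+
  then show False by simp
qed

text \<open>Adding a small rank one map with values on the ray of an interior vector
  \<open>z\<close> makes \<open>f\<close> strictly positive; the eigenvectors of these perturbations
  lie in a compact slice and accumulate at the desired one. The limit may be on the boundary of
  \<open>K\<close> and need not be an order unit, so the bound on the other eigenvalues is proved
  before the limit is taken.\<close>

lemma cone_perron_frobenius:
  fixes K :: "'a::euclidean_space set"
  assumes K: "closed K" "convex K" "cone K" and pos: "\<And>x. x \<in> K \<Longrightarrow> x \<noteq> 0 \<Longrightarrow> 0 < a \<bullet> x"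
    and int: "interior K \<noteq> {}" and lin: "linear f" and fK: "f ` K \<subseteq> K"
  obtains y r where "y \<in> K" "y \<noteq> 0" "f y = r *\<^sub>R y"
    "\<And>p \<mu>. p \<noteq> 0 \<Longrightarrow> f p = \<mu> *\<^sub>R p \<Longrightarrow> \<bar>\<mu>\<bar> \<le> r"
proof -
  have "\<not> interior K \<subseteq> {0}"
    using int by (metis finite.emptyI finite_insert finite_subset finite_imp_not_open open_interior)
  then obtain z where z: "z \<in> interior K" "z \<noteq> 0" by auto
  have zK: "z \<in> K" using z interior_subset by blast
  have a: "a \<noteq> 0" using pos[OF zK z(2)] by auto
  define e where "e n = inverse (real (Suc n))" for n
  define g where "g n x = f x + (e n * (a \<bullet> x)) *\<^sub>R z" for n x
  have e0: "e n > 0" for n by (simp add: e_def)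
  have g_lin: "linear (g n)" for n
    by (rule linearI)
      (simp_all add: g_def linear_add[OF lin] linear_scale[OF lin] algebra_simps inner_add_right)
  have g_int: "g n x \<in> interior K" if "x \<in> K" "x \<noteq> 0" for n x
    unfolding g_def
  proof (rule convex_cone_add_interior[OF K(2,3)])
    show "f x \<in> K" using that fK by blast
    show "(e n * (a \<bullet> x)) *\<^sub>R z \<in> interior K"
      using pos[OF that] e0[of n] by (intro scaleR_interior_cone K z) simp
  qed
  have "\<exists>x r. x \<in> interior K \<and> a \<bullet> x = 1 \<and> 0 < r \<and> g n x = r *\<^sub>R x" for n
    using strictly_positive_operator_eigenvector[OF K pos g_lin g_int zK z(2) a] by metis
  then obtain x r where x: "\<And>n. x n \<in> interior K" "\<And>n. a \<bullet> x n = 1" "\<And>n. 0 < r n"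
      "\<And>n. g n (x n) = r n *\<^sub>R x n"
    by metis
  have xK: "x n \<in> K" for n using x(1) interior_subset by blast
  obtain c where c: "c > 0" "\<And>x. x \<in> K \<Longrightarrow> c * norm x \<le> a \<bullet> x"
    using salient_cone_norm_bound[OF K(1,3) pos] by blast
  have "norm (x n) \<le> 1 / c" for n
    using c(1) c(2)[OF xK[of n]] x(2)[of n] by (simp add: field_simps)
  then have xB: "\<forall>n. x n \<in> K \<inter> cball 0 (1 / c)" using xK by simp
  have "seq_compact (K \<inter> cball 0 (1 / c))"
    using K by (simp add: closed_Int_compact compact_imp_seq_compact)
  then obtain y h where yB: "y \<in> K \<inter> cball 0 (1 / c)" and h: "strict_mono h"
    and "(x \<circ> h) \<longlonglongrightarrow> y"
    using xB by (rule seq_compactE)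
  then have y: "y \<in> K" and lim: "(\<lambda>n. x (h n)) \<longlonglongrightarrow> y" by (simp_all add: o_def)
  have lim_e: "(\<lambda>n. e (h n)) \<longlonglongrightarrow> 0"
    using LIMSEQ_subseq_LIMSEQ[OF LIMSEQ_inverse_real_of_nat h] by (simp add: e_def o_def)
  have bl: "bounded_linear f" using lin by (simp add: linear_conv_bounded_linear)
  have lim_g: "(\<lambda>n. g (h n) (x (h n))) \<longlonglongrightarrow> f y + (0 * (a \<bullet> y)) *\<^sub>R z"
    unfolding g_def by (intro tendsto_intros bounded_linear.tendsto[OF bl] lim lim_e)
  have r_eq: "r n = a \<bullet> g n (x n)" for n by (simp add: x(2) x(4))
  have lim_r: "(\<lambda>n. r (h n)) \<longlonglongrightarrow> a \<bullet> f y"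
    unfolding r_eq using tendsto_inner[OF tendsto_const lim_g, of a] by simp
  have ay: "a \<bullet> y = 1"
    using LIMSEQ_unique[OF tendsto_inner[OF tendsto_const lim, of a]] x(2) by auto
  show thesis
  proof
    show "y \<in> K" "y \<noteq> 0" using y ay by auto
    have "(\<lambda>n. r (h n) *\<^sub>R x (h n)) \<longlonglongrightarrow> (a \<bullet> f y) *\<^sub>R y" by (intro tendsto_intros lim lim_r)
    then have "(\<lambda>n. g (h n) (x (h n))) \<longlonglongrightarrow> (a \<bullet> f y) *\<^sub>R y" by (simp only: x(4))
    from LIMSEQ_unique[OF lim_g this] show "f y = (a \<bullet> f y) *\<^sub>R y"
      by (simp only: mult_zero_left scaleR_zero_left add_0_right)
    fix p \<mu> assume p: "p \<noteq> 0" "f p = \<mu> *\<^sub>R p"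
    have "\<bar>\<mu>\<bar> \<le> r n" for n
    proof (rule cone_order_unit_eigenvalue_bound[OF K pos lin fK x(1)[of n] x(3)[of n] _ p])
      have "r n *\<^sub>R x n - f (x n) = e n *\<^sub>R z"
        using x(4)[of n] by (simp add: g_def x(2) algebra_simps)
      then show "r n *\<^sub>R x n - f (x n) \<in> K"
        using e0[of n] zK K(3) by (simp add: cone_def)
    qed
    then show "\<bar>\<mu>\<bar> \<le> a \<bullet> f y"
      using LIMSEQ_le_const[OF lim_r] by blast
  qed
qed


section \<open>The isometry group\<close>

text \<open>The Gram matrix J of the form, as a map. It converts the form into the Euclidean inner
  product, and thus form-adjoints into transposes.\<close>

definition ads_flip :: "real ^ ('n::finite + 2) \<Rightarrow> real ^ ('n + 2)" where
  "ads_flip x = (\<chi> k. case k of Inl i \<Rightarrow> x $ Inl i | Inr j \<Rightarrow> - x $ Inr j)"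

lemma ads_form_inner: "ads_form x y = x \<bullet> ads_flip y"
proof -
  have "x \<bullet> ads_flip y = (\<Sum>k\<in>UNIV <+> UNIV. x $ k * ads_flip y $ k)"
    by (simp add: inner_vec_def)
  also have "\<dots> = ads_form x y"
    by (subst sum.Plus) (simp_all add: ads_form_def ads_flip_def sum_negf)
  finally show ?thesis ..
qed

lemma linear_ads_flip: "linear ads_flip"
  by (rule linearI) (auto simp: ads_flip_def vec_eq_iff split: sum.split)

lemma ads_flip_flip [simp]: "ads_flip (ads_flip x) = x"
  by (auto simp: ads_flip_def vec_eq_iff split: sum.split)

lemma ads_form_commute: "ads_form x y = ads_form y x"
  by (simp add: ads_form_def mult.commute)

lemma bounded_bilinear_ads_form: "bounded_bilinear ads_form"
proof -
  have "bounded_bilinear (\<lambda>x y. x \<bullet> ads_flip y)"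
    using linear_ads_flip
    by (intro bounded_bilinear.comp[OF bounded_bilinear_inner bounded_linear_ident])
      (simp add: linear_conv_bounded_linear)
  then show ?thesis by (simp add: ads_form_inner[abs_def])
qed

interpretation ads_form: bounded_bilinear ads_form
  by (rule bounded_bilinear_ads_form)

lemmas ads_form_simps = ads_form.add_left ads_form.add_right ads_form.diff_left ads_form.diff_right
  ads_form.scaleR_left ads_form.scaleR_right ads_form.minus_left ads_form.minus_right
  ads_form.zero_left ads_form.zero_right

lemma ads_form_nondegenerate:
  assumes "\<And>y. ads_form x y = 0"
  shows "x = 0"
  using assms[of "ads_flip x"] by (simp add: ads_form_inner)

lemma O_n_2_iff: "A \<in> carrier O_n_2 \<longleftrightarrow> (\<forall>x y. ads_form (A *v x) (A *v y) = ads_form x y)"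
  by (simp add: O_n_2_def)

lemma O_n_2_form: "A \<in> carrier O_n_2 \<Longrightarrow> ads_form (A *v x) (A *v y) = ads_form x y"
  by (simp add: O_n_2_iff)

lemma mult_O_n_2 [simp]: "A \<otimes>\<^bsub>O_n_2\<^esub> B = A ** B"
  by (simp add: O_n_2_def)

lemma one_O_n_2 [simp]: "\<one>\<^bsub>O_n_2\<^esub> = mat 1"
  by (simp add: O_n_2_def)

text \<open>The relation A^T J A = J. It turns eigenvectors of the inverse of \<open>A\<close> into
  eigenvectors of the transpose.\<close>

lemma O_n_2_transpose:
  assumes "A \<in> carrier O_n_2"
  shows "transpose A *v ads_flip (A *v x) = ads_flip x"
proof -
  have "y \<bullet> (transpose A *v ads_flip (A *v x)) = y \<bullet> ads_flip x" for y
    using O_n_2_form[OF assms, of y x]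
    by (simp add: ads_form_inner) (metis dot_lmul_matrix inner_commute)
  then show ?thesis by (metis vector_eq_ldot)
qed

lemma O_n_2_inverse:
  assumes "A \<in> carrier O_n_2"
  obtains B where "B \<in> carrier O_n_2" "A ** B = mat 1" "B ** A = mat 1"
proof -
  have "inj ((*v) A)"
  proof (subst linear_injective_0[OF matrix_vector_mul_linear], safe)
    fix x assume "A *v x = 0"
    then have "ads_form x y = 0" for y using O_n_2_form[OF assms, of x y] by (simp add: ads_form_simps)
    then show "x = 0" by (rule ads_form_nondegenerate)
  qed
  then obtain B where B: "B ** A = mat 1"
    using matrix_left_invertible_injective by blast
  then have AB: "A ** B = mat 1" by (simp add: matrix_left_right_inverse)
  have "ads_form (B *v x) (B *v y) = ads_form x y" for x y
    using O_n_2_form[OF assms, of "B *v x" "B *v y"] by (simp add: matrix_vector_mul_assoc AB)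
  then have "B \<in> carrier O_n_2" by (simp add: O_n_2_iff)
  then show thesis using that B AB by blast
qed

lemma group_O_n_2: "group O_n_2"
proof (rule groupI)
  fix A B :: "real ^ ('n::finite + 2) ^ ('n + 2)"
  assume A: "A \<in> carrier O_n_2"
  from O_n_2_inverse[OF A] show "\<exists>B\<in>carrier O_n_2. B \<otimes>\<^bsub>O_n_2\<^esub> A = \<one>\<^bsub>O_n_2\<^esub>"
    by (metis mult_O_n_2 one_O_n_2)
  assume B: "B \<in> carrier O_n_2"
  then show "A \<otimes>\<^bsub>O_n_2\<^esub> B \<in> carrier O_n_2"
    using A by (simp add: O_n_2_iff flip: matrix_vector_mul_assoc)
qed (simp_all add: matrix_mul_assoc O_n_2_iff)

lemma uminus_matrix_mult: "(- A) ** B = - (A ** B)" "A ** (- B) = - (A ** B)"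
  for A B :: "real ^ 'n ^ 'n"
  by (simp_all add: matrix_matrix_mult_def vec_eq_iff sum_negf)

lemma uminus_matrix_vector_mult: "(- A) *v x = - (A *v x)" for A :: "real ^ 'n ^ 'n"
  by (simp add: matrix_vector_mult_def vec_eq_iff sum_negf)

lemma uminus_in_O_n_2: "A \<in> carrier O_n_2 \<Longrightarrow> - A \<in> carrier O_n_2"
  by (simp add: O_n_2_iff uminus_matrix_vector_mult ads_form_simps)

lemma plus_minus_Id_coset: "plus_minus_Id #>\<^bsub>O_n_2\<^esub> A = {A, - A}"
  by (auto simp: r_coset_def uminus_matrix_mult)

lemma plus_minus_Id_lcoset: "A <#\<^bsub>O_n_2\<^esub> plus_minus_Id = {A, - A}"
  by (auto simp: l_coset_def uminus_matrix_mult)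

lemma normal_plus_minus_Id: "normal plus_minus_Id O_n_2"
proof -
  interpret group O_n_2 by (rule group_O_n_2)
  have one: "mat 1 \<in> carrier O_n_2" using one_closed by simp
  have mm: "- mat 1 \<otimes>\<^bsub>O_n_2\<^esub> - mat 1 = \<one>\<^bsub>O_n_2\<^esub>" by (simp add: uminus_matrix_mult)
  have inv: "inv\<^bsub>O_n_2\<^esub> (- mat 1) = - mat 1"
    by (rule inv_equality[OF mm]) (use one uminus_in_O_n_2 in auto)
  have "subgroup plus_minus_Id O_n_2"
  proof (rule subgroupI)
    show "plus_minus_Id \<subseteq> carrier O_n_2" using one uminus_in_O_n_2 by auto
    show "inv\<^bsub>O_n_2\<^esub> a \<in> plus_minus_Id" if "a \<in> plus_minus_Id" for a
      using that inv inv_one by auto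
    show "a \<otimes>\<^bsub>O_n_2\<^esub> b \<in> plus_minus_Id" if "a \<in> plus_minus_Id" "b \<in> plus_minus_Id" for a b
      using that by (auto simp: uminus_matrix_mult)
  qed simp
  then show ?thesis
    by (rule normalI) (simp add: plus_minus_Id_coset plus_minus_Id_lcoset)
qed

lemma group_PO_n_2: "group PO_n_2"
  unfolding PO_n_2_def by (rule normal.factorgroup_is_group[OF normal_plus_minus_Id])

lemma PO_n_2_lift:
  assumes "g \<in> carrier PO_n_2" "A \<in> g"
  shows "A \<in> carrier O_n_2" "g = {A, - A}"
proof -
  obtain B where B: "B \<in> carrier O_n_2" "g = {B, - B}"
    using assms by (auto simp: PO_n_2_def FactGroup_def RCOSETS_def plus_minus_Id_coset)
  then show "A \<in> carrier O_n_2" "g = {A, - A}" using assms uminus_in_O_n_2 by auto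
qed

lemma PO_n_2_lift_exists:
  assumes "g \<in> carrier PO_n_2"
  obtains A where "A \<in> g"
  using assms by (auto simp: PO_n_2_def FactGroup_def RCOSETS_def plus_minus_Id_coset)

lemma PO_n_2_mult:
  assumes "A \<in> g" "B \<in> h"
  shows "A ** B \<in> g \<otimes>\<^bsub>PO_n_2\<^esub> h"
  using assms by (auto simp: PO_n_2_def FactGroup_def set_mult_def)

text \<open>A lift of the inverse element inverts \<open>A\<close> only up to sign; the sign is
  absorbed by passing to the other lift.\<close>

lemma PO_n_2_inv:
  assumes g: "g \<in> carrier PO_n_2" and A: "A \<in> g"
  obtains B where "B \<in> inv\<^bsub>PO_n_2\<^esub> g" "A ** B = mat 1" "B ** A = mat 1"
proof -
  interpret group PO_n_2 by (rule group_PO_n_2)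
  obtain B where B: "B \<in> inv\<^bsub>PO_n_2\<^esub> g" using PO_n_2_lift_exists g inv_closed by metis
  have "B ** A \<in> \<one>\<^bsub>PO_n_2\<^esub>"
    using PO_n_2_mult[OF B A] l_inv[OF g] by simp
  moreover have "\<one>\<^bsub>PO_n_2\<^esub> = plus_minus_Id"
    by (simp add: PO_n_2_def FactGroup_def)
  ultimately consider "B ** A = mat 1" | "B ** A = - mat 1" by auto
  then show thesis
  proof cases
    case 1
    then show ?thesis using that[OF B] matrix_left_right_inverse by blast
  next
    case 2
    then have m: "(- B) ** A = mat 1" by (simp add: uminus_matrix_mult)
    have "- B \<in> inv\<^bsub>PO_n_2\<^esub> g" using PO_n_2_lift(2)[OF inv_closed[OF g] B] by auto
    then show ?thesis using that m matrix_left_right_inverse by blast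
  qed
qed


section \<open>Projective space and the action\<close>

lemma line_of_rp_class: "x \<noteq> 0 \<Longrightarrow> line_of (rp_class x) = span {x}"
  unfolding rp_class_def by (rule rp_of_line_inverse) blast

lemma rp_class_surj:
  obtains x where "x \<noteq> 0" "p = rp_class x"
proof -
  obtain x where "x \<noteq> 0" "line_of p = span {x}" using line_of[of p] by blast
  then show thesis using that by (metis line_of_inverse rp_class_def)
qed

lemma rp_class_eq_iff:
  assumes "x \<noteq> 0" "y \<noteq> 0"
  shows "rp_class x = rp_class y \<longleftrightarrow> (\<exists>c. c \<noteq> 0 \<and> y = c *\<^sub>R x)"
proof
  assume "rp_class x = rp_class y"
  then have "span {x} = span {y}" using assms by (metis line_of_rp_class)
  then have "y \<in> span {x}" by (metis insertI1 span_base)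
  then obtain c where "y = c *\<^sub>R x" by (auto simp: span_singleton)
  then show "\<exists>c. c \<noteq> 0 \<and> y = c *\<^sub>R x" using assms by auto
next
  assume "\<exists>c. c \<noteq> 0 \<and> y = c *\<^sub>R x"
  then obtain c where "c \<noteq> 0" "y = c *\<^sub>R x" by blast
  then have "span {x} = span {y}"
    using span_image_scale[of "{x}" "\<lambda>_. c"] by simp
  then show "rp_class x = rp_class y" by (simp add: rp_class_def)
qed

lemma rp_class_scaleR [simp]: "c \<noteq> 0 \<Longrightarrow> rp_class (c *\<^sub>R x) = rp_class x"
proof (cases "x = 0")
  case False
  assume "c \<noteq> 0"
  then show ?thesis using False rp_class_eq_iff[of x "c *\<^sub>R x"] by force
qed simp

lemma rp_class_uminus [simp]: "rp_class (- x) = rp_class x"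
  using rp_class_scaleR[of "-1" x] by simp

lemma open_rp_iff: "open U \<longleftrightarrow> open {x :: real ^ 'm. x \<noteq> 0 \<and> rp_class x \<in> U}"
  for U :: "'m::finite rp set"
  by (rule open_rp_def)

lemma continuous_on_rp_class: "continuous_on (- {0 :: real ^ 'm::finite}) rp_class"
proof -
  have "open (rp_class -` B \<inter> - {0 :: real ^ 'm})" if "open B" for B
  proof -
    have "{x :: real ^ 'm. x \<noteq> 0 \<and> rp_class x \<in> B} = rp_class -` B \<inter> - {0}" by auto
    then show ?thesis using that by (simp add: open_rp_iff)
  qed
  then show ?thesis by (simp add: continuous_on_open_vimage open_Compl)
qed

lemma tendsto_rp_class:
  assumes "(f \<longlongrightarrow> l) F" "l \<noteq> 0"
  shows "((\<lambda>x. rp_class (f x)) \<longlongrightarrow> rp_class l) F"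
  using assms continuous_on_rp_class
  by (intro isCont_tendsto_compose[of l rp_class])
    (auto simp: continuous_on_eq_continuous_at open_Compl)

text \<open>\<open>rp_class 0\<close> is unspecified, and the cone over a nonempty set accumulates
  at 0; inserting 0 settles both.\<close>

lemma closed_rp_iff: "closed F \<longleftrightarrow> closed (insert 0 {x :: real ^ 'm. rp_class x \<in> F})"
  for F :: "'m::finite rp set"
proof -
  have "{x :: real ^ 'm. x \<noteq> 0 \<and> rp_class x \<in> - F} = - insert 0 {x. rp_class x \<in> F}" by auto
  then show ?thesis by (simp only: closed_def open_rp_iff)
qed

lemma act_rp_class:
  assumes g: "g \<in> carrier PO_n_2" and A: "A \<in> g" and x: "x \<noteq> 0"
  shows "act g (rp_class x) = rp_class (A *v x)"
proof -
  have "(\<Union>B\<in>g. (\<lambda>x. B *v x) ` line_of (rp_class x)) = span {A *v x}"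
  proof -
    have "(\<lambda>y. A *v y) ` span {x} = span {A *v x}"
      by (metis image_empty image_insert linear_span_image matrix_vector_mul_linear)
    moreover have "(\<lambda>y. (- A) *v y) ` span {x} = span {A *v x}"
    proof -
      have "(\<lambda>y. (- A) *v y) ` span {x} = span {- (A *v x)}"
        using linear_span_image[OF matrix_vector_mul_linear[of "- A"], of "{x}"]
        by (simp add: uminus_matrix_vector_mult)
      also have "\<dots> = span {A *v x}"
        using span_image_scale[of "{A *v x}" "\<lambda>_. -1"] by simp
      finally show ?thesis .
    qed
    ultimately show ?thesis
      by (simp add: PO_n_2_lift(2)[OF g A] line_of_rp_class[OF x])
  qed
  then show ?thesis by (simp add: act_def rp_class_def)
qed

lemma O_n_2_mult_nonzero: "A \<in> carrier O_n_2 \<Longrightarrow> x \<noteq> 0 \<Longrightarrow> A *v x \<noteq> 0"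
  by (metis O_n_2_inverse matrix_vector_mul_assoc matrix_vector_mul_lid matrix_vector_mult_0_right)

section \<open>Invariance of the limit set\<close>

lemma attracting_fixed_point_conjugate:
  assumes g: "g \<in> carrier PO_n_2" "A \<in> g" and h: "h \<in> carrier PO_n_2" "proximal h"
    and x: "x \<noteq> 0" "attracting_fixed_point h (rp_class x)"
  defines "k \<equiv> g \<otimes>\<^bsub>PO_n_2\<^esub> h \<otimes>\<^bsub>PO_n_2\<^esub> inv\<^bsub>PO_n_2\<^esub> g"
  shows "proximal k" "attracting_fixed_point k (rp_class (A *v x))"
proof -
  obtain B where B: "B \<in> inv\<^bsub>PO_n_2\<^esub> g" and AB: "A ** B = mat 1" and BA: "B ** A = mat 1"
    using PO_n_2_inv[OF g] by metis
  have in_k: "A ** C ** B \<in> k" if "C \<in> h" for C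
    unfolding k_def by (intro PO_n_2_mult g B that)
  show "proximal k"
    using h(2) in_k log_modulus_conjugate[OF AB] unfolding proximal_def by metis
  obtain C \<mu> y where C: "C \<in> h" "\<bar>\<mu>\<bar> = exp (log_modulus C 1)" "y \<noteq> 0" "C *v y = \<mu> *\<^sub>R y"
    "rp_class x = rp_class y"
    using x(2) unfolding attracting_fixed_point_def by metis
  obtain c where c: "c \<noteq> 0" "y = c *\<^sub>R x" using C x rp_class_eq_iff by metis
  have "c *\<^sub>R (C *v x) = c *\<^sub>R (\<mu> *\<^sub>R x)"
    using C(4) c by (simp add: matrix_vector_mult_scaleR mult.commute)
  then have "C *v x = \<mu> *\<^sub>R x" using c(1) by (simp only: scaleR_cancel_left) simp
  moreover have "(A ** C ** B) *v (A *v x) = A *v (C *v ((B ** A) *v x))"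
    by (simp add: matrix_vector_mul_assoc matrix_mul_assoc)
  ultimately have "(A ** C ** B) *v (A *v x) = \<mu> *\<^sub>R (A *v x)"
    by (simp add: BA matrix_vector_mult_scaleR)
  moreover have "A *v x \<noteq> 0"
    using O_n_2_mult_nonzero PO_n_2_lift(1)[OF g] x(1) by blast
  ultimately show "attracting_fixed_point k (rp_class (A *v x))"
    unfolding attracting_fixed_point_def
    by (intro bexI[OF _ in_k[OF C(1)]] exI[of _ \<mu>] exI[of _ "A *v x"])
      (simp add: log_modulus_conjugate[OF AB] C(2))
qed

text \<open>Conjugation by \<open>g\<close> permutes the attracting fixed points. For the closure it
  suffices that the preimage of a closed set under \<open>g\<close> is closed, which is checked on
  cones in the vector space.\<close>

lemma limit_set_invariant:
  assumes \<Gamma>: "subgroup \<Gamma> PO_n_2" and g: "g \<in> \<Gamma>" "A \<in> g" and x: "x \<noteq> 0" "rp_class x \<in> limit_set \<Gamma>"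
  shows "rp_class (A *v x) \<in> limit_set \<Gamma>"
proof -
  have gc: "g \<in> carrier PO_n_2" using \<Gamma> g subgroup.mem_carrier by metis
  have nz: "A *v y \<noteq> 0" if "y \<noteq> 0" for y
    using O_n_2_mult_nonzero PO_n_2_lift(1)[OF gc g(2)] that by blast
  define P where "P = {p. \<exists>h\<in>\<Gamma>. proximal h \<and> attracting_fixed_point h p}"
  define F where "F = {p. act g p \<in> closure P}"
  have "act g (rp_class y) \<in> P" if y: "y \<noteq> 0" "rp_class y \<in> P" for y
  proof -
    obtain h where h: "h \<in> \<Gamma>" "proximal h" "attracting_fixed_point h (rp_class y)"
      using y by (auto simp: P_def)
    have hc: "h \<in> carrier PO_n_2" using \<Gamma> h subgroup.mem_carrier by metis
    have "g \<otimes>\<^bsub>PO_n_2\<^esub> h \<otimes>\<^bsub>PO_n_2\<^esub> inv\<^bsub>PO_n_2\<^esub> g \<in> \<Gamma>"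
      using \<Gamma> g h by (simp add: subgroup.m_closed subgroup.m_inv_closed)
    then show ?thesis
      using attracting_fixed_point_conjugate[OF gc g(2) hc h(2) y(1) h(3)]
      by (auto simp: P_def act_rp_class[OF gc g(2) y(1)])
  qed
  then have "act g p \<in> P" if "p \<in> P" for p
    using that rp_class_surj[of p] by metis
  then have "P \<subseteq> F"
    using closure_subset[of P] by (auto simp: F_def)
  moreover have "closed F"
  proof -
    have "insert 0 {x. rp_class x \<in> F} = (*v) A -` insert 0 {x. rp_class x \<in> closure P}"
    proof (rule Set.set_eqI)
      fix y show "y \<in> insert 0 {x. rp_class x \<in> F} \<longleftrightarrow>
          y \<in> (*v) A -` insert 0 {x. rp_class x \<in> closure P}"
        by (cases "y = 0") (simp_all add: F_def act_rp_class[OF gc g(2)] nz)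
    qed
    moreover have "closed (insert 0 {x. rp_class x \<in> closure P})"
      using closed_rp_iff[of "closure P"] closed_closure[of P] by blast
    moreover have "continuous_on UNIV ((*v) A)"
      by (intro linear_continuous_on matrix_vector_mul_bounded_linear)
    ultimately show ?thesis
      by (simp only: closed_rp_iff[of F] closed_vimage)
  qed
  ultimately have "closure P \<subseteq> F" by (rule closure_minimal)
  then show ?thesis
    using x act_rp_class[OF gc g(2) x(1)] by (auto simp: F_def limit_set_def P_def)
qed


section \<open>The invariant cone\<close>

text \<open>
  \<open>K\<close> is the cone over the closure of the convex set on which \<open>\<Gamma>\<close> acts, seen in the affine chart
  \<open>a \<bullet> x = 1\<close>.  The sign \<open>s\<close> selects the lift that does not exchange \<open>K\<close> and \<open>-K\<close>.
\<close>

locale acausal_cone =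
  fixes K :: "(real ^ ('n::finite + 2)) set" and a :: "real ^ ('n + 2)"
    and \<Gamma> :: "(real ^ ('n + 2) ^ ('n + 2)) set set"
  assumes closed_K: "closed K" and convex_K: "convex K" and cone_K: "cone K"
    and interior_K: "interior K \<noteq> {}"
    and pos: "x \<in> K \<Longrightarrow> x \<noteq> 0 \<Longrightarrow> 0 < a \<bullet> x"
    and form_nonpos: "x \<in> K \<Longrightarrow> ads_form x x \<le> 0"
    and acausal: "x \<in> K \<Longrightarrow> y \<in> K \<Longrightarrow> x \<noteq> 0 \<Longrightarrow> y \<noteq> 0 \<Longrightarrow>
      ads_form x x = 0 \<Longrightarrow> ads_form y y = 0 \<Longrightarrow> ads_form x y = 0 \<Longrightarrow> rp_class x = rp_class y"
    and subgroup_\<Gamma>: "subgroup \<Gamma> PO_n_2"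
    and invariant: "g \<in> \<Gamma> \<Longrightarrow> A \<in> g \<Longrightarrow> \<exists>s\<in>{1, -1}. \<forall>x\<in>K. s *\<^sub>R (A *v x) \<in> K"

lemma in_affine_chart_normalize:
  assumes "C \<subseteq> affine_chart a" "x \<noteq> 0" "rp_class x \<in> C"
  shows "a \<bullet> x \<noteq> 0" "x /\<^sub>R (a \<bullet> x) \<in> in_affine_chart a C"
proof -
  obtain y where y: "rp_class x = rp_class y" "a \<bullet> y \<noteq> 0"
    using assms by (auto simp: affine_chart_def)
  then have "y \<noteq> 0" by auto
  then obtain c where "c \<noteq> 0" "y = c *\<^sub>R x" using rp_class_eq_iff assms(2) y(1) by metis
  then show "a \<bullet> x \<noteq> 0" using y by auto
  then show "x /\<^sub>R (a \<bullet> x) \<in> in_affine_chart a C"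
    using assms by (simp add: in_affine_chart_def)
qed

lemma AdS_form_neg:
  assumes "x \<noteq> 0" "rp_class x \<in> AdS"
  shows "ads_form x x < 0"
proof -
  obtain y where y: "rp_class x = rp_class y" "y \<noteq> 0" "ads_form y y < 0"
    using assms by (auto simp: AdS_def)
  then obtain c where "c \<noteq> 0" "x = c *\<^sub>R y" using rp_class_eq_iff assms(1) by metis
  then show ?thesis using y by (simp add: ads_form_simps mult_pos_neg zero_less_mult_iff mult_less_0_iff)
      (metis linorder_neqE_linordered_idom)
qed

text \<open>The functional \<open>a\<close> has constant sign on the image of the slice: if it
  changed sign, it would vanish at the image of some point of the convex slice, and that image would
  leave the affine chart. The constant sign is the \<open>s\<close> of the conclusion.\<close>

lemma linear_image_affine_chart_cone:
  assumes conv: "convex (in_affine_chart a C)" and C: "C \<subseteq> affine_chart a"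
    and nz: "\<And>x. x \<noteq> 0 \<Longrightarrow> A *v x \<noteq> 0"
    and AC: "\<And>x. x \<noteq> 0 \<Longrightarrow> rp_class x \<in> C \<Longrightarrow> rp_class (A *v x) \<in> C"
  shows "\<exists>s\<in>{1, -1}. \<forall>x\<in>conic hull closure (in_affine_chart a C).
    s *\<^sub>R (A *v x) \<in> closure (conic hull (in_affine_chart a C))"
proof -
  let ?S = "in_affine_chart a C"
  have nonzero: "x \<noteq> 0" if "x \<in> ?S" for x using that by (auto simp: in_affine_chart_def)
  have Ax: "a \<bullet> (A *v x) \<noteq> 0 \<and> (A *v x) /\<^sub>R (a \<bullet> (A *v x)) \<in> ?S" if "x \<in> ?S" for x
    using in_affine_chart_normalize[OF C nz AC] nonzero[OF that] that by (auto simp: in_affine_chart_def)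
  have sign: "0 < (a \<bullet> (A *v x)) * (a \<bullet> (A *v y))" if x: "x \<in> ?S" and y: "y \<in> ?S" for x y
  proof (rule ccontr)
    define u where "u = a \<bullet> (A *v x)"
    define v where "v = a \<bullet> (A *v y)"
    assume "\<not> ?thesis"
    then have uv: "u * v < 0" using Ax[OF x] Ax[OF y] by (auto simp: u_def v_def less_le)
    then have d: "\<bar>u\<bar> + \<bar>v\<bar> > 0" by (cases "u = 0") auto
    \<comment> \<open>The weights are chosen so that \<open>a\<close> vanishes on the image of this
      convex combination, \<open>u\<close> and \<open>v\<close> having opposite signs.\<close>
    have "(\<bar>v\<bar> / (\<bar>u\<bar> + \<bar>v\<bar>)) *\<^sub>R x + (\<bar>u\<bar> / (\<bar>u\<bar> + \<bar>v\<bar>)) *\<^sub>R y \<in> ?S"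
      using d by (intro convexD[OF conv x y]) (auto simp: add_divide_distrib[symmetric] add.commute)
    from Ax[OF this] have "\<bar>v\<bar> / (\<bar>u\<bar> + \<bar>v\<bar>) * u + \<bar>u\<bar> / (\<bar>u\<bar> + \<bar>v\<bar>) * v \<noteq> 0"
      by (simp add: matrix_vector_right_distrib matrix_vector_mult_scaleR inner_add_right u_def v_def)
    moreover have "\<bar>v\<bar> * u + \<bar>u\<bar> * v = 0" using uv by (auto simp: abs_if mult_less_0_iff)
    ultimately show False
      by (metis add_divide_distrib divide_eq_0_iff times_divide_eq_left)
  qed
  have "\<exists>s\<in>{1, -1}. \<forall>x\<in>?S. 0 < s * (a \<bullet> (A *v x))"
  proof (cases "?S = {}")
    case False
    then obtain z where z: "z \<in> ?S" by blast
    show ?thesis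
    proof (cases "0 < a \<bullet> (A *v z)")
      case True
      then show ?thesis using sign[OF z] by (intro bexI[of _ 1]) (auto simp: zero_less_mult_iff)
    next
      case False
      then show ?thesis using sign[OF z] by (intro bexI[of _ "-1"]) (auto simp: zero_less_mult_iff)
    qed
  qed auto
  then obtain s :: real where s: "s \<in> {1, -1}" "\<And>x. x \<in> ?S \<Longrightarrow> 0 < s * (a \<bullet> (A *v x))" by blast
  have 1: "s *\<^sub>R (A *v x) \<in> conic hull ?S" if "x \<in> ?S" for x
  proof -
    have "s *\<^sub>R (A *v x) = (s * (a \<bullet> (A *v x))) *\<^sub>R ((A *v x) /\<^sub>R (a \<bullet> (A *v x)))"
      using Ax[OF that] by simp
    then show ?thesis
      unfolding conic_hull_explicit using s(2)[OF that] Ax[OF that] less_imp_le by blast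
  qed
  have cont: "continuous_on UNIV (\<lambda>x. s *\<^sub>R (A *v x))"
    by (intro continuous_intros linear_continuous_on matrix_vector_mul_bounded_linear)
  have 2: "s *\<^sub>R (A *v x) \<in> closure (conic hull ?S)" if "x \<in> closure ?S" for x
  proof -
    have "?S \<subseteq> (\<lambda>x. s *\<^sub>R (A *v x)) -` closure (conic hull ?S)"
      using 1 closure_subset by blast
    moreover have "closed ((\<lambda>x. s *\<^sub>R (A *v x)) -` closure (conic hull ?S))"
      by (intro closed_vimage cont closed_closure)
    ultimately show ?thesis using closure_minimal that by blast
  qed
  have "conic (closure (conic hull ?S))"
    by (intro conic_closure conic_conic_hull)
  then have 3: "c *\<^sub>R (s *\<^sub>R (A *v x)) \<in> closure (conic hull ?S)" if "x \<in> closure ?S" "c \<ge> 0" for x c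
    using 2[OF that(1)] that(2) conicD by blast
  have "s *\<^sub>R (A *v x) \<in> closure (conic hull ?S)" if x: "x \<in> conic hull closure ?S" for x
  proof -
    obtain c w where "x = c *\<^sub>R w" "c \<ge> 0" "w \<in> closure ?S"
      using x by (auto simp: conic_hull_explicit)
    then show ?thesis using 3[of w c] by (simp add: matrix_vector_mult_scaleR mult.commute)
  qed
  then show ?thesis using s(1) by blast
qed

text \<open>Two orthogonal isotropic vectors of \<open>K\<close> are joined by isotropic vectors.
  The projective segment lies in the closure of \<open>C\<close> but misses \<open>AdS\<close>,
  hence \<open>C\<close>, so the condition on the ideal boundary forces its endpoints to coincide.
  Boundedness in the chart makes \<open>S\<close> compact; as \<open>S\<close> avoids 0, its cone is
  closed.\<close>

lemma AdS_convex_cocompact_acausal_cone: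
  assumes "AdS_convex_cocompact \<Gamma>"
  obtains K a where "acausal_cone K a \<Gamma>"
proof -
  obtain C where \<Gamma>: "discrete_subgroup \<Gamma>" and CA: "C \<subseteq> AdS" and pc: "properly_convex C"
    and int: "interior C \<noteq> {}" and pres: "preserves \<Gamma> C"
    and seg: "\<not> contains_nontrivial_segment (closure C - C)"
    using assms unfolding AdS_convex_cocompact_def by blast
  obtain a where a: "a \<noteq> 0" "C \<subseteq> affine_chart a" "convex (in_affine_chart a C)"
    "bounded (in_affine_chart a C)"
    using pc unfolding properly_convex_def by blast
  define S where "S = closure (in_affine_chart a C)"
  define K where "K = conic hull S"
  have aS: "a \<bullet> x = 1" if "x \<in> S" for x
  proof -
    have "S \<subseteq> {x. a \<bullet> x = 1}"
      unfolding S_def by (intro closure_minimal closed_hyperplane) (auto simp: in_affine_chart_def)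
    then show ?thesis using that by blast
  qed
  have S: "compact S" "convex S" "0 \<notin> S"
    using a(3,4) aS[of 0] by (simp add: S_def, simp add: S_def convex_closure, auto)
  have Kc: "closed K" unfolding K_def using S closed_conic_hull by blast
  have Kx: "\<exists>t>0. \<exists>w\<in>S. x = t *\<^sub>R w" if "x \<in> K" "x \<noteq> 0" for x
    using that unfolding K_def conic_hull_explicit by (force simp: less_le)
  have SK: "S \<subseteq> K" unfolding K_def by (rule hull_subset)
  have form_S: "ads_form x x \<le> 0" if "x \<in> S" for x
  proof -
    have "S \<subseteq> {x. ads_form x x \<le> 0}"
      unfolding S_def
    proof (rule closure_minimal)
      show "in_affine_chart a C \<subseteq> {x. ads_form x x \<le> 0}"
      proof
        fix x assume "x \<in> in_affine_chart a C"
        then have "x \<noteq> 0" "rp_class x \<in> AdS" using CA by (auto simp: in_affine_chart_def)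
        then show "x \<in> {x. ads_form x x \<le> 0}" using AdS_form_neg less_imp_le by blast
      qed
      show "closed {x. ads_form x x \<le> 0}"
        by (intro closed_Collect_le ads_form.continuous_on continuous_intros)
    qed
    then show ?thesis using that by blast
  qed
  have class_S: "rp_class x \<in> closure C" if "x \<in> S" for x
  proof -
    have "S \<subseteq> insert 0 {x. rp_class x \<in> closure C}"
      unfolding S_def
    proof (rule closure_minimal)
      show "in_affine_chart a C \<subseteq> insert 0 {x. rp_class x \<in> closure C}"
        using closure_subset by (auto simp: in_affine_chart_def)
      show "closed (insert 0 {x. rp_class x \<in> closure C})"
        using closed_rp_iff[of "closure C"] closed_closure[of C] by blast
    qed
    then show ?thesis using that S(3) by blast
  qed
  have class_K: "rp_class x \<in> closure C" if "x \<in> K" "x \<noteq> 0" for x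
    using Kx[OF that] class_S by auto
  have posK: "0 < a \<bullet> x" if "x \<in> K" "x \<noteq> 0" for x
    using Kx[OF that] aS by auto
  have "acausal_cone K a \<Gamma>"
  proof (rule acausal_cone.intro)
    show "closed K" "convex K" by (fact Kc, simp add: K_def convex_conic_hull S)
    show "cone K" using conic_conic_hull[of S] by (simp add: K_def cone_def conic_def)
    show "subgroup \<Gamma> PO_n_2" using \<Gamma> by (simp add: discrete_subgroup_def)
    show "0 < a \<bullet> x" if "x \<in> K" "x \<noteq> 0" for x using posK that .
    show "ads_form x x \<le> 0" if "x \<in> K" for x
    proof (cases "x = 0")
      case False
      from Kx[OF that this] form_S show ?thesis by (auto simp: ads_form_simps mult_nonneg_nonpos)
    qed (simp add: ads_form_simps)
    show "interior K \<noteq> {}"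
    proof -
      let ?U = "{x. x \<noteq> 0 \<and> rp_class x \<in> interior C}"
      obtain x0 where x0: "x0 \<noteq> 0" "rp_class x0 \<in> interior C"
        using int rp_class_surj by (metis ex_in_conv)
      have C_int: "rp_class x \<in> C" if "x \<in> ?U" for x using that interior_subset by blast
      have "open (?U \<inter> {x. 0 < a \<bullet> x})"
        by (intro open_Int open_halfspace_gt) (simp flip: open_rp_iff)
      moreover have "?U \<inter> {x. 0 < a \<bullet> x} \<subseteq> K"
      proof
        fix x assume x: "x \<in> ?U \<inter> {x. 0 < a \<bullet> x}"
        then have "x /\<^sub>R (a \<bullet> x) \<in> S"
          using in_affine_chart_normalize[OF a(2)] C_int closure_subset unfolding S_def by blast
        moreover have "x = (a \<bullet> x) *\<^sub>R (x /\<^sub>R (a \<bullet> x))" using x by simp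
        ultimately show "x \<in> K"
          using x unfolding K_def conic_hull_explicit by (metis (mono_tags, lifting) IntD2 less_imp_le mem_Collect_eq)
      qed
      ultimately have "?U \<inter> {x. 0 < a \<bullet> x} \<subseteq> interior K" by (rule interior_maximal[rotated])
      moreover have "x0 \<in> ?U \<inter> {x. 0 < a \<bullet> x} \<or> - x0 \<in> ?U \<inter> {x. 0 < a \<bullet> x}"
        using x0 in_affine_chart_normalize(1)[OF a(2) x0(1)] C_int[of x0] by auto
      ultimately show ?thesis by blast
    qed
    show "rp_class x = rp_class y"
      if x: "x \<in> K" "x \<noteq> 0" "ads_form x x = 0" and y: "y \<in> K" "y \<noteq> 0" "ads_form y y = 0"
        and xy: "ads_form x y = 0" for x y
    proof (rule ccontr)
      assume ne: "rp_class x \<noteq> rp_class y"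
      have "rp_class ` closed_segment x y \<subseteq> closure C - C"
      proof
        fix p assume "p \<in> rp_class ` closed_segment x y"
        then obtain t where t: "0 \<le> t" "t \<le> 1" and p: "p = rp_class ((1 - t) *\<^sub>R x + t *\<^sub>R y)"
          by (auto simp: closed_segment_def)
        let ?z = "(1 - t) *\<^sub>R x + t *\<^sub>R y"
        have "convex K" by (simp add: K_def convex_conic_hull S)
        then have zK: "?z \<in> K" using x y t by (intro convexD) auto
        have "a \<bullet> ?z > 0"
          using posK[OF x(1,2)] posK[OF y(1,2)] t
          by (cases "t = 0") (auto simp: inner_add_right intro!: add_nonneg_pos)
        then have z0: "?z \<noteq> 0" by auto
        have "ads_form ?z ?z = 0"
          using x y xy by (simp add: ads_form_simps ads_form_commute[of y x])
        then have "rp_class ?z \<notin> C" using AdS_form_neg[OF z0] CA by auto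
        then show "p \<in> closure C - C" using class_K[OF zK z0] p by simp
      qed
      then show False
        using seg x y ne unfolding contains_nontrivial_segment_def by blast
    qed
    show "\<exists>s\<in>{1, -1}. \<forall>x\<in>K. s *\<^sub>R (A *v x) \<in> K" if g: "g \<in> \<Gamma>" "A \<in> g" for g A
    proof -
      have gc: "g \<in> carrier PO_n_2"
        using \<Gamma> g by (meson discrete_subgroup_def subgroup.mem_carrier)
      have AC: "rp_class (A *v x) \<in> C" if "x \<noteq> 0" "rp_class x \<in> C" for x
      proof -
        have "act g ` C = C" using pres g(1) by (simp add: preserves_def)
        then have "act g (rp_class x) \<in> C" using that(2) by blast
        then show ?thesis by (simp add: act_rp_class[OF gc g(2) that(1)])
      qed
      have nzA: "A *v x \<noteq> 0" if "x \<noteq> 0" for x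
        using O_n_2_mult_nonzero[OF PO_n_2_lift(1)[OF gc g(2)] that] .
      have "\<exists>s\<in>{1, -1}. \<forall>x\<in>K. s *\<^sub>R (A *v x) \<in> closure (conic hull (in_affine_chart a C))"
        unfolding K_def S_def using a(3,2) nzA AC by (rule linear_image_affine_chart_cone)
      then obtain s where s: "s \<in> {1, -1}"
        "\<And>x. x \<in> K \<Longrightarrow> s *\<^sub>R (A *v x) \<in> closure (conic hull (in_affine_chart a C))"
        by metis
      have "closure (conic hull (in_affine_chart a C)) \<subseteq> K"
        using Kc closure_subset unfolding K_def S_def by (intro closure_minimal hull_mono) auto
      then show ?thesis using s by (intro bexI[of _ s]) auto
    qed
  qed
  then show thesis by (rule that)
qed


section \<open>Eigenvectors of proximal elements\<close>

lemma det_eq_0_if_kernel: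
  fixes M :: "'a::field ^ 'n::finite ^ 'n"
  assumes "M *v w = 0" "w \<noteq> 0"
  shows "det M = 0"
proof (rule ccontr)
  assume "det M \<noteq> 0"
  then have "inj ((*v) M)" using inj_matrix_vector_mult invertible_det_nz by blast
  then show False using assms by (metis injD matrix_vector_mult_0_right)
qed

lemma complex_char_poly_root:
  fixes A :: "real ^ 'm::finite ^ 'm"
  assumes "A *v y = \<mu> *\<^sub>R y" "y \<noteq> 0"
  shows "poly (complex_char_poly A) (complex_of_real \<mu>) = 0"
proof -
  define w :: "complex ^ 'm" where "w = (\<chi> i. complex_of_real (y $ i))"
  have "w \<noteq> 0" using assms(2) by (auto simp: w_def vec_eq_iff)
  moreover have "(mat (complex_of_real \<mu>) - complex_matrix A) *v w = 0"
  proof -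
    have "(complex_matrix A *v w) $ i = complex_of_real ((A *v y) $ i)" for i
      by (simp add: complex_matrix_def matrix_vector_mult_def w_def)
    moreover have "(mat c *v w) $ i = c * w $ i" for c :: complex and i
      by (simp add: matrix_vector_mult_def mat_def if_distrib if_distribR sum.delta sum.delta' cong: if_cong)
    ultimately show ?thesis
      by (simp add: vec_eq_iff matrix_vector_mult_diff_rdistrib assms(1)) (simp add: w_def)
  qed
  ultimately show ?thesis by (simp add: poly_complex_char_poly det_eq_0_if_kernel)
qed

lemma complex_char_poly_transpose:
  fixes A :: "real ^ 'm::finite ^ 'm"
  shows "complex_char_poly (transpose A) = complex_char_poly A"
proof -
  have "poly (complex_char_poly (transpose A)) z = poly (complex_char_poly A) z" for z
  proof -
    have "mat z - complex_matrix (transpose A) = transpose (mat z - complex_matrix A)"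
      by (simp add: vec_eq_iff transpose_def complex_matrix_def mat_def)
    then show ?thesis by (simp add: poly_complex_char_poly)
  qed
  then have "poly (complex_char_poly (transpose A)) = poly (complex_char_poly A)" by (rule ext)
  then show ?thesis by (simp only: poly_eq_poly_eq_iff)
qed

lemma transpose_eigenvector:
  fixes A :: "real ^ 'm::finite ^ 'm"
  assumes "A *v y = \<mu> *\<^sub>R y" "y \<noteq> 0"
  obtains r where "transpose A *v r = \<mu> *\<^sub>R r" "r \<noteq> 0"
proof -
  have d: "(X - mat \<mu>) *v v = X *v v - \<mu> *\<^sub>R v" for X :: "real ^ 'm ^ 'm" and v
    by (simp add: matrix_vector_mult_diff_rdistrib vec_eq_iff)
      (simp add: matrix_vector_mult_def mat_def if_distrib if_distribR sum.delta sum.delta' cong: if_cong)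
  have "det (A - mat \<mu>) = 0" using d[of A y] assms by (intro det_eq_0_if_kernel[of _ y]) simp_all
  then have "det (transpose (A - mat \<mu>)) = 0" by simp
  moreover have "transpose (A - mat \<mu>) = transpose A - mat \<mu>"
    by (simp add: vec_eq_iff transpose_def mat_def)
  ultimately have "\<not> inj ((*v) (transpose A - mat \<mu>))" by (simp add: det_nz_iff_inj[symmetric])
  then obtain r where "(transpose A - mat \<mu>) *v r = 0" "r \<noteq> 0"
    using linear_injective_0[OF matrix_vector_mul_linear] by blast
  then show thesis using that[of r] d[of "transpose A" r] by simp
qed

context acausal_cone
begin

lemma Gamma_carrier: "g \<in> \<Gamma> \<Longrightarrow> g \<in> carrier PO_n_2"
  using subgroup.mem_carrier[OF subgroup_\<Gamma>] .

text \<open>The positive operator is \<open>A\<close> up to the sign \<open>s\<close>; undoing the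
  sign affects eigenvalues only by sign, hence the absolute values.\<close>

lemma lift_perron_frobenius:
  assumes "g \<in> \<Gamma>" "A \<in> g"
  obtains y r where "y \<in> K" "y \<noteq> 0" "A *v y = r *\<^sub>R y"
    "\<And>p \<mu>. p \<noteq> 0 \<Longrightarrow> A *v p = \<mu> *\<^sub>R p \<Longrightarrow> \<bar>\<mu>\<bar> \<le> \<bar>r\<bar>"
proof -
  obtain s :: real where s: "s \<in> {1, -1}" "\<forall>x\<in>K. s *\<^sub>R (A *v x) \<in> K" using invariant[OF assms] by blast
  define f where "f x = s *\<^sub>R (A *v x)" for x
  have ss: "s * s = 1" "\<bar>s\<bar> = 1" using s by auto
  have "linear f" unfolding f_def by (intro linear_compose_scale_right matrix_vector_mul_linear)
  moreover have "f ` K \<subseteq> K" using s by (auto simp: f_def)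
  ultimately obtain y r where y: "y \<in> K" "y \<noteq> 0" "f y = r *\<^sub>R y"
    and r: "\<And>p \<mu>. p \<noteq> 0 \<Longrightarrow> f p = \<mu> *\<^sub>R p \<Longrightarrow> \<bar>\<mu>\<bar> \<le> r"
    using cone_perron_frobenius[OF closed_K convex_K cone_K pos interior_K] by metis
  show thesis
  proof
    show "y \<in> K" "y \<noteq> 0" by fact+
    have "s *\<^sub>R f y = (s * r) *\<^sub>R y" using y by simp
    then show "A *v y = (s * r) *\<^sub>R y" by (simp add: f_def ss)
    fix p \<mu> assume p: "p \<noteq> 0" "A *v p = \<mu> *\<^sub>R p"
    then have "\<bar>s * \<mu>\<bar> \<le> r" using r[of p "s * \<mu>"] by (simp add: f_def)
    then show "\<bar>\<mu>\<bar> \<le> \<bar>s * r\<bar>" by (simp add: abs_mult ss)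
  qed
qed

text \<open>Perron--Frobenius for \<open>A\<close> and for its inverse \<open>B\<close> gives
  eigenvectors \<open>y\<close> and \<open>q\<close> in \<open>K\<close>. Since A^T J = J B, the
  vector \<open>ads_flip q\<close> is an eigenvector of the transpose, again of maximal modulus. By
  simplicity of the top eigenvalue, such left and right eigenvectors pair nontrivially; this makes
  \<open>x\<close> a multiple of \<open>y\<close> and \<open>ads_form x q\<close> nonzero.\<close>

lemma proximal_eigenvectors:
  assumes g: "g \<in> \<Gamma>" "proximal g" and x: "x \<noteq> 0" "attracting_fixed_point g (rp_class x)"
    and null: "ads_form x x = 0"
  obtains A \<mu> q where "A \<in> g" "1 < \<bar>\<mu>\<bar>" "A *v x = \<mu> *\<^sub>R x" "A *v q = inverse \<mu> *\<^sub>R q"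
    "q \<in> K" "q \<noteq> 0" "ads_form q q = 0" "ads_form x q \<noteq> 0" "x \<in> K \<or> - x \<in> K"
proof -
  note transpose_matrix_vector [simp del]
  have gc: "g \<in> carrier PO_n_2" using g Gamma_carrier by blast
  obtain A \<mu> where A: "A \<in> g" and \<mu>: "\<bar>\<mu>\<bar> = exp (log_modulus A 1)" and Ax: "A *v x = \<mu> *\<^sub>R x"
  proof -
    obtain A \<mu> y where y: "A \<in> g" "\<bar>\<mu>\<bar> = exp (log_modulus A 1)" "y \<noteq> 0" "A *v y = \<mu> *\<^sub>R y"
      "rp_class x = rp_class y"
      using x(2) unfolding attracting_fixed_point_def by metis
    then obtain c where c: "c \<noteq> 0" "x = c *\<^sub>R y" using x rp_class_eq_iff by metis
    then have "A *v x = \<mu> *\<^sub>R x" using y by (simp add: matrix_vector_mult_scaleR)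
    then show thesis using that y by blast
  qed
  have simple: "log_modulus A 1 > log_modulus A 2"
  proof -
    obtain A' where "A' \<in> g" "log_modulus A' 1 > log_modulus A' 2"
      using g(2) by (auto simp: proximal_def)
    moreover have "A' = A \<or> A' = - A" using PO_n_2_lift(2)[OF gc A] \<open>A' \<in> g\<close> by auto
    ultimately show ?thesis by (auto simp: log_modulus_uminus)
  qed
  have \<mu>0: "\<mu> \<noteq> 0" using \<mu> by auto
  have lnmod: "ln (cmod (complex_of_real m)) = log_modulus A 1" if "\<bar>m\<bar> = \<bar>\<mu>\<bar>" for m
    using that \<mu> by simp
  have root_le: "\<bar>m\<bar> \<le> \<bar>\<mu>\<bar>" if "poly (complex_char_poly A) (complex_of_real m) = 0" for m
  proof (cases "m = 0")
    case False
    have "ln \<bar>m\<bar> \<le> log_modulus A 1"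
      using log_modulus_ge_root[OF that] by simp
    then have "exp (ln \<bar>m\<bar>) \<le> exp (log_modulus A 1)" by (simp only: exp_le_cancel_iff)
    then show ?thesis using False \<mu> by simp
  qed simp
  have AO: "A \<in> carrier O_n_2" using PO_n_2_lift(1)[OF gc A] .
  obtain B where B: "B \<in> inv\<^bsub>PO_n_2\<^esub> g" and AB: "A ** B = mat 1" and BA: "B ** A = mat 1"
    using PO_n_2_inv[OF gc A] by metis
  have invg: "inv\<^bsub>PO_n_2\<^esub> g \<in> \<Gamma>" using g subgroup_\<Gamma> by (simp add: subgroup.m_inv_closed)
  have ABv: "A *v (B *v v) = v" "B *v (A *v v) = v" for v
    by (simp_all add: matrix_vector_mul_assoc AB BA)
  have At: "transpose A *v ads_flip v = ads_flip (B *v v)" for v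
    using O_n_2_transpose[OF AO, of "B *v v"] by (simp add: ABv)
  have flip0: "ads_flip v \<noteq> 0" if "v \<noteq> 0" for v
    using that ads_flip_flip linear_0[OF linear_ads_flip] by metis
  have flipR: "ads_flip (c *\<^sub>R v) = c *\<^sub>R ads_flip v" for c v
    by (rule linear_scale[OF linear_ads_flip])
  \<comment> \<open>An orthogonal pair of a right and a left eigenvector of maximal modulus would
    account for two roots of that modulus, counted with multiplicity, against proximality.\<close>
  have no_pair: "v \<bullet> r \<noteq> 0"
    if "A *v v = m *\<^sub>R v" "v \<noteq> 0" "\<bar>m\<bar> = \<bar>\<mu>\<bar>" "transpose A *v r = k *\<^sub>R r" "r \<noteq> 0" "\<bar>k\<bar> = \<bar>\<mu>\<bar>" for v m r k
  proof
    assume "v \<bullet> r = 0"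
    then have "r \<bullet> v = 0" by (simp add: inner_commute)
    from complex_char_poly_eigen_pair[OF that(1,2,4,5) this] simple
    show False using log_modulus_double_root lnmod[OF that(3)] lnmod[OF that(6)] by fastforce
  qed
  obtain y m where y: "y \<in> K" "y \<noteq> 0" "A *v y = m *\<^sub>R y"
    and m_max: "\<And>p k. p \<noteq> 0 \<Longrightarrow> A *v p = k *\<^sub>R p \<Longrightarrow> \<bar>k\<bar> \<le> \<bar>m\<bar>"
    using lift_perron_frobenius[OF g(1) A] by metis
  have m: "\<bar>m\<bar> = \<bar>\<mu>\<bar>"
    using m_max[OF x(1) Ax] root_le[OF complex_char_poly_root[OF y(3,2)]] by simp
  obtain q k where q: "q \<in> K" "q \<noteq> 0" "B *v q = k *\<^sub>R q"
    and k_max: "\<And>p k'. p \<noteq> 0 \<Longrightarrow> B *v p = k' *\<^sub>R p \<Longrightarrow> \<bar>k'\<bar> \<le> \<bar>k\<bar>"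
    using lift_perron_frobenius[OF invg B] by metis
  have qt: "transpose A *v ads_flip q = k *\<^sub>R ads_flip q" by (simp add: At q flipR)
  \<comment> \<open>Upper bound: \<open>k\<close> is an eigenvalue of the transpose, hence a root.
    Lower bound: a left eigenvector for \<mu>, flipped, is an eigenvector of \<open>B\<close> for
    \<mu>.\<close>
  have k: "\<bar>k\<bar> = \<bar>\<mu>\<bar>"
  proof (rule antisym)
    have "poly (complex_char_poly (transpose A)) (complex_of_real k) = 0"
      using complex_char_poly_root[OF qt flip0[OF q(2)]] .
    then show "\<bar>k\<bar> \<le> \<bar>\<mu>\<bar>" by (intro root_le) (simp add: complex_char_poly_transpose)
    obtain r where r: "transpose A *v r = \<mu> *\<^sub>R r" "r \<noteq> 0" using transpose_eigenvector[OF Ax x(1)] .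
    have "ads_flip (B *v ads_flip r) = \<mu> *\<^sub>R r" using At[of "ads_flip r"] r by simp
    then have "B *v ads_flip r = \<mu> *\<^sub>R ads_flip r" by (metis ads_flip_flip flipR)
    then show "\<bar>\<mu>\<bar> \<le> \<bar>k\<bar>" using k_max[OF flip0[OF r(2)]] by blast
  qed
  have eigen_q: "v \<bullet> ads_flip q \<noteq> 0 \<and> m' = k" if v: "A *v v = m' *\<^sub>R v" "v \<noteq> 0" "\<bar>m'\<bar> = \<bar>\<mu>\<bar>" for v m'
  proof -
    have nz: "v \<bullet> ads_flip q \<noteq> 0" using no_pair[OF v qt flip0[OF q(2)] k] .
    have "m' * (v \<bullet> ads_flip q) = (A *v v) \<bullet> ads_flip q" by (simp add: v)
    also have "\<dots> = v \<bullet> (transpose A *v ads_flip q)"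
      by (simp add: transpose_matrix_vector) (metis dot_lmul_matrix inner_commute)
    also have "\<dots> = k * (v \<bullet> ads_flip q)" by (simp add: qt)
    finally show ?thesis using nz by simp
  qed
  have x_q: "x \<bullet> ads_flip q \<noteq> 0" and \<mu>k: "\<mu> = k" using eigen_q[OF Ax x(1)] by auto
  have y_q: "y \<bullet> ads_flip q \<noteq> 0" and mk: "m = k" using eigen_q[OF y(3,2) m] by auto
  \<comment> \<open>Chosen so that \<open>x - c *\<^sub>R y\<close> pairs to zero with
    \<open>ads_flip q\<close>, which no eigenvector of maximal modulus does.\<close>
  define c where "c = (x \<bullet> ads_flip q) / (y \<bullet> ads_flip q)"
  have "x - c *\<^sub>R y = 0"
  proof (rule ccontr)
    assume nz: "x - c *\<^sub>R y \<noteq> 0"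
    have "A *v (x - c *\<^sub>R y) = k *\<^sub>R (x - c *\<^sub>R y)"
      using y(3) Ax by (simp add: matrix_vector_mult_diff_distrib matrix_vector_mult_scaleR \<mu>k mk algebra_simps)
    then have "(x - c *\<^sub>R y) \<bullet> ads_flip q \<noteq> 0" using eigen_q nz k by blast
    then show False using y_q by (simp add: inner_diff_left c_def)
  qed
  then have x_cy: "x = c *\<^sub>R y" by simp
  have xK: "x \<in> K \<or> - x \<in> K"
  proof (cases "c \<ge> 0")
    case True
    then show ?thesis using x_cy y(1) cone_K by (simp add: cone_def)
  next
    case False
    then have "(- c) *\<^sub>R y \<in> K" using y(1) cone_K unfolding cone_def by (metis less_imp_le neg_0_le_iff_le not_le)
    then show ?thesis using x_cy by simp
  qed
  have Bx: "B *v x = inverse \<mu> *\<^sub>R x"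
  proof -
    have "x = \<mu> *\<^sub>R (B *v x)" using ABv(2)[of x] by (simp add: Ax matrix_vector_mult_scaleR)
    then have "inverse \<mu> *\<^sub>R x = inverse \<mu> *\<^sub>R (\<mu> *\<^sub>R (B *v x))" by simp
    then show ?thesis using \<mu>0 by simp
  qed
  have ge1: "1 \<le> \<bar>\<mu>\<bar>"
  proof (rule ccontr)
    assume "\<not> 1 \<le> \<bar>\<mu>\<bar>"
    then have "1 < \<bar>inverse \<mu>\<bar>" using \<mu>0 by (simp add: field_simps)
    moreover have "\<bar>inverse \<mu>\<bar> \<le> \<bar>\<mu>\<bar>" using k_max[OF x(1) Bx] k by simp
    ultimately show False using \<open>\<not> 1 \<le> \<bar>\<mu>\<bar>\<close> by simp
  qed
  \<comment> \<open>At modulus 1 the real number \<mu> is its own inverse and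
    \<open>ads_flip x\<close> is a left eigenvector for it, so \<open>x\<close> would pair
    nontrivially with \<open>ads_flip x\<close> and not be isotropic.\<close>
  have gt1: "1 < \<bar>\<mu>\<bar>"
  proof (rule ccontr)
    assume "\<not> 1 < \<bar>\<mu>\<bar>"
    then have "\<bar>\<mu>\<bar> = 1" using ge1 by simp
    then have "inverse \<mu> = \<mu>" by (auto simp: abs_if split: if_splits)
    then have "transpose A *v ads_flip x = \<mu> *\<^sub>R ads_flip x" by (simp add: At Bx flipR)
    then have "x \<bullet> ads_flip x \<noteq> 0" using no_pair[OF Ax x(1) refl] flip0[OF x(1)] by blast
    then show False using null by (simp add: ads_form_inner)
  qed
  have Aq: "A *v q = inverse \<mu> *\<^sub>R q"
  proof -
    have "q = \<mu> *\<^sub>R (A *v q)" using ABv(1)[of q] by (simp add: q \<mu>k matrix_vector_mult_scaleR)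
    then have "inverse \<mu> *\<^sub>R q = inverse \<mu> *\<^sub>R (\<mu> *\<^sub>R (A *v q))" by simp
    then show ?thesis using \<mu>0 by simp
  qed
  have "ads_form q q = 0"
  proof -
    have "ads_form q q = inverse \<mu> * (inverse \<mu> * ads_form q q)"
      using O_n_2_form[OF AO, of q q] by (simp add: Aq ads_form_simps)
    then have "(1 - inverse \<mu> * inverse \<mu>) * ads_form q q = 0" by (simp add: algebra_simps)
    moreover have "\<bar>inverse \<mu>\<bar> < 1" using gt1 by (simp add: field_simps)
    then have "inverse \<mu> * inverse \<mu> < 1" by (metis abs_square_less_1 power2_eq_square)
    ultimately show ?thesis by simp
  qed
  then show thesis
    using that[OF A gt1 Ax Aq q(1,2)] x_q xK by (simp add: ads_form_inner)
qed

end


section \<open>Signature\<close>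

lemma independent_ads_orthogonal:
  assumes orth: "pairwise (\<lambda>x y. ads_form x y = 0) E" and nz: "\<And>e. e \<in> E \<Longrightarrow> ads_form e e \<noteq> 0"
  shows "independent E"
proof
  assume "dependent E"
  then obtain t f x where t: "finite t" "t \<subseteq> E" and sum: "(\<Sum>e\<in>t. f e *\<^sub>R e) = 0"
    and x: "x \<in> t" "f x \<noteq> 0"
    unfolding dependent_explicit by blast
  have "0 = ads_form (\<Sum>e\<in>t. f e *\<^sub>R e) x" by (simp add: sum ads_form_simps)
  also have "\<dots> = (\<Sum>e\<in>t. f e * ads_form e x)" by (simp add: ads_form.sum_left ads_form_simps)
  also have "\<dots> = (\<Sum>e\<in>t. if e = x then f x * ads_form x x else 0)"
    using orth x t by (intro sum.cong) (auto simp: pairwise_def)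
  also have "\<dots> = f x * ads_form x x" using t x by simp
  finally show False using nz x t by auto
qed

text \<open>Gram--Schmidt for the form: split off a unit vector and pass to its orthogonal
  complement in \<open>X\<close>.\<close>

lemma definite_orthonormal_basis:
  fixes X :: "(real ^ ('n::finite + 2)) set"
  assumes "subspace X" "\<And>x. x \<in> X \<Longrightarrow> x \<noteq> 0 \<Longrightarrow> 0 < ads_form x x"
  shows "\<exists>E. E \<subseteq> X \<and> span E = X \<and> pairwise (\<lambda>x y. ads_form x y = 0) E \<and> (\<forall>e\<in>E. ads_form e e = 1)"
  using assms
proof (induction "dim X" arbitrary: X rule: less_induct)
  case less
  show ?case
  proof (cases "X = {0}")
    case True
    then show ?thesis by (intro exI[of _ "{}"]) simp
  next
    case False
    then obtain x where x: "x \<in> X" "x \<noteq> 0" using subspace_0[OF less.prems(1)] by blast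
    have fx: "0 < ads_form x x" using less.prems(2)[OF x] .
    define e where "e = x /\<^sub>R sqrt (ads_form x x)"
    have eX: "e \<in> X" unfolding e_def by (intro subspace_scale less.prems x)
    have ee: "ads_form e e = 1"
      using fx by (simp add: e_def ads_form_simps field_simps flip: power2_eq_square)
    define Y where "Y = {y \<in> X. ads_form y e = 0}"
    have Y: "subspace Y"
      using less.prems(1) by (simp add: Y_def subspace_def ads_form_simps)
    have "Y \<subseteq> X" "e \<notin> Y" using ee by (auto simp: Y_def)
    then have "dim Y < dim X"
      using eX Y less.prems(1) by (intro dim_psubset) (auto simp: span_eq_iff[THEN iffD2])
    then obtain E where E: "E \<subseteq> Y" "span E = Y" "pairwise (\<lambda>x y. ads_form x y = 0) E"
      "\<forall>e\<in>E. ads_form e e = 1"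
      using less.hyps[OF _ Y] less.prems(2) \<open>Y \<subseteq> X\<close> by blast
    have "X \<subseteq> span (insert e E)"
    proof
      fix y assume y: "y \<in> X"
      have "y - ads_form y e *\<^sub>R e \<in> Y"
        using less.prems(1) y eX ee by (simp add: Y_def subspace_diff subspace_scale ads_form_simps)
      then show "y \<in> span (insert e E)" using E(2) by (auto simp: span_insert)
    qed
    moreover have "span (insert e E) \<subseteq> X"
      using eX E(1) \<open>Y \<subseteq> X\<close> less.prems(1) by (intro span_minimal) auto
    moreover have "pairwise (\<lambda>x y. ads_form x y = 0) (insert e E)"
      using E(1,3) by (auto simp: pairwise_insert Y_def ads_form_commute)
    ultimately show ?thesis
      using eX E \<open>Y \<subseteq> X\<close> ee by (intro exI[of _ "insert e E"]) auto
  qed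
qed

text \<open>\<open>P\<close> is positive semidefinite with radical the line of the isotropic vector
  \<open>p\<close>, and \<open>q\<close> is isotropic and not orthogonal to \<open>p\<close>. Thus
  \<open>V\<close> is the orthogonal sum of the hyperbolic plane of \<open>p\<close> and
  \<open>q\<close> and the positive definite space \<open>P0\<close>.\<close>

locale null_pair =
  fixes P :: "(real ^ ('n::finite + 2)) set" and p q :: "real ^ ('n + 2)"
  assumes P: "subspace P" "p \<in> P" and null_p: "ads_form p p = 0" and null_q: "ads_form q q = 0"
    and pq: "ads_form p q \<noteq> 0" and orth_p: "u \<in> P \<Longrightarrow> ads_form u p = 0"
    and definite: "u \<in> P \<Longrightarrow> ads_form u u \<le> 0 \<Longrightarrow> u \<in> span {p}"
    and dim_P: "dim P = CARD('n)"
begin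

definition "V = span (insert q P)"
definition "P0 = {u \<in> P. ads_form u q = 0}"

lemma subspace_P0: "subspace P0"
  using P(1) by (simp add: P0_def subspace_def ads_form_simps)

lemma P0_orth: "u \<in> P0 \<Longrightarrow> ads_form u p = 0" "u \<in> P0 \<Longrightarrow> ads_form u q = 0"
  by (auto simp: P0_def orth_p)

lemma P0_pos:
  assumes "u \<in> P0" "u \<noteq> 0"
  shows "0 < ads_form u u"
proof (rule ccontr)
  assume "\<not> ?thesis"
  then have "u \<in> span {p}" using definite assms by (auto simp: P0_def)
  then obtain c where "u = c *\<^sub>R p" by (auto simp: span_singleton)
  then show False using P0_orth(2)[OF assms(1)] pq assms(2) by (auto simp: ads_form_simps)
qed

lemma V_decomposition:
  assumes "u \<in> V"
  obtains \<alpha> h \<beta> where "u = \<alpha> *\<^sub>R p + h + \<beta> *\<^sub>R q" "h \<in> P0"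
proof -
  obtain \<beta> where "u - \<beta> *\<^sub>R q \<in> span P" using assms by (auto simp: V_def span_insert)
  then have w: "u - \<beta> *\<^sub>R q \<in> P" using P(1) by (simp add: span_eq_iff[THEN iffD2])
  define \<alpha> where "\<alpha> = ads_form (u - \<beta> *\<^sub>R q) q / ads_form p q"
  have "u - \<beta> *\<^sub>R q - \<alpha> *\<^sub>R p \<in> P0"
    using w P pq by (simp add: P0_def subspace_diff subspace_scale ads_form_simps \<alpha>_def)
  then show thesis using that[of \<alpha> "u - \<beta> *\<^sub>R q - \<alpha> *\<^sub>R p" \<beta>] by simp
qed

lemma V_subspace: "subspace V" and P_V: "P \<subseteq> V" and q_V: "q \<in> V" and p_V: "p \<in> V"
  and P0_V: "P0 \<subseteq> V"
  using P(2) span_superset[of "insert q P"] by (auto simp: V_def P0_def)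

lemma V_nondegenerate:
  assumes "v \<in> V" "\<And>w. w \<in> V \<Longrightarrow> ads_form v w = 0"
  shows "v = 0"
proof -
  obtain \<alpha> h \<beta> where v: "v = \<alpha> *\<^sub>R p + h + \<beta> *\<^sub>R q" and h: "h \<in> P0"
    using V_decomposition[OF assms(1)] .
  have "ads_form v p = 0" "ads_form v q = 0" "ads_form v h = 0"
    using assms(2) p_V q_V P0_V h by auto
  then have "\<beta> = 0" "\<alpha> = 0" "ads_form h h = 0"
    using pq null_p null_q P0_orth[OF h]
    by (auto simp: v ads_form_simps ads_form_commute[of q p] ads_form_commute[of p h] ads_form_commute[of q h])
  then show "v = 0" using P0_pos[OF h] v by force
qed

lemma dim_V: "dim V = CARD('n) + 1"
proof -
  have "q \<notin> P" using orth_p pq ads_form_commute by metis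
  then have "q \<notin> span P" using P(1) by (simp add: span_eq_iff[THEN iffD2])
  then show ?thesis by (simp add: V_def dim_insert dim_P)
qed

lemma has_signature_V: "has_signature V CARD('n) 1"
proof -
  obtain E where E: "E \<subseteq> P0" "span E = P0" "pairwise (\<lambda>x y. ads_form x y = 0) E"
    "\<forall>e\<in>E. ads_form e e = 1"
    using definite_orthonormal_basis[OF subspace_P0 P0_pos] by blast
  \<comment> \<open>With this scale the form takes the values 1 and -1 on p + s q and p - s q, which
    are orthogonal: an orthonormal basis of the hyperbolic plane.\<close>
  define s where "s = 1 / (2 * ads_form p q)"
  define f g where "f = p + s *\<^sub>R q" and "g = p - s *\<^sub>R q"
  have fg: "ads_form f f = 1" "ads_form g g = -1" "ads_form f g = 0" "ads_form g f = 0"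
    using pq by (simp_all add: f_def g_def ads_form_simps null_p null_q ads_form_commute[of q p] s_def)
  have Efg: "ads_form e f = 0" "ads_form e g = 0" "ads_form f e = 0" "ads_form g e = 0" if "e \<in> E" for e
    using P0_orth[of e] E(1) that
    by (auto simp: f_def g_def ads_form_simps ads_form_commute[of p e] ads_form_commute[of q e])
  define Pos where "Pos = insert f E"
  have orth: "pairwise (\<lambda>x y. ads_form x y = 0) (Pos \<union> {g})"
    using E(3) Efg fg by (auto simp: Pos_def pairwise_insert)
  have pos: "\<forall>x\<in>Pos. ads_form x x = 1" using E(4) fg by (auto simp: Pos_def)
  have ind: "independent (Pos \<union> {g})"
    using orth pos fg by (intro independent_ads_orthogonal) auto
  have "g \<notin> Pos" using pos fg by auto
  have sp: "span (Pos \<union> {g}) = V"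
  proof
    have "f \<in> V" "g \<in> V" using V_subspace p_V q_V by (auto simp: f_def g_def subspace_add subspace_diff subspace_scale)
    then show "span (Pos \<union> {g}) \<subseteq> V"
      using E(1) P0_V V_subspace by (intro span_minimal) (auto simp: Pos_def)
    have fgs: "f \<in> span (Pos \<union> {g})" "g \<in> span (Pos \<union> {g})" by (auto simp: Pos_def span_base)
    have "p = (1/2) *\<^sub>R (f + g)" by (simp add: f_def g_def flip: scaleR_2)
    then have ps: "p \<in> span (Pos \<union> {g})" using fgs by (metis span_add span_scale)
    have "s \<noteq> 0" using pq by (simp add: s_def)
    then have "q = (1/s) *\<^sub>R (f - p)" by (simp add: f_def)
    then have qs: "q \<in> span (Pos \<union> {g})" using fgs ps by (metis span_diff span_scale)
    have "P0 \<subseteq> span (Pos \<union> {g})"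
      using E(2) span_mono[of E "Pos \<union> {g}"] by (auto simp: Pos_def)
    then show "V \<subseteq> span (Pos \<union> {g})"
      using ps qs by (auto elim!: V_decomposition intro!: span_add span_scale)
  qed
  have "card (Pos \<union> {g}) = CARD('n) + 1"
    using dim_span_eq_card_independent[OF ind] dim_V unfolding sp by linarith
  moreover have "finite Pos" using ind independent_imp_finite by blast
  ultimately have "card Pos = CARD('n)" using \<open>g \<notin> Pos\<close> by simp
  then show ?thesis
    unfolding has_signature_def
    using \<open>g \<notin> Pos\<close> ind sp orth pos fg by (intro exI[of _ Pos] exI[of _ "{g}"]) auto
qed

text \<open>\<open>V\<close> has codimension one; its form-normal is the flipped Euclidean normal,
  and it is not isotropic as \<open>V\<close> is nondegenerate. The last conclusion will make
  \<open>n\<close> an eigenvector of an isometry that preserves \<open>V\<close>.\<close>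

lemma V_hyperplane:
  obtains n where "n \<noteq> 0" "V = {x. ads_form x n = 0}" "ads_form n n \<noteq> 0"
    "\<And>z. (\<And>v. v \<in> V \<Longrightarrow> ads_form z v = 0) \<Longrightarrow> \<exists>c. z = c *\<^sub>R n"
proof -
  have "dim V < DIM(real ^ ('n + 2))" by (simp add: dim_V)
  then obtain m where m: "m \<noteq> 0" "\<And>y. y \<in> span V \<Longrightarrow> orthogonal m y"
    using orthogonal_to_subspace_exists by blast
  define n where "n = ads_flip m"
  have n0: "n \<noteq> 0" using m(1) ads_flip_flip linear_0[OF linear_ads_flip] unfolding n_def by metis
  have form_n: "ads_form x n = m \<bullet> x" for x by (simp add: n_def ads_form_inner inner_commute)
  have "V \<subseteq> {x. ads_form x n = 0}"
    using m(2) span_superset[of V] by (auto simp: form_n orthogonal_def)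
  moreover have "dim {x. ads_form x n = 0} = CARD('n) + 1"
    using dim_hyperplane[OF m(1)] by (simp add: form_n)
  moreover have "subspace {x. ads_form x n = 0}"
    by (simp add: subspace_def ads_form_simps)
  ultimately have V: "V = {x. ads_form x n = 0}"
    using subspace_dim_equal[OF V_subspace] dim_V by simp
  have nn: "ads_form n n \<noteq> 0"
  proof
    assume "ads_form n n = 0"
    then have "n \<in> V" by (simp add: V)
    then have "n = 0" by (rule V_nondegenerate) (simp add: V ads_form_commute)
    then show False using n0 by simp
  qed
  show thesis
  proof (rule that[OF n0 V nn])
    fix z assume z: "\<And>v. v \<in> V \<Longrightarrow> ads_form z v = 0"
    define c where "c = ads_form z n / ads_form n n"
    have "ads_form (z - c *\<^sub>R n) y = 0" for y
    proof -
      define d where "d = ads_form y n / ads_form n n"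
      have "y - d *\<^sub>R n \<in> V" using nn by (simp add: V ads_form_simps d_def)
      moreover from this have "ads_form (y - d *\<^sub>R n) n = 0" unfolding V by blast
      ultimately have "ads_form z (y - d *\<^sub>R n) = 0" "ads_form n (y - d *\<^sub>R n) = 0"
        using z by (simp_all only: ads_form_commute[of n])
      then have "ads_form z y = d * ads_form z n" "ads_form n y = d * ads_form n n"
        by (simp_all add: ads_form_simps)
      then show ?thesis using nn by (simp add: ads_form_simps c_def)
    qed
    then have "z - c *\<^sub>R n = 0" by (rule ads_form_nondegenerate)
    then show "\<exists>c. z = c *\<^sub>R n" by (intro exI[of _ c]) simp
  qed
qed

text \<open>By compactness of the unit sphere of \<open>P0\<close>. It converts the conservation of
  the form along an orbit in \<open>P0\<close> into a bound on the Euclidean norm.\<close>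

lemma P0_coercive:
  obtains c where "c > 0" "\<And>u. u \<in> P0 \<Longrightarrow> c * (norm u)\<^sup>2 \<le> ads_form u u"
proof (cases "P0 \<inter> sphere 0 1 = {}")
  case True
  have "u = 0" if "u \<in> P0" for u
  proof (rule ccontr)
    assume "u \<noteq> 0"
    then have "u /\<^sub>R norm u \<in> P0 \<inter> sphere 0 1" using that by (simp add: subspace_scale subspace_P0)
    then show False using True by blast
  qed
  then have "1 * (norm u)\<^sup>2 \<le> ads_form u u" if "u \<in> P0" for u using that by (fastforce simp: ads_form_simps)
  then show thesis by (intro that[of 1]) simp_all
next
  case False
  have "compact (P0 \<inter> sphere 0 1)"
    by (intro closed_Int_compact closed_subspace subspace_P0) simp
  moreover have "continuous_on (P0 \<inter> sphere 0 1) (\<lambda>u. ads_form u u)"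
    by (intro ads_form.continuous_on continuous_intros)
  ultimately obtain w where w: "w \<in> P0 \<inter> sphere 0 1"
    and min: "\<And>u. u \<in> P0 \<inter> sphere 0 1 \<Longrightarrow> ads_form w w \<le> ads_form u u"
    using continuous_attains_inf[of "P0 \<inter> sphere 0 1" "\<lambda>u. ads_form u u"] False by blast
  show thesis
  proof (rule that)
    have "w \<noteq> 0" using w by auto
    then show "0 < ads_form w w" using P0_pos w by blast
    fix u assume u: "u \<in> P0"
    show "ads_form w w * (norm u)\<^sup>2 \<le> ads_form u u"
    proof (cases "u = 0")
      case False
      then have "u /\<^sub>R norm u \<in> P0 \<inter> sphere 0 1" using u by (simp add: subspace_scale subspace_P0)
      from min[OF this] False show ?thesis
        by (simp add: ads_form_simps field_simps power2_eq_square)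
    qed (simp add: ads_form_simps)
  qed
qed

end


section \<open>Tangent spaces of the limit set\<close>

text \<open>Differentiates the identity \<open>ads_form (\<sigma> z) (\<sigma> z) = 0\<close>, valid
  on all of \<open>W\<close> because the chart takes values in the quadric.\<close>

lemma ads_form_derivative_null:
  assumes par: "C1_parametrization W \<sigma>" and w: "w \<in> W" and der: "(\<sigma> has_derivative T) (at w)"
  shows "ads_form (\<sigma> w) (\<sigma> w) = 0" "ads_form (\<sigma> w) (T v) = 0"
proof -
  have null: "ads_form (\<sigma> z) (\<sigma> z) = 0" if z: "z \<in> W" for z
  proof -
    have "(rp_class \<circ> \<sigma>) ` W \<subseteq> boundary_AdS"
      using par unfolding C1_parametrization_def by (meson openin_imp_subset)
    then have "rp_class (\<sigma> z) \<in> boundary_AdS" using z by auto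
    then obtain y where y: "rp_class (\<sigma> z) = rp_class y" "y \<noteq> 0" "ads_form y y = 0"
      by (auto simp: boundary_AdS_def)
    have "\<sigma> z \<noteq> 0" using par z unfolding C1_parametrization_def by (metis image_eqI)
    then obtain c where "\<sigma> z = c *\<^sub>R y" using rp_class_eq_iff y by metis
    then show ?thesis using y by (simp add: ads_form_simps)
  qed
  then show "ads_form (\<sigma> w) (\<sigma> w) = 0" using w by blast
  have "open W" using par by (simp add: C1_parametrization_def)
  have "((\<lambda>z. ads_form (\<sigma> z) (\<sigma> z)) has_derivative (\<lambda>h. ads_form (\<sigma> w) (T h) + ads_form (T h) (\<sigma> w))) (at w)"
    by (intro ads_form.FDERIV der)
  moreover have "((\<lambda>z. ads_form (\<sigma> z) (\<sigma> z)) has_derivative (\<lambda>h. 0)) (at w)"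
    by (rule has_derivative_transform_within_open[OF has_derivative_const[of 0] \<open>open W\<close> w])
      (simp add: null)
  ultimately have "(\<lambda>h. ads_form (\<sigma> w) (T h) + ads_form (T h) (\<sigma> w)) = (\<lambda>h. 0)"
    by (rule has_derivative_unique)
  from fun_cong[OF this, of v] show "ads_form (\<sigma> w) (T v) = 0"
    by (simp add: ads_form_commute[of "T v"])
qed

text \<open>First order tangency in homogeneous form: a functional \<open>l\<close> that vanishes on
  the tangent space of the cone over \<Lambda> is, near the base point, small compared with the
  displacement modulo the base line, which \<pi> measures. Both sides scale alike in
  \<open>y\<close>, so the representative is immaterial.\<close>

lemma tangent_estimate:
  fixes l :: "real ^ ('n::finite + 2) \<Rightarrow> real" and \<pi> :: "real ^ ('n + 2) \<Rightarrow> real ^ ('n + 2)"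
  assumes par: "C1_parametrization W \<sigma>" and slice: "{w \<in> W. rp_class (\<sigma> w) \<in> \<Lambda>} = W \<inter> L"
    and L: "subspace L" and \<Lambda>: "\<Lambda> \<subseteq> boundary_AdS" and w0: "w0 \<in> W" "w0 \<in> L"
    and der: "(\<sigma> has_derivative T) (at w0)" and imm: "\<And>v. T v \<in> span {\<sigma> w0} \<Longrightarrow> v = 0"
    and l: "bounded_linear l" "l (\<sigma> w0) = 0" "\<And>v. v \<in> L \<Longrightarrow> l (T v) = 0"
    and \<pi>: "bounded_linear \<pi>" "\<pi> (\<sigma> w0) = 0" "\<And>u. \<pi> u = 0 \<Longrightarrow> u \<in> span {\<sigma> w0}"
    and \<epsilon>: "0 < \<epsilon>"
  obtains U where "open U" "rp_class (\<sigma> w0) \<in> U"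
    "\<And>y. y \<noteq> 0 \<Longrightarrow> rp_class y \<in> \<Lambda> \<Longrightarrow> rp_class y \<in> U \<Longrightarrow> \<bar>l y\<bar> \<le> \<epsilon> * norm (\<pi> y)"
proof -
  interpret T: bounded_linear T using der by (rule has_derivative_bounded_linear)
  interpret l: bounded_linear l by fact
  interpret \<pi>: bounded_linear \<pi> by fact
  have lin: "linear (\<lambda>v. \<pi> (T v))"
    by (rule linearI) (simp_all add: T.add T.scaleR \<pi>.add \<pi>.scaleR)
  have "inj (\<lambda>v. \<pi> (T v))"
    using \<pi>(3) imm by (subst linear_injective_0[OF lin]) blast
  then obtain c where c: "c > 0" "\<And>v. c * norm v \<le> norm (\<pi> (T v))"
    using linear_inj_bounded_below_pos[OF lin] by metis
  obtain M where M: "M > 0" "\<And>u. \<bar>l u\<bar> \<le> norm u * M" using l.pos_bounded by auto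
  obtain N where N: "N > 0" "\<And>u. norm (\<pi> u) \<le> norm u * N" using \<pi>.pos_bounded by auto
  \<comment> \<open>The first bound lets the remainder consume at most half of the lower bound
    \<open>c\<close> for \<pi> composed with \<open>T\<close>; the second keeps \<open>l\<close> of
    the remainder below \<epsilon> times the other half.\<close>
  define e where "e = min (c / (2 * N)) (\<epsilon> * c / (2 * M))"
  have e: "e > 0" "e * N \<le> c / 2" "e * M \<le> \<epsilon> * c / 2"
    using c(1) M(1) N(1) \<epsilon> by (auto simp: e_def min_def field_simps)
  obtain d where d: "d > 0"
    "\<And>w. norm (w - w0) < d \<Longrightarrow> norm (\<sigma> w - \<sigma> w0 - T (w - w0)) \<le> e * norm (w - w0)"
    using der e(1) unfolding has_derivative_at_alt by blast
  have est: "\<bar>l (\<sigma> w)\<bar> \<le> \<epsilon> * norm (\<pi> (\<sigma> w))" if w: "w \<in> L" "norm (w - w0) < d" for w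
  proof -
    define r where "r = \<sigma> w - \<sigma> w0 - T (w - w0)"
    have r: "norm r \<le> e * norm (w - w0)" using d(2)[OF w(2)] by (simp add: r_def)
    have \<sigma>w: "\<sigma> w = \<sigma> w0 + T (w - w0) + r" by (simp add: r_def)
    have "w - w0 \<in> L" using L w w0 by (simp add: subspace_diff)
    then have "l (\<sigma> w) = l r" by (simp add: \<sigma>w l.add l(2,3))
    then have "\<bar>l (\<sigma> w)\<bar> \<le> norm r * M" using M(2) by simp
    also have "\<dots> \<le> (e * norm (w - w0)) * M" using r M(1) by (intro mult_right_mono) auto
    also have "\<dots> = (e * M) * norm (w - w0)" by simp
    also have "\<dots> \<le> (\<epsilon> * c / 2) * norm (w - w0)" using e(3) by (intro mult_right_mono) auto
    finally have 1: "\<bar>l (\<sigma> w)\<bar> \<le> (\<epsilon> * c / 2) * norm (w - w0)" .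
    have "c * norm (w - w0) \<le> norm (\<pi> (T (w - w0)))" by (rule c)
    also have "\<pi> (T (w - w0)) = \<pi> (\<sigma> w) - \<pi> r" by (simp add: \<sigma>w \<pi>.add \<pi>(2))
    also have "norm \<dots> \<le> norm (\<pi> (\<sigma> w)) + norm (\<pi> r)" by (rule norm_triangle_ineq4)
    also have "norm (\<pi> r) \<le> norm r * N" by (rule N)
    also have "norm r * N \<le> (e * norm (w - w0)) * N" using r N(1) by (intro mult_right_mono) auto
    also have "\<dots> = (e * N) * norm (w - w0)" by simp
    also have "\<dots> \<le> c / 2 * norm (w - w0)" using e(2) by (intro mult_right_mono) auto
    finally have "c / 2 * norm (w - w0) \<le> norm (\<pi> (\<sigma> w))" by simp
    then have "\<epsilon> * (c / 2 * norm (w - w0)) \<le> \<epsilon> * norm (\<pi> (\<sigma> w))" using \<epsilon> by simp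
    with 1 show ?thesis by simp
  qed
  let ?f = "rp_class \<circ> \<sigma>"
  obtain h where h: "homeomorphism W (?f ` W) ?f h" using par unfolding C1_parametrization_def by blast
  \<comment> \<open>The chart is open onto its image, so every point of \<Lambda> close to the base
    point has its parameter close to \<open>w0\<close>: no other sheet of \<Lambda> returns
    there.\<close>
  have "openin (top_of_set W) (W \<inter> ball w0 d)" by (simp add: openin_open_Int)
  then have "openin (top_of_set (?f ` W)) (?f ` (W \<inter> ball w0 d))"
    using homeomorphism_imp_open_map[OF h] by blast
  moreover have "openin (top_of_set boundary_AdS) (?f ` W)"
    using par unfolding C1_parametrization_def by blast
  ultimately have "openin (top_of_set boundary_AdS) (?f ` (W \<inter> ball w0 d))"
    by (rule openin_trans)
  then obtain U where U: "open U" "?f ` (W \<inter> ball w0 d) = boundary_AdS \<inter> U"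
    unfolding openin_open by blast
  show thesis
  proof (rule that[OF U(1)])
    have "?f w0 \<in> ?f ` (W \<inter> ball w0 d)" using w0 d(1) by (intro imageI) simp
    then show "rp_class (\<sigma> w0) \<in> U" using U(2) by auto
    fix y assume y: "y \<noteq> 0" "rp_class y \<in> \<Lambda>" "rp_class y \<in> U"
    then have "rp_class y \<in> ?f ` (W \<inter> ball w0 d)" using U(2) \<Lambda> by blast
    then obtain w where w: "w \<in> W" "dist w0 w < d" "rp_class y = rp_class (\<sigma> w)" by auto
    then have wL: "w \<in> L" using slice y(2) by auto
    have "\<sigma> w \<noteq> 0" using par w(1) unfolding C1_parametrization_def by (metis image_eqI)
    then obtain k where k: "y = k *\<^sub>R \<sigma> w" using rp_class_eq_iff w(3) y(1) by metis
    have "\<bar>l (\<sigma> w)\<bar> \<le> \<epsilon> * norm (\<pi> (\<sigma> w))"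
      using w(2) by (intro est wL) (simp add: dist_norm norm_minus_commute)
    then have "\<bar>k\<bar> * \<bar>l (\<sigma> w)\<bar> \<le> \<bar>k\<bar> * (\<epsilon> * norm (\<pi> (\<sigma> w)))" by (intro mult_left_mono) auto
    then show "\<bar>l y\<bar> \<le> \<epsilon> * norm (\<pi> y)"
      by (simp add: k l.scaleR \<pi>.scaleR abs_mult mult.left_commute)
  qed
qed

text \<open>Positivity on \<open>L\<close> is positivity on its compact unit sphere, so it persists
  near \<open>w0\<close>. This is where continuity of the derivative enters.\<close>

lemma definite_on_slice_open:
  fixes D :: "real ^ 'n::finite \<Rightarrow> (real ^ 'n) \<Rightarrow>\<^sub>L (real ^ ('n + 2))"
  assumes D: "continuous_on W D" and W: "open W" "w0 \<in> W" and L: "subspace L"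
    and pos: "\<And>v. v \<in> L \<Longrightarrow> v \<noteq> 0 \<Longrightarrow> 0 < ads_form (D w0 v) (D w0 v)"
  obtains d where "d > 0" "ball w0 d \<subseteq> W"
    "\<And>w v. w \<in> ball w0 d \<Longrightarrow> v \<in> L \<Longrightarrow> v \<noteq> 0 \<Longrightarrow> 0 < ads_form (D w v) (D w v)"
proof -
  obtain r where r: "r > 0" "ball w0 r \<subseteq> W" using W by (auto simp: open_contains_ball)
  show thesis
  proof (rule ccontr)
    assume no: "\<not> thesis"
    have "\<exists>w v. w \<in> ball w0 (min r (inverse (real (Suc k)))) \<and> v \<in> L \<inter> sphere 0 1 \<and>
        ads_form (D w v) (D w v) \<le> 0" for k
    proof (rule ccontr)
      assume H: "\<not> ?thesis"
      let ?d = "min r (inverse (real (Suc k)))"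
      have "thesis"
      proof (rule that[of ?d])
        show "0 < ?d" "ball w0 ?d \<subseteq> W" using r by auto
        fix w v assume w: "w \<in> ball w0 ?d" and v: "v \<in> L" "v \<noteq> 0"
        have "v /\<^sub>R norm v \<in> L \<inter> sphere 0 1" using v L by (simp add: subspace_scale)
        then have "0 < ads_form (D w (v /\<^sub>R norm v)) (D w (v /\<^sub>R norm v))"
          using H w by (meson not_le)
        then show "0 < ads_form (D w v) (D w v)"
          using v by (simp add: blinfun.scaleR_right ads_form_simps zero_less_mult_iff)
      qed
      then show False using no by blast
    qed
    then obtain w v where w: "\<And>k. w k \<in> ball w0 (min r (inverse (real (Suc k))))"
      and v: "\<And>k. v k \<in> L \<inter> sphere 0 1" and neg: "\<And>k. ads_form (D (w k) (v k)) (D (w k) (v k)) \<le> 0"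
      by metis
    have "seq_compact (L \<inter> sphere 0 1)"
      by (intro compact_imp_seq_compact closed_Int_compact closed_subspace L) simp
    then obtain u s where u: "u \<in> L \<inter> sphere 0 1" and s: "strict_mono s" and vs: "(v \<circ> s) \<longlonglongrightarrow> u"
      using v by (meson seq_compactE)
    have "w \<longlonglongrightarrow> w0"
    proof (rule metric_tendsto_imp_tendsto[OF LIMSEQ_inverse_real_of_nat])
      show "\<forall>\<^sub>F k in sequentially. dist (w k) w0 \<le> dist (inverse (real (Suc k))) 0"
        using w by (intro always_eventually) (auto simp: dist_commute less_imp_le)
    qed
    then have "(w \<circ> s) \<longlonglongrightarrow> w0" using s by (rule LIMSEQ_subseq_LIMSEQ)
    moreover have "isCont D w0" using D W by (simp add: continuous_on_eq_continuous_at)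
    ultimately have "(\<lambda>k. D (w (s k))) \<longlonglongrightarrow> D w0"
      using isCont_tendsto_compose[of w0 D "w \<circ> s"] by (simp add: o_def)
    then have "(\<lambda>k. D (w (s k)) (v (s k))) \<longlonglongrightarrow> D w0 u"
      using vs by (intro blinfun.tendsto) (simp_all add: o_def)
    then have "(\<lambda>k. ads_form (D (w (s k)) (v (s k))) (D (w (s k)) (v (s k)))) \<longlonglongrightarrow> ads_form (D w0 u) (D w0 u)"
      by (intro ads_form.tendsto)
    then have "ads_form (D w0 u) (D w0 u) \<le> 0"
      using neg LIMSEQ_le_const2 by blast
    then show False using pos[of u] u by fastforce
  qed
qed

section \<open>The timelike coordinates and a time function on the limit set\<close>

definition timelike_part :: "real ^ ('n::finite + 2) \<Rightarrow> real ^ 2" where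
  "timelike_part x = (\<chi> j. x $ Inr j)"

lemma linear_timelike_part: "linear timelike_part"
  by (rule linearI) (simp_all add: timelike_part_def vec_eq_iff)

text \<open>Shows that a nonzero vector on which the form is at most 0 has nonzero timelike part,
  and that a vector without timelike part is spacelike or 0.\<close>

lemma ads_form_timelike_part: "ads_form x x = (norm x)\<^sup>2 - 2 * (norm (timelike_part x))\<^sup>2"
proof -
  have "(norm x)\<^sup>2 = (\<Sum>k\<in>UNIV <+> UNIV. x $ k * x $ k)"
    by (simp add: power2_norm_eq_inner inner_vec_def)
  also have "\<dots> = (\<Sum>i\<in>UNIV. x $ Inl i * x $ Inl i) + (\<Sum>j\<in>UNIV. x $ Inr j * x $ Inr j)"
    by (subst sum.Plus) simp_all
  moreover have "(norm (timelike_part x))\<^sup>2 = (\<Sum>j\<in>UNIV. x $ Inr j * x $ Inr j)"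
    by (simp add: power2_norm_eq_inner inner_vec_def timelike_part_def)
  ultimately show ?thesis by (simp add: ads_form_def)
qed

lemma boundary_AdS_null:
  assumes "rp_class x \<in> boundary_AdS" "x \<noteq> 0"
  shows "ads_form x x = 0"
proof -
  obtain y where y: "rp_class x = rp_class y" "y \<noteq> 0" "ads_form y y = 0"
    using assms by (auto simp: boundary_AdS_def)
  then obtain c where "x = c *\<^sub>R y" using rp_class_eq_iff assms(2) by metis
  then show ?thesis using y by (simp add: ads_form_simps)
qed

locale limit_set_in_boundary = acausal_cone +
  assumes boundary: "limit_set \<Gamma> \<subseteq> boundary_AdS"
begin

lemma limit_null: "rp_class x \<in> limit_set \<Gamma> \<Longrightarrow> x \<noteq> 0 \<Longrightarrow> ads_form x x = 0"
  using boundary boundary_AdS_null by blast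

text \<open>The cone over the image \<open>F\<close> of \<open>K\<close> in projective space is the
  union of \<open>K\<close> and its negative, so \<open>F\<close> is closed, and it suffices that
  \<open>F\<close> contains the attracting fixed points.\<close>

lemma limit_in_cone:
  assumes "rp_class x \<in> limit_set \<Gamma>" "x \<noteq> 0"
  shows "x \<in> K \<or> - x \<in> K"
proof -
  define F where "F = rp_class ` (K - {0})"
  have F: "rp_class y \<in> F \<longleftrightarrow> y \<in> K \<or> - y \<in> K" if y0: "y \<noteq> 0" for y
  proof
    assume "rp_class y \<in> F"
    then obtain z where "rp_class y = rp_class z" "z \<in> K - {0}" unfolding F_def by (rule imageE)
    then have z: "z \<in> K" "z \<noteq> 0" "rp_class z = rp_class y" by simp_all
    then obtain c where c: "y = c *\<^sub>R z" using rp_class_eq_iff[OF z(2) y0] by blast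
    have "\<bar>c\<bar> *\<^sub>R z \<in> K" using z(1) cone_K by (simp add: cone_def)
    then show "y \<in> K \<or> - y \<in> K" by (cases "c \<ge> 0") (simp_all add: c)
  next
    assume "y \<in> K \<or> - y \<in> K"
    then show "rp_class y \<in> F"
    proof
      assume "- y \<in> K"
      then have "rp_class (- y) \<in> F" unfolding F_def using y0 by (intro imageI) simp
      then show ?thesis by simp
    qed (use y0 in \<open>simp add: F_def\<close>)
  qed
  have "closed F"
  proof -
    have "0 \<in> K" using cone_K interior_K interior_subset unfolding cone_def
      by (metis all_not_in_conv order_refl scaleR_zero_left subsetD)
    have "insert 0 {y. rp_class y \<in> F} = K \<union> uminus -` K"
    proof (rule Set.set_eqI)
      fix y show "y \<in> insert 0 {y. rp_class y \<in> F} \<longleftrightarrow> y \<in> K \<union> uminus -` K"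
        using F[of y] \<open>0 \<in> K\<close> by (cases "y = 0") auto
    qed
    moreover have "closed (K \<union> uminus -` K)"
      by (intro closed_Un closed_vimage closed_K continuous_intros)
    ultimately show ?thesis by (simp only: closed_rp_iff)
  qed
  moreover have "{p. \<exists>g\<in>\<Gamma>. proximal g \<and> attracting_fixed_point g p} \<subseteq> F"
  proof safe
    fix p g assume g: "g \<in> \<Gamma>" "proximal g" "attracting_fixed_point g p"
    obtain y where y: "y \<noteq> 0" "p = rp_class y" using rp_class_surj .
    have "p \<in> limit_set \<Gamma>"
      unfolding limit_set_def using g by (intro subsetD[OF closure_subset]) blast
    then have "ads_form y y = 0" using limit_null y by simp
    then have "y \<in> K \<or> - y \<in> K"
      using proximal_eigenvectors[OF g(1,2) y(1)] g(3) y(2) by metis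
    then show "p \<in> F" using F y by simp
  qed
  ultimately have "limit_set \<Gamma> \<subseteq> F"
    unfolding limit_set_def by (intro closure_minimal)
  then show ?thesis using F assms by blast
qed

text \<open>Signs are adjusted to bring both vectors into \<open>K\<close>. As \<open>y\<close> is
  any isotropic vector of the cone up to sign, the repelling eigenvector \<open>q\<close> may be
  inserted as well as a limit point.\<close>

lemma limit_acausal:
  assumes x: "rp_class x \<in> limit_set \<Gamma>" "x \<noteq> 0" and y: "y \<in> K \<or> - y \<in> K" "y \<noteq> 0" "ads_form y y = 0"
    and xy: "ads_form x y = 0"
  shows "rp_class x = rp_class y"
proof -
  obtain s t where st: "s *\<^sub>R x \<in> K" "t *\<^sub>R y \<in> K" "s \<in> {1, -1 :: real}" "t \<in> {1, -1 :: real}"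
  proof -
    have "\<exists>s\<in>{1, -1 :: real}. s *\<^sub>R x \<in> K" using limit_in_cone[OF x] by auto
    moreover have "\<exists>s\<in>{1, -1 :: real}. s *\<^sub>R y \<in> K" using y(1) by auto
    ultimately show thesis using that by blast
  qed
  have "rp_class (s *\<^sub>R x) = rp_class (t *\<^sub>R y)"
    using st x y xy limit_null[OF x] by (intro acausal) (auto simp: ads_form_simps)
  then show ?thesis using st by auto
qed

text \<open>The timelike part does not vanish on \<open>K\<close> minus 0, so it maps a compact
  convex slice onto a compact convex subset of the plane that misses the origin; a line separates
  the two. Timelike parts of \<open>K\<close> are thus confined to an open half plane, where angles
  are well defined.\<close>

lemma timelike_part_positive:
  obtains e where "\<And>x. x \<in> K \<Longrightarrow> x \<noteq> 0 \<Longrightarrow> 0 < e \<bullet> timelike_part x"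
proof -
  let ?S = "{x \<in> K. a \<bullet> x = 1}"
  obtain c where c: "c > 0" "\<And>x. x \<in> K \<Longrightarrow> c * norm x \<le> a \<bullet> x"
    using salient_cone_norm_bound[OF closed_K cone_K pos] by blast
  have "norm x \<le> 1 / c" if "x \<in> ?S" for x
    using c(1) c(2)[of x] that by (simp add: field_simps)
  then have "bounded ?S" unfolding bounded_iff by blast
  moreover have S: "?S = K \<inter> {x. a \<bullet> x = 1}" by blast
  then have "closed ?S" using closed_K closed_hyperplane[of a 1] by (simp only: closed_Int)
  ultimately have cS: "compact ?S" by (simp add: compact_eq_bounded_closed)
  have "convex ?S" unfolding S using convex_K convex_hyperplane[of a 1] by (simp add: convex_Int)
  then have conv: "convex (timelike_part ` ?S)" by (intro convex_linear_image linear_timelike_part)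
  have "compact (timelike_part ` ?S)"
    using linear_timelike_part
    by (intro compact_continuous_image linear_continuous_on cS) (simp add: linear_conv_bounded_linear)
  then have clo: "closed (timelike_part ` ?S)" by (rule compact_imp_closed)
  have nz: "timelike_part x \<noteq> 0" if "x \<in> K" "x \<noteq> 0" for x
    using form_nonpos[OF that(1)] that(2) by (auto simp: ads_form_timelike_part)
  have "0 \<notin> timelike_part ` ?S"
  proof
    assume "0 \<in> timelike_part ` ?S"
    then obtain x where x: "x \<in> ?S" "timelike_part x = 0" by auto
    then have "x \<noteq> 0" by auto
    then show False using nz x by blast
  qed
  from separating_hyperplane_closed_0[OF conv clo this]
  obtain e b where e: "0 < b" "\<forall>z\<in>timelike_part ` ?S. b < e \<bullet> z" by blast
  show thesis
  proof
    fix x assume x: "x \<in> K" "x \<noteq> 0"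
    then have ax: "0 < a \<bullet> x" by (rule pos)
    then have "x /\<^sub>R (a \<bullet> x) \<in> ?S" using x cone_K by (simp add: cone_def)
    then have "b < e \<bullet> timelike_part (x /\<^sub>R (a \<bullet> x))" using e(2) by blast
    then have "0 < e \<bullet> timelike_part (x /\<^sub>R (a \<bullet> x))" using e(1) by linarith
    then show "0 < e \<bullet> timelike_part x"
      using ax by (simp add: linear_scale[OF linear_timelike_part] zero_less_mult_iff)
  qed
qed

text \<open>
  A point of the limit set where the time function \<open>\<tau>\<close>, the slope of the timelike part, is
  maximal: there every tangent direction is horizontal, hence spacelike.
\<close>

lemma spacelike_tangent_point:
  assumes "limit_set \<Gamma> \<noteq> {}"
  obtains p where "p \<in> limit_set \<Gamma>"
    "\<And>\<gamma> u d. (\<gamma> has_vector_derivative u) (at 0) \<Longrightarrow> 0 < d \<Longrightarrow>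
      (\<And>t. \<bar>t\<bar> < d \<Longrightarrow> \<gamma> t \<noteq> 0 \<and> rp_class (\<gamma> t) \<in> limit_set \<Gamma>) \<Longrightarrow> rp_class (\<gamma> 0) = p \<Longrightarrow>
      ads_form (\<gamma> 0) u = 0 \<Longrightarrow> 0 < ads_form u u \<or> u \<in> span {\<gamma> 0}"
proof -
  obtain e where e: "\<And>x. x \<in> K \<Longrightarrow> x \<noteq> 0 \<Longrightarrow> 0 < e \<bullet> timelike_part x"
    using timelike_part_positive by metis
  \<comment> \<open>The quarter turn of \<open>e\<close>: the quotient \<tau> is the tangent of the
    angle from \<open>e\<close> to the timelike part.\<close>
  define e' :: "real ^ 2" where "e' = (\<chi> j. if j = 1 then - e $ 2 else e $ 1)"
  define f where "f x = e \<bullet> timelike_part x" for x :: "real ^ ('a + 2)"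
  define f' where "f' x = e' \<bullet> timelike_part x" for x :: "real ^ ('a + 2)"
  define \<tau> where "\<tau> x = f' x / f x" for x
  interpret f: bounded_linear f
    unfolding f_def using linear_timelike_part
    by (intro bounded_linear_compose[OF bounded_linear_inner_right]) (simp add: linear_conv_bounded_linear)
  interpret f': bounded_linear f'
    unfolding f'_def using linear_timelike_part
    by (intro bounded_linear_compose[OF bounded_linear_inner_right]) (simp add: linear_conv_bounded_linear)
  have f_nz: "f x \<noteq> 0" if "rp_class x \<in> limit_set \<Gamma>" "x \<noteq> 0" for x
    using limit_in_cone[OF that] e[of x] e[of "- x"] that(2) f.scaleR[of "-1" x]
    by (auto simp: f_def)
  have \<tau>_scale: "\<tau> (c *\<^sub>R x) = \<tau> x" if "c \<noteq> 0" for c x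
    using that by (simp add: \<tau>_def f.scaleR f'.scaleR)
  define S where "S = {x \<in> sphere 0 1. rp_class x \<in> limit_set \<Gamma>}"
  have "closed (insert 0 {x. rp_class x \<in> limit_set \<Gamma>})"
    using closed_rp_iff[of "limit_set \<Gamma>"] by (simp add: limit_set_def)
  then have "compact (insert 0 {x. rp_class x \<in> limit_set \<Gamma>} \<inter> sphere 0 1)"
    by (intro closed_Int_compact) simp_all
  moreover have "insert 0 {x. rp_class x \<in> limit_set \<Gamma>} \<inter> sphere 0 1 = S" by (auto simp: S_def)
  ultimately have cS: "compact S" by simp
  have normS: "x /\<^sub>R norm x \<in> S" if "rp_class x \<in> limit_set \<Gamma>" "x \<noteq> 0" for x
    using that by (simp add: S_def)
  obtain p1 where p1: "p1 \<in> limit_set \<Gamma>" using assms by blast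
  obtain x1 where "x1 \<noteq> 0" "p1 = rp_class x1" using rp_class_surj .
  then have "S \<noteq> {}" using normS p1 by blast
  have S_nz: "f x \<noteq> 0" if "x \<in> S" for x using that by (intro f_nz) (auto simp: S_def)
  have "continuous_on S \<tau>"
    unfolding \<tau>_def using S_nz
    by (intro continuous_on_divide f.continuous_on f'.continuous_on continuous_on_id) auto
  then obtain x0 where x0: "x0 \<in> S" and max: "\<And>x. x \<in> S \<Longrightarrow> \<tau> x \<le> \<tau> x0"
    using continuous_attains_sup[OF cS \<open>S \<noteq> {}\<close>] by blast
  have x0n: "x0 \<noteq> 0" using x0 by (auto simp: S_def)
  show thesis
  proof (rule that)
    show "rp_class x0 \<in> limit_set \<Gamma>" using x0 by (simp add: S_def)
    fix \<gamma> :: "real \<Rightarrow> real ^ ('a + 2)" and u d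
    assume der: "(\<gamma> has_vector_derivative u) (at 0)" and d: "0 < d"
      and \<gamma>: "\<And>t. \<bar>t\<bar> < d \<Longrightarrow> \<gamma> t \<noteq> 0 \<and> rp_class (\<gamma> t) \<in> limit_set \<Gamma>"
      and \<gamma>0: "rp_class (\<gamma> 0) = rp_class x0" and orth: "ads_form (\<gamma> 0) u = 0"
    have g0: "\<gamma> 0 \<noteq> 0" "rp_class (\<gamma> 0) \<in> limit_set \<Gamma>" using \<gamma>[of 0] d by auto
    have nz: "f (\<gamma> 0) \<noteq> 0" using f_nz g0 by blast
    obtain c where c: "c \<noteq> 0" "\<gamma> 0 = c *\<^sub>R x0" using \<gamma>0 rp_class_eq_iff[OF x0n g0(1)] by metis
    have le: "\<tau> (\<gamma> t) \<le> \<tau> (\<gamma> 0)" if "\<bar>t\<bar> < d" for t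
    proof -
      have "\<tau> (\<gamma> t) = \<tau> (\<gamma> t /\<^sub>R norm (\<gamma> t))" using \<gamma>[OF that] by (intro \<tau>_scale[symmetric]) simp
      also have "\<dots> \<le> \<tau> x0" using \<gamma>[OF that] by (intro max normS) auto
      also have "\<tau> x0 = \<tau> (\<gamma> 0)" using c by (simp add: \<tau>_scale)
      finally show ?thesis .
    qed
    have df: "DERIV (\<lambda>t. f (\<gamma> t)) 0 :> f u" and df': "DERIV (\<lambda>t. f' (\<gamma> t)) 0 :> f' u"
      using f.has_vector_derivative[OF der] f'.has_vector_derivative[OF der]
      by (simp_all add: has_real_derivative_iff_has_vector_derivative)
    have "DERIV (\<lambda>t. \<tau> (\<gamma> t)) 0 :> (f' u * f (\<gamma> 0) - f' (\<gamma> 0) * f u) / (f (\<gamma> 0) * f (\<gamma> 0))"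
      unfolding \<tau>_def by (rule DERIV_divide[OF df' df nz])
    then have "(f' u * f (\<gamma> 0) - f' (\<gamma> 0) * f u) / (f (\<gamma> 0) * f (\<gamma> 0)) = 0"
      using d le by (intro DERIV_local_max[where d = d]) auto
    then have eq: "f' u * f (\<gamma> 0) = f' (\<gamma> 0) * f u" using nz by simp
    \<comment> \<open>\<open>w\<close> is \<open>u\<close> modulo \<open>\<gamma> 0\<close>,
      normalised by \<open>f w = 0\<close>; criticality of \<tau> then gives
      \<open>f' w = 0\<close>. Since \<open>e\<close> and \<open>e'\<close> form a basis of the
      plane, \<open>w\<close> has no timelike part.\<close>
    define k where "k = f u / f (\<gamma> 0)"
    define w where "w = u - k *\<^sub>R \<gamma> 0"
    have fw: "f w = 0" "f' w = 0"
      using nz eq by (simp_all add: w_def f.diff f.scaleR f'.diff f'.scaleR k_def field_simps)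
    have "timelike_part w = 0"
    proof -
      define z where "z = timelike_part w"
      have 1: "e $ 1 * z $ 1 + e $ 2 * z $ 2 = 0"
        using fw(1) by (simp add: f_def z_def inner_vec_def UNIV_2)
      have 2: "- e $ 2 * z $ 1 + e $ 1 * z $ 2 = 0"
        using fw(2) by (simp add: f'_def e'_def z_def inner_vec_def UNIV_2)
      have "e \<noteq> 0" using nz by (auto simp: f_def)
      then have E: "(e $ 1)\<^sup>2 + (e $ 2)\<^sup>2 \<noteq> 0"
        by (auto simp: sum_power2_eq_zero_iff vec_eq_iff forall_2)
      have "e $ 1 * (e $ 1 * z $ 1 + e $ 2 * z $ 2) - e $ 2 * (- e $ 2 * z $ 1 + e $ 1 * z $ 2) = 0"
        "e $ 2 * (e $ 1 * z $ 1 + e $ 2 * z $ 2) + e $ 1 * (- e $ 2 * z $ 1 + e $ 1 * z $ 2) = 0"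
        unfolding 1 2 by simp_all
      then have "((e $ 1)\<^sup>2 + (e $ 2)\<^sup>2) * z $ 1 = 0" "((e $ 1)\<^sup>2 + (e $ 2)\<^sup>2) * z $ 2 = 0"
        by algebra+
      then have "z $ 1 = 0" "z $ 2 = 0" using E mult_eq_0_iff by blast+
      then show ?thesis by (simp add: z_def[symmetric] vec_eq_iff forall_2)
    qed
    then have fww: "ads_form w w = (norm w)\<^sup>2" by (simp add: ads_form_timelike_part)
    have "ads_form u u = ads_form w w"
      using orth limit_null[OF g0(2,1)]
      by (simp add: w_def ads_form_simps ads_form_commute[of u "\<gamma> 0"])
    moreover have "u \<in> span {\<gamma> 0}" if "w = 0"
      using that by (simp add: w_def span_base span_scale)
    ultimately show "0 < ads_form u u \<or> u \<in> span {\<gamma> 0}" using fww by (cases "w = 0") auto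
  qed
qed

end


section \<open>Blow-up at an attracting fixed point\<close>

lemma has_vector_derivative_quotient_tendsto:
  assumes "(f has_vector_derivative D) (at 0)"
  shows "((\<lambda>t. (f t - f 0) /\<^sub>R t) \<longlongrightarrow> D) (at (0 :: real))"
proof -
  have "((\<lambda>t. norm ((f t - f 0) - t *\<^sub>R D) / norm t) \<longlongrightarrow> 0) (at 0)"
    using assms by (simp add: has_vector_derivative_def has_derivative_iff_norm)
  moreover have "\<forall>\<^sub>F t in at (0 :: real). norm ((f t - f 0) - t *\<^sub>R D) / norm t = norm ((f t - f 0) /\<^sub>R t - D)"
  proof (rule eventually_at_filter[THEN iffD2], intro always_eventually allI impI)
    fix t :: real assume t: "t \<noteq> 0"
    have "(f t - f 0) /\<^sub>R t - D = inverse t *\<^sub>R ((f t - f 0) - t *\<^sub>R D)"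
      using t by (simp add: scaleR_diff_right)
    then show "norm ((f t - f 0) - t *\<^sub>R D) / norm t = norm ((f t - f 0) /\<^sub>R t - D)"
      by (simp only: norm_scaleR) (simp add: divide_inverse mult.commute)
  qed
  ultimately have "((\<lambda>t. norm ((f t - f 0) /\<^sub>R t - D)) \<longlongrightarrow> 0) (at 0)"
    by (rule Lim_transform_eventually)
  then show ?thesis by (simp add: tendsto_norm_zero_iff LIM_zero_iff)
qed

lemma curve_has_vector_derivative:
  assumes "(\<sigma> has_derivative T) (at w)"
  shows "((\<lambda>t. \<sigma> (w + t *\<^sub>R v)) has_vector_derivative T v) (at (0 :: real))"
proof -
  interpret T: bounded_linear T using assms by (rule has_derivative_bounded_linear)
  have "((\<lambda>t. w + t *\<^sub>R v) has_derivative (\<lambda>t. t *\<^sub>R v)) (at (0 :: real))"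
    by (auto intro!: derivative_eq_intros)
  moreover have "(\<sigma> has_derivative T) (at (w + 0 *\<^sub>R v))" using assms by simp
  ultimately have "((\<lambda>t. \<sigma> (w + t *\<^sub>R v)) has_derivative (\<lambda>t. T (t *\<^sub>R v))) (at 0)"
    by (rule has_derivative_compose)
  then show ?thesis by (simp add: has_vector_derivative_def T.scaleR)
qed

text \<open>Straight lines in the slice give the curves in \<Lambda> that realise tangent vectors.
  The 1 in the denominator of the radius allows for \<open>v = 0\<close>.\<close>

lemma slice_curve:
  assumes par: "C1_parametrization W \<sigma>" and slice: "{w \<in> W. rp_class (\<sigma> w) \<in> \<Lambda>} = W \<inter> L"
    and L: "subspace L" and w: "w \<in> W" "w \<in> L" and v: "v \<in> L"
  obtains d :: real where "0 < d"
    "\<And>t. \<bar>t\<bar> < d \<Longrightarrow> \<sigma> (w + t *\<^sub>R v) \<noteq> 0 \<and> rp_class (\<sigma> (w + t *\<^sub>R v)) \<in> \<Lambda>"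
proof -
  have "open W" using par by (simp add: C1_parametrization_def)
  then obtain r where r: "r > 0" "ball w r \<subseteq> W" using w(1) by (auto simp: open_contains_ball)
  show thesis
  proof (rule that[of "r / (norm v + 1)"])
    show "0 < r / (norm v + 1)" using r by (simp add: add_nonneg_pos)
    fix t :: real assume t: "\<bar>t\<bar> < r / (norm v + 1)"
    have "\<bar>t\<bar> * norm v \<le> \<bar>t\<bar> * (norm v + 1)" by (intro mult_left_mono) auto
    also have "\<dots> < r" using t by (simp add: pos_less_divide_eq add_nonneg_pos)
    finally have "w + t *\<^sub>R v \<in> ball w r" by (simp add: dist_norm)
    then have W: "w + t *\<^sub>R v \<in> W" using r by blast
    have "w + t *\<^sub>R v \<in> L" using L w v by (simp add: subspace_add subspace_scale)
    then have "rp_class (\<sigma> (w + t *\<^sub>R v)) \<in> \<Lambda>" using slice W by blast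
    moreover have "\<sigma> (w + t *\<^sub>R v) \<noteq> 0" using par W unfolding C1_parametrization_def by (metis image_eqI)
    ultimately show "\<sigma> (w + t *\<^sub>R v) \<noteq> 0 \<and> rp_class (\<sigma> (w + t *\<^sub>R v)) \<in> \<Lambda>" by blast
  qed
qed

text \<open>The situation once the proximal element is chosen: \<sigma> is a slice chart whose value
  at \<open>w0\<close> spans the attracting line of \<open>A\<close>, \<open>T\<close> is its
  derivative there, and \<open>q\<close> spans the repelling line.\<close>

locale spacelike_fixed_point = limit_set_in_boundary K a \<Gamma>
  for K :: "(real ^ ('n::finite + 2)) set" and a \<Gamma> +
  fixes W :: "(real ^ 'n) set" and \<sigma> :: "real ^ 'n \<Rightarrow> real ^ ('n + 2)" and L w0 T g A \<mu> q
  assumes par: "C1_parametrization W \<sigma>"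
    and slice: "{w \<in> W. rp_class (\<sigma> w) \<in> limit_set \<Gamma>} = W \<inter> L"
    and L: "subspace L" and dim_L: "dim L + 1 = CARD('n)"
    and w0: "w0 \<in> W" "w0 \<in> L" and der: "(\<sigma> has_derivative T) (at w0)"
    and imm: "T v \<in> span {\<sigma> w0} \<Longrightarrow> v = 0"
    and spacelike: "v \<in> L \<Longrightarrow> v \<noteq> 0 \<Longrightarrow> 0 < ads_form (T v) (T v)"
    and g: "g \<in> \<Gamma>" "A \<in> g" and \<mu>: "1 < \<bar>\<mu>\<bar>"
    and A\<sigma>: "A *v \<sigma> w0 = \<mu> *\<^sub>R \<sigma> w0" and Aq: "A *v q = inverse \<mu> *\<^sub>R q"
    and q: "q \<in> K" "q \<noteq> 0" "ads_form q q = 0" and pq: "ads_form (\<sigma> w0) q \<noteq> 0"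
begin

abbreviation "p \<equiv> \<sigma> w0"
text \<open>The tangent space at \<open>p\<close> of the cone over the limit set.\<close>

definition "P = span (insert p (T ` L))"
text \<open>The projection along \<open>p\<close> onto the form-orthogonal of \<open>q\<close>: it
  measures vectors modulo \<open>p\<close>.\<close>

definition "\<pi> y = y - (ads_form y q / ads_form p q) *\<^sub>R p"

lemma p_nonzero: "p \<noteq> 0"
  using pq by (auto simp: ads_form_simps)

lemma p_limit: "rp_class p \<in> limit_set \<Gamma>"
  using slice w0 by blast

lemma linear_T: "linear T"
  using der has_derivative_linear by blast

lemma subspace_TL: "subspace (T ` L)"
  by (rule linear_subspace_image[OF linear_T L])

lemma P_cases:
  assumes "u \<in> P"
  obtains c v where "u = c *\<^sub>R p + T v" "v \<in> L"
proof -
  obtain c where "u - c *\<^sub>R p \<in> span (T ` L)" using assms by (auto simp: P_def span_insert)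
  then have "u - c *\<^sub>R p \<in> T ` L" using subspace_TL by (simp add: span_eq_iff[THEN iffD2])
  then obtain v where "u - c *\<^sub>R p = T v" "v \<in> L" by blast
  then show thesis using that[of c v] by (simp add: algebra_simps)
qed

lemma T_in_P: "v \<in> L \<Longrightarrow> T v \<in> P" and p_in_P: "p \<in> P" and subspace_P: "subspace P"
  by (auto simp: P_def intro: span_base)

lemma dim_P: "dim P = CARD('n)"
proof -
  have "inj T" using imm span_zero by (subst linear_injective_0[OF linear_T]) force
  then have d: "dim (T ` L) = dim L"
    by (intro dim_image_eq linear_T) (metis inj_on_subset subset_UNIV)
  have "p \<notin> span (T ` L)"
  proof
    assume "p \<in> span (T ` L)"
    then have "p \<in> T ` L" using subspace_TL by (simp add: span_eq_iff[THEN iffD2])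
    then obtain v where v: "p = T v" by blast
    then have "v = 0" using imm[of v] by (simp add: span_base)
    then show False using v p_nonzero linear_0[OF linear_T] by simp
  qed
  then show ?thesis using d dim_L by (simp add: P_def dim_insert)
qed

text \<open>Adding a multiple of \<open>p\<close> to \<open>T v\<close> does not change the form, as
  \<open>p\<close> is isotropic and orthogonal to all tangent vectors; by \<open>spacelike\<close>,
  the form on \<open>P\<close> degenerates exactly along \<open>p\<close>.\<close>

sublocale null_pair P p q
proof
  show "subspace P" "p \<in> P" by (fact subspace_P, fact p_in_P)
  show null: "ads_form p p = 0" by (rule ads_form_derivative_null(1)[OF par w0(1) der])
  show "ads_form q q = 0" "ads_form p q \<noteq> 0" "dim P = CARD('n)" by (fact q pq dim_P)+
  have pT: "ads_form p (T v) = 0" for v by (rule ads_form_derivative_null(2)[OF par w0(1) der])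
  show "ads_form u p = 0" if u: "u \<in> P" for u
  proof -
    obtain c v where v: "u = c *\<^sub>R p + T v" "v \<in> L" using P_cases[OF u] .
    show ?thesis using null pT[of v] by (simp add: v(1) ads_form_simps ads_form_commute[of "T v" p])
  qed
  show "u \<in> span {p}" if u: "u \<in> P" "ads_form u u \<le> 0" for u
  proof -
    obtain c v where v: "u = c *\<^sub>R p + T v" "v \<in> L" using P_cases[OF u(1)] .
    have "ads_form u u = ads_form (T v) (T v)"
      using null pT[of v] by (simp add: v(1) ads_form_simps ads_form_commute[of "T v" p])
    then have "v = 0" using spacelike[OF v(2)] u(2) by fastforce
    then show ?thesis using v(1) linear_0[OF linear_T] by (simp add: span_base span_scale)
  qed
qed

lemma bounded_linear_\<pi>: "bounded_linear \<pi>"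
  unfolding \<pi>_def
  by (intro bounded_linear_sub bounded_linear_ident bounded_linear_scaleR_const
      bounded_linear_divide[THEN bounded_linear_compose] ads_form.bounded_linear_left)

lemma \<pi>_p: "\<pi> p = 0"
  using pq by (simp add: \<pi>_def)

text \<open>Tangency for a functional given by a Euclidean normal \<open>z\<close> of
  \<open>P\<close>; it serves both the invariance of \<open>P\<close> and the blow-up.\<close>

lemma near_p_estimate:
  assumes z: "\<And>u. u \<in> P \<Longrightarrow> z \<bullet> u = 0" and \<epsilon>: "0 < \<epsilon>"
  obtains U where "open U" "rp_class p \<in> U"
    "\<And>y. y \<noteq> 0 \<Longrightarrow> rp_class y \<in> limit_set \<Gamma> \<Longrightarrow> rp_class y \<in> U \<Longrightarrow> \<bar>z \<bullet> y\<bar> \<le> \<epsilon> * norm (\<pi> y)"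
proof (rule tangent_estimate[OF par slice L boundary w0 der imm _ _ _ bounded_linear_\<pi> \<pi>_p _ \<epsilon>])
  show "bounded_linear (\<lambda>y. z \<bullet> y)" by (rule bounded_linear_inner_right)
  show "z \<bullet> p = 0" using z p_in_P by blast
  show "z \<bullet> T v = 0" if "v \<in> L" for v using z T_in_P[OF that] by blast
  show "u \<in> span {p}" if "\<pi> u = 0" for u
  proof -
    have "u = (ads_form u q / ads_form p q) *\<^sub>R p" using that by (simp add: \<pi>_def)
    then show ?thesis by (metis insertI1 span_base span_scale)
  qed
qed (use that in auto)

section \<open>The action of \<open>A\<close> on the tangent space at \<open>p\<close>\<close>

lemma AO: "A \<in> carrier O_n_2"
  using PO_n_2_lift(1)[OF Gamma_carrier[OF g(1)] g(2)] .

lemma limit_A: "rp_class y \<in> limit_set \<Gamma> \<Longrightarrow> y \<noteq> 0 \<Longrightarrow> rp_class (A *v y) \<in> limit_set \<Gamma>"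
  using limit_set_invariant[OF subgroup_\<Gamma> g] by blast

lemma A_nonzero: "y \<noteq> 0 \<Longrightarrow> A *v y \<noteq> 0"
  by (rule O_n_2_mult_nonzero[OF AO])

lemma \<mu>_nonzero: "\<mu> \<noteq> 0"
  using \<mu> by auto

text \<open>\<open>A\<close> maps a curve of the limit set through \<open>p\<close> to another one.\<close>

lemma A_TL:
  assumes v: "v \<in> L"
  shows "A *v T v \<in> P"
proof -
  have ortho: "z \<bullet> (A *v T v) = 0" if z: "\<And>u. u \<in> P \<Longrightarrow> z \<bullet> u = 0" for z
  proof -
    obtain d where d: "0 < d"
      and \<gamma>: "\<And>t. \<bar>t\<bar> < d \<Longrightarrow> \<sigma> (w0 + t *\<^sub>R v) \<noteq> 0 \<and> rp_class (\<sigma> (w0 + t *\<^sub>R v)) \<in> limit_set \<Gamma>"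
      using slice_curve[OF par slice L w0 v] by blast
    define y where "y t = A *v \<sigma> (w0 + t *\<^sub>R v)" for t :: real
    have y0: "y 0 = \<mu> *\<^sub>R p" by (simp add: y_def A\<sigma>)
    have "((\<lambda>t. \<sigma> (w0 + t *\<^sub>R v)) has_vector_derivative T v) (at 0)"
      by (rule curve_has_vector_derivative[OF der])
    then have dy: "(y has_vector_derivative A *v T v) (at 0)"
      unfolding y_def
      by (rule bounded_linear.has_vector_derivative[OF matrix_vector_mul_bounded_linear])
    have quot: "((\<lambda>t. (y t - y 0) /\<^sub>R t) \<longlongrightarrow> A *v T v) (at 0)"
      by (rule has_vector_derivative_quotient_tendsto[OF dy])
    have "(y \<longlongrightarrow> y 0) (at 0)"
      using has_vector_derivative_continuous[OF dy] by (simp add: continuous_at)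
    then have lim: "((\<lambda>t. rp_class (y t)) \<longlongrightarrow> rp_class p) (at 0)"
      using tendsto_rp_class[of y "y 0" "at 0"] y0 p_nonzero \<mu>_nonzero by simp
    have lz: "((\<lambda>t. \<bar>z \<bullet> ((y t - y 0) /\<^sub>R t)\<bar>) \<longlongrightarrow> \<bar>z \<bullet> (A *v T v)\<bar>) (at 0)"
      by (intro tendsto_intros quot)
    have l\<pi>: "((\<lambda>t. norm (\<pi> ((y t - y 0) /\<^sub>R t))) \<longlongrightarrow> norm (\<pi> (A *v T v))) (at 0)"
      by (intro tendsto_norm bounded_linear.tendsto[OF bounded_linear_\<pi>] quot)
    \<comment> \<open>The tangency estimate holds along the image curve. As \<open>z\<close> and
      \<pi> annihilate \<open>y 0\<close>, it passes to the difference quotient and, as t tends to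
      0, to the derivative.\<close>
    have le: "\<bar>z \<bullet> (A *v T v)\<bar> \<le> \<epsilon> * norm (\<pi> (A *v T v))" if \<epsilon>: "0 < \<epsilon>" for \<epsilon>
    proof (rule tendsto_le[OF trivial_limit_at _ lz])
      show "((\<lambda>t. \<epsilon> * norm (\<pi> ((y t - y 0) /\<^sub>R t))) \<longlongrightarrow> \<epsilon> * norm (\<pi> (A *v T v))) (at 0)"
        by (intro tendsto_intros l\<pi>)
      obtain U where U: "open U" "rp_class p \<in> U"
        and est: "\<And>y. y \<noteq> 0 \<Longrightarrow> rp_class y \<in> limit_set \<Gamma> \<Longrightarrow> rp_class y \<in> U \<Longrightarrow> \<bar>z \<bullet> y\<bar> \<le> \<epsilon> * norm (\<pi> y)"
        using near_p_estimate[OF z \<epsilon>] by blast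
      have "\<forall>\<^sub>F t in at 0. rp_class (y t) \<in> U" by (rule topological_tendstoD[OF lim U])
      moreover have "\<forall>\<^sub>F t in at 0. \<bar>t\<bar> < d"
        using d by (auto simp: eventually_at intro!: exI[of _ d])
      ultimately show "\<forall>\<^sub>F t in at 0. \<bar>z \<bullet> ((y t - y 0) /\<^sub>R t)\<bar> \<le> \<epsilon> * norm (\<pi> ((y t - y 0) /\<^sub>R t))"
      proof eventually_elim
        case (elim t)
        have "\<bar>z \<bullet> y t\<bar> \<le> \<epsilon> * norm (\<pi> (y t))"
          using \<gamma>[OF elim(2)] elim(1) by (intro est) (auto simp: y_def A_nonzero limit_A)
        then have "\<bar>inverse t\<bar> * \<bar>z \<bullet> y t\<bar> \<le> \<bar>inverse t\<bar> * (\<epsilon> * norm (\<pi> (y t)))"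
          by (intro mult_left_mono) auto
        moreover have "z \<bullet> ((y t - y 0) /\<^sub>R t) = inverse t * (z \<bullet> y t)"
          using z p_in_P by (simp add: y0 inner_diff_right)
        moreover have "\<pi> ((y t - y 0) /\<^sub>R t) = inverse t *\<^sub>R \<pi> (y t)"
          using \<pi>_p by (simp add: y0 linear_simps[OF bounded_linear_\<pi>])
        ultimately show ?case by (simp only: abs_mult norm_scaleR mult.left_commute)
      qed
    qed
    show ?thesis
    proof (rule ccontr)
      assume nz: "z \<bullet> (A *v T v) \<noteq> 0"
      define M where "M = norm (\<pi> (A *v T v)) + 1"
      have M: "M > 0" by (simp add: M_def add_nonneg_pos)
      define \<epsilon> where "\<epsilon> = \<bar>z \<bullet> (A *v T v)\<bar> / (2 * M)"
      have "\<epsilon> > 0" using nz M by (simp add: \<epsilon>_def)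
      then have "\<bar>z \<bullet> (A *v T v)\<bar> \<le> \<epsilon> * norm (\<pi> (A *v T v))" by (rule le)
      also have "\<dots> \<le> \<epsilon> * M" using \<open>\<epsilon> > 0\<close> by (simp add: M_def)
      also have "\<dots> = \<bar>z \<bullet> (A *v T v)\<bar> / 2" using M by (simp add: \<epsilon>_def)
      finally show False using nz by simp
    qed
  qed
  \<comment> \<open>Euclidean normals detect \<open>P\<close>: the normal component \<open>z\<close>
    of \<open>A *v T v\<close> is orthogonal to \<open>A *v T v\<close>, hence to itself.\<close>
  obtain u z where "u \<in> span P" and z: "\<And>w. w \<in> span P \<Longrightarrow> orthogonal z w" and eq: "A *v T v = u + z"
    using orthogonal_subspace_decomp_exists[of P "A *v T v"] by metis
  then have uP: "u \<in> P" using subspace_P by (simp add: span_eq_iff[THEN iffD2])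
  have zP: "z \<bullet> w = 0" if "w \<in> P" for w
    using z[of w] that by (simp add: orthogonal_def span_base)
  have "z \<bullet> z = 0" using ortho[OF zP] zP[OF uP] by (simp add: eq inner_add_right)
  then show ?thesis using eq uP by simp
qed

lemma A_P:
  assumes "u \<in> P"
  shows "A *v u \<in> P"
proof -
  obtain c v where v: "u = c *\<^sub>R p + T v" "v \<in> L" using P_cases[OF assms] .
  have "A *v u = (c * \<mu>) *\<^sub>R p + A *v T v"
    by (simp add: v(1) matrix_vector_right_distrib matrix_vector_mult_scaleR A\<sigma>)
  then show ?thesis
    using A_TL[OF v(2)] p_in_P subspace_P by (simp add: subspace_add subspace_scale)
qed

lemma A_P0:
  assumes "u \<in> P0"
  shows "A *v u \<in> P0"
proof -
  have "inverse \<mu> * ads_form (A *v u) q = ads_form (A *v u) (A *v q)" by (simp add: Aq ads_form_simps)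
  also have "\<dots> = 0" using O_n_2_form[OF AO, of u q] P0_orth(2)[OF assms] by simp
  finally show ?thesis using assms A_P \<mu>_nonzero by (simp add: P0_def)
qed

lemma A_V:
  assumes "u \<in> V"
  shows "A *v u \<in> V"
proof -
  obtain \<alpha> h \<beta> where u: "u = \<alpha> *\<^sub>R p + h + \<beta> *\<^sub>R q" and h: "h \<in> P0" using V_decomposition[OF assms] .
  have "A *v u = (\<alpha> * \<mu>) *\<^sub>R p + A *v h + (\<beta> * inverse \<mu>) *\<^sub>R q"
    by (simp add: u matrix_vector_right_distrib matrix_vector_mult_scaleR A\<sigma> Aq)
  then show ?thesis
    using A_P0[OF h] P0_V V_subspace p_V q_V by (auto intro!: subspace_add subspace_scale)
qed

text \<open>
  Blow-up at \<open>p\<close>: the orbit \<open>A\<^sup>k y\<close> of a point of the limit set converges to \<open>p\<close> in projective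
  space, but modulo \<open>p\<close> it stays bounded while its component normal to \<open>V\<close> keeps its size.
  Tangency of the limit set to \<open>P\<close> therefore forces this component to vanish.
\<close>

lemma limit_in_V:
  assumes y: "y \<noteq> 0" "rp_class y \<in> limit_set \<Gamma>"
  shows "y \<in> V"
proof (cases "ads_form y q = 0")
  case True
  have "rp_class q = rp_class y"
    using limit_acausal[OF y(2,1) _ q(2,3) True] q(1) by simp
  then obtain c where "y = c *\<^sub>R q" using rp_class_eq_iff q(2) y(1) by metis
  then show ?thesis using q_V V_subspace by (simp add: subspace_scale)
next
  case yq: False
  obtain n where n: "n \<noteq> 0" "V = {x. ads_form x n = 0}" "ads_form n n \<noteq> 0"
    and V_perp: "\<And>z. (\<And>v. v \<in> V \<Longrightarrow> ads_form z v = 0) \<Longrightarrow> \<exists>c. z = c *\<^sub>R n"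
    using V_hyperplane by metis
  obtain B where B: "B \<in> carrier O_n_2" "A ** B = mat 1" using O_n_2_inverse[OF AO] by metis
  have AB: "A *v (B *v x) = x" for x by (simp add: matrix_vector_mul_assoc B)
  \<comment> \<open>The inverse \<open>B\<close> preserves the orthogonal complement of
    \<open>V\<close> because \<open>A\<close> preserves \<open>V\<close>. As \<open>n\<close> is not
    isotropic, its eigenvalue is 1 or -1.\<close>
  obtain c where c: "B *v n = c *\<^sub>R n"
  proof -
    have "ads_form (B *v n) v = 0" if "v \<in> V" for v
      using O_n_2_form[OF AO, of "B *v n" v] A_V[OF that] by (simp add: AB n(2) ads_form_commute[of n])
    then show thesis using V_perp that by blast
  qed
  have "c * c * ads_form n n = ads_form n n"
    using O_n_2_form[OF B(1), of n n] by (simp add: c ads_form_simps)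
  then have c2: "c * c = 1" using n(3) by simp
  then have cabs: "\<bar>c\<bar> = 1" by (metis abs_mult_self_eq abs_1 abs_mult power2_eq_square power2_eq_1_iff abs_minus)
  have An: "A *v n = c *\<^sub>R n"
  proof -
    have "c *\<^sub>R (A *v n) = n" using AB[of n] by (simp add: c matrix_vector_mult_scaleR)
    then have "c *\<^sub>R n = (c * c) *\<^sub>R (A *v n)" by (metis scaleR_scaleR)
    then show ?thesis using c2 by simp
  qed
  define s where "s = ads_form y n / ads_form n n"
  have "y - s *\<^sub>R n \<in> V" using n(3) by (simp add: n(2) ads_form_simps s_def)
  then obtain \<alpha> h \<beta> where "y - s *\<^sub>R n = \<alpha> *\<^sub>R p + h + \<beta> *\<^sub>R q" and h: "h \<in> P0"
    by (rule V_decomposition)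
  then have y_eq: "y = \<alpha> *\<^sub>R p + h + \<beta> *\<^sub>R q + s *\<^sub>R n" by (simp add: algebra_simps)
  have nV: "ads_form v n = 0" if "v \<in> V" for v using that n(2) by blast
  \<comment> \<open>All summands of \<open>y\<close> other than the first are orthogonal to
    \<open>q\<close>, so \<open>ads_form y q\<close> is \<alpha> times
    \<open>ads_form p q\<close>.\<close>
  have \<alpha>: "\<alpha> \<noteq> 0"
  proof
    assume "\<alpha> = 0"
    then have "ads_form y q = 0"
      using P0_orth(2)[OF h] nV[OF q_V] by (simp add: y_eq ads_form_simps q(3) ads_form_commute[of n q])
    then show False using yq by simp
  qed
  define Y where "Y k = (((*v) A) ^^ k) y" for k
  define H where "H k = (((*v) A) ^^ k) h" for k
  have H: "H k \<in> P0 \<and> ads_form (H k) (H k) = ads_form h h" for k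
    by (induction k) (simp_all add: H_def h A_P0 O_n_2_form[OF AO])
  have Y: "Y k = (\<alpha> * \<mu> ^ k) *\<^sub>R p + H k + (\<beta> * inverse \<mu> ^ k) *\<^sub>R q + (s * c ^ k) *\<^sub>R n" for k
    by (induction k) (simp_all add: Y_def H_def y_eq matrix_vector_right_distrib
      matrix_vector_mult_scaleR A\<sigma> Aq An mult_ac)
  have Yl: "Y k \<noteq> 0 \<and> rp_class (Y k) \<in> limit_set \<Gamma>" for k
    by (induction k) (simp_all add: Y_def y A_nonzero limit_A)
  obtain b where b: "b > 0" "\<And>u. u \<in> P0 \<Longrightarrow> b * (norm u)\<^sup>2 \<le> ads_form u u" using P0_coercive by blast
  define R where "R = sqrt (ads_form h h / b)"
  have HR: "norm (H k) \<le> R" for k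
    using b(1) b(2)[of "H k"] H[of k] unfolding R_def by (intro real_le_rsqrt) (simp add: field_simps)
  have i\<mu>: "\<bar>inverse \<mu> ^ k\<bar> \<le> 1" for k
    using \<mu> by (simp add: power_abs power_le_one inverse_le_1_iff)
  obtain N where N: "N > 0" "\<And>u. norm (\<pi> u) \<le> norm u * N"
    using bounded_linear.pos_bounded[OF bounded_linear_\<pi>] by metis
  \<comment> \<open>The orbit without its component along \<open>p\<close>. It is bounded: the part
    in \<open>P0\<close> by coercivity, the part along \<open>q\<close> since it does not grow, the
    normal part since |c| = 1.\<close>
  define Z where "Z k = H k + (\<beta> * inverse \<mu> ^ k) *\<^sub>R q + (s * c ^ k) *\<^sub>R n" for k
  define b' where "b' = R + \<bar>\<beta>\<bar> * norm q + \<bar>s\<bar> * norm n"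
  have YZ: "Y k = (\<alpha> * \<mu> ^ k) *\<^sub>R p + Z k" for k by (simp add: Y Z_def)
  have Zb: "norm (Z k) \<le> b'" for k
    unfolding Z_def b'_def
  proof (intro norm_triangle_le add_mono HR)
    have "\<bar>\<beta>\<bar> * \<bar>inverse \<mu> ^ k\<bar> \<le> \<bar>\<beta>\<bar> * 1" by (intro mult_left_mono i\<mu>) simp
    then show "norm ((\<beta> * inverse \<mu> ^ k) *\<^sub>R q) \<le> \<bar>\<beta>\<bar> * norm q"
      by (simp only: norm_scaleR abs_mult mult_1_right) (intro mult_right_mono, auto)
    show "norm ((s * c ^ k) *\<^sub>R n) \<le> \<bar>s\<bar> * norm n" by (simp add: abs_mult power_abs cabs)
  qed
  define M where "M = b' * N"
  have \<pi>Y: "norm (\<pi> (Y k)) \<le> M" for k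
  proof -
    have "\<pi> (Y k) = \<pi> (Z k)" by (simp add: YZ linear_simps[OF bounded_linear_\<pi>] \<pi>_p)
    also have "norm \<dots> \<le> norm (Z k) * N" by (rule N)
    also have "\<dots> \<le> b' * N" using N(1) by (intro mult_right_mono Zb) simp
    finally show ?thesis by (simp add: M_def)
  qed
  have lim: "(\<lambda>k. rp_class (Y k)) \<longlonglongrightarrow> rp_class p"
  proof -
    have 0: "(\<lambda>k. inverse \<mu> ^ k) \<longlonglongrightarrow> 0"
      using \<mu> by (intro LIMSEQ_power_zero) (simp add: inverse_less_1_iff)
    have "Bseq Z" using Zb by (rule BseqI')
    have "Zfun (\<lambda>k. inverse \<mu> ^ k *\<^sub>R Z k) sequentially"
      using bounded_bilinear.Zfun_prod_Bfun[OF bounded_bilinear_scaleR 0[unfolded tendsto_Zfun_iff diff_zero] \<open>Bseq Z\<close>] .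
    then have "(\<lambda>k. inverse \<mu> ^ k *\<^sub>R Z k) \<longlonglongrightarrow> 0" by (simp add: tendsto_Zfun_iff)
    then have "(\<lambda>k. \<alpha> *\<^sub>R p + inverse \<mu> ^ k *\<^sub>R Z k) \<longlonglongrightarrow> \<alpha> *\<^sub>R p + 0" by (intro tendsto_add tendsto_const)
    moreover have "\<alpha> *\<^sub>R p + inverse \<mu> ^ k *\<^sub>R Z k = inverse \<mu> ^ k *\<^sub>R Y k" for k
    proof -
      have "inverse \<mu> ^ k * (\<alpha> * \<mu> ^ k) = \<alpha>" using \<mu>_nonzero by (simp add: power_inverse)
      then show ?thesis unfolding YZ by (simp only: scaleR_add_right scaleR_scaleR)
    qed
    ultimately have "(\<lambda>k. inverse \<mu> ^ k *\<^sub>R Y k) \<longlonglongrightarrow> \<alpha> *\<^sub>R p" by simp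
    then have "(\<lambda>k. rp_class (inverse \<mu> ^ k *\<^sub>R Y k)) \<longlonglongrightarrow> rp_class (\<alpha> *\<^sub>R p)"
      using \<alpha> p_nonzero by (intro tendsto_rp_class) auto
    then show ?thesis using \<alpha> \<mu>_nonzero by simp
  qed
  define z where "z = ads_flip n"
  have zform: "z \<bullet> x = ads_form x n" for x by (simp add: z_def ads_form_inner inner_commute)
  have zP: "z \<bullet> u = 0" if "u \<in> P" for u using that P_V nV by (auto simp: zform)
  have zY: "\<bar>z \<bullet> Y k\<bar> = \<bar>s * ads_form n n\<bar>" for k
  proof -
    have "z \<bullet> Y k = s * c ^ k * ads_form n n"
      using nV[OF p_V] nV[OF q_V] nV[of "H k"] H[of k] P0_V by (auto simp: zform Y ads_form_simps)
    then show ?thesis by (simp add: abs_mult power_abs cabs)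
  qed
  have "s = 0"
  proof (rule ccontr)
    assume "s \<noteq> 0"
    define \<delta> where "\<delta> = \<bar>s * ads_form n n\<bar>"
    have \<delta>: "\<delta> > 0" using \<open>s \<noteq> 0\<close> n(3) by (simp add: \<delta>_def)
    have M: "M \<ge> 0" using \<pi>Y[of 0] norm_ge_zero order_trans by blast
    define m where "m = M + 1"
    have m: "m > 0" using M by (simp add: m_def)
    \<comment> \<open>With this tolerance the tangency estimate at \<open>Y k\<close> reads \<delta>
      \<le> \<delta> / 2, as \<open>m\<close> exceeds the bound \<open>M\<close>; the 1 added to
      \<open>M\<close> keeps the denominator positive.\<close>
    have \<epsilon>: "0 < \<delta> / (2 * m)" using \<delta> m by simp
    obtain U where U: "open U" "rp_class p \<in> U"
      and est: "\<And>y. y \<noteq> 0 \<Longrightarrow> rp_class y \<in> limit_set \<Gamma> \<Longrightarrow> rp_class y \<in> U \<Longrightarrow>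
        \<bar>z \<bullet> y\<bar> \<le> \<delta> / (2 * m) * norm (\<pi> y)"
      using near_p_estimate[OF zP \<epsilon>] by blast
    obtain k where "rp_class (Y k) \<in> U"
      using topological_tendstoD[OF lim U] eventually_happens'[OF sequentially_bot] by blast
    then have "\<delta> \<le> \<delta> / (2 * m) * norm (\<pi> (Y k))"
      using est[of "Y k"] Yl[of k] zY[of k] by (simp add: \<delta>_def)
    also have "\<dots> \<le> \<delta> / (2 * m) * m"
      using \<epsilon> \<pi>Y[of k] by (intro mult_left_mono) (auto simp: m_def)
    also have "\<dots> = \<delta> / 2" using m by simp
    finally show False using \<delta> by simp
  qed
  then show ?thesis
    using y_eq p_V q_V P0_V h V_subspace by (auto intro!: subspace_add subspace_scale)
qed

end


section \<open>Rigidity\<close>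

text \<open>The submanifold condition leaves the dimension open; the sphere fixes it. A punctured
  sphere is a hyperplane, and invariance of dimension is applied both ways: from an open piece of
  \<open>L\<close> to the hyperplane, and from an open piece of the hyperplane to
  \<open>L\<close>.\<close>

lemma sphere_slice_dimension:
  fixes M :: "'b::topological_space set" and L :: "(real ^ 'n::finite) set"
  assumes sph: "M homeomorphic sphere (0 :: real ^ 'n) 1" and hom: "homeomorphism S N \<psi> h"
    and N: "openin (top_of_set M) N" and S: "openin (top_of_set L) S" "S \<noteq> {}" and L: "subspace L"
  shows "dim L + 1 = CARD('n)"
proof -
  obtain f f' where f: "homeomorphism M (sphere (0 :: real ^ 'n) 1) f f'"
    using sph unfolding homeomorphic_def by blast
  obtain x1 where x1: "x1 \<in> S" using S by blast
  have NM: "N \<subseteq> M" using N openin_imp_subset by blast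
  have \<psi>M: "\<psi> x \<in> M" if "x \<in> S" for x using that hom NM homeomorphism_image1 by blast
  \<comment> \<open>The puncture is antipodal to the image of \<open>x1\<close>, so
    \<open>x1\<close> survives.\<close>
  define b where "b = - f (\<psi> x1)"
  have f1: "f (\<psi> x) \<in> sphere 0 1" if "x \<in> S" for x
    using \<psi>M[OF that] homeomorphism_image1[OF f] by blast
  have b: "b \<in> sphere 0 1" and b1: "f (\<psi> x1) \<noteq> b"
    using f1[OF x1] by (auto simp: b_def eq_neg_iff_add_eq_0 simp flip: scaleR_2)
  define c :: "real ^ 'n" where "c = axis undefined 1"
  define T where "T = {x. c \<bullet> x = 0}"
  have c: "c \<noteq> 0" by (simp add: c_def axis_eq_0_iff)
  have aff: "affine T" "affine L" using L by (auto simp: T_def affine_hyperplane subspace_imp_affine)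
  have aT: "aff_dim T = int CARD('n) - 1" using c by (simp add: T_def aff_dim_hyperplane)
  have "(sphere 0 1 - {b}) homeomorphic T"
    unfolding T_def by (rule homeomorphic_punctured_sphere_hyperplane[OF _ b c]) simp
  then obtain k k' where k: "homeomorphism (sphere 0 1 - {b}) T k k'"
    unfolding homeomorphic_def by blast
  have cont_f\<psi>: "continuous_on S (\<lambda>x. f (\<psi> x))"
    using homeomorphism_cont1[OF hom] homeomorphism_cont1[OF f] \<psi>M
    by (intro continuous_on_compose2[of M f S \<psi>]) auto
  have "aff_dim L \<le> aff_dim T"
  proof (rule invariance_of_dimension_affine_sets[OF _ aff(2,1)])
    let ?S = "S \<inter> (\<lambda>x. f (\<psi> x)) -` (- {b})"
    have "openin (top_of_set S) ?S"
      by (rule continuous_openin_preimage_gen[OF cont_f\<psi>]) (simp add: open_Compl)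
    then show "openin (top_of_set L) ?S" using S(1) openin_trans by blast
    show "continuous_on ?S (\<lambda>x. k (f (\<psi> x)))"
      using f1 by (intro continuous_on_compose2[OF homeomorphism_cont1[OF k]]
          continuous_on_subset[OF cont_f\<psi>]) auto
    show "(\<lambda>x. k (f (\<psi> x))) \<in> ?S \<rightarrow> T"
      using f1 homeomorphism_image1[OF k] by blast
    show "inj_on (\<lambda>x. k (f (\<psi> x))) ?S"
    proof (rule inj_onI)
      fix x y assume xy: "x \<in> ?S" "y \<in> ?S" "k (f (\<psi> x)) = k (f (\<psi> y))"
      then have "f (\<psi> x) = f (\<psi> y)"
        using f1 homeomorphism_apply1[OF k] by (metis ComplD DiffI IntD1 IntD2 vimageD)
      then have "\<psi> x = \<psi> y" using xy \<psi>M homeomorphism_apply1[OF f] by (metis IntD1)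
      then show "x = y" using xy homeomorphism_apply1[OF hom] by (metis IntD1)
    qed
    show "?S \<noteq> {}" using x1 b1 by auto
  qed
  moreover have "aff_dim T \<le> aff_dim L"
  proof -
    have kT: "k' t \<in> sphere 0 1 - {b}" if "t \<in> T" for t using that homeomorphism_image2[OF k] by blast
    have fk: "f' (k' t) \<in> M" if "t \<in> T" for t using kT[OF that] homeomorphism_image2[OF f] by blast
    have cont: "continuous_on T (\<lambda>t. f' (k' t))"
      using kT by (intro continuous_on_compose2[OF homeomorphism_cont2[OF f] homeomorphism_cont2[OF k]]) auto
    let ?O = "T \<inter> (\<lambda>t. f' (k' t)) -` N"
    show ?thesis
    proof (rule invariance_of_dimension_affine_sets[OF _ aff])
      show "openin (top_of_set T) ?O"
        using fk by (intro continuous_openin_preimage[OF cont _ N]) auto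
      show "continuous_on ?O (\<lambda>t. h (f' (k' t)))"
        by (intro continuous_on_compose2[OF homeomorphism_cont2[OF hom]] continuous_on_subset[OF cont]) auto
      have "S \<subseteq> L" using S(1) openin_imp_subset by blast
      then show "(\<lambda>t. h (f' (k' t))) \<in> ?O \<rightarrow> L"
        using homeomorphism_image2[OF hom] by blast
      show "inj_on (\<lambda>t. h (f' (k' t))) ?O"
      proof (rule inj_onI)
        fix s t assume st: "s \<in> ?O" "t \<in> ?O" "h (f' (k' s)) = h (f' (k' t))"
        then have "f' (k' s) = f' (k' t)" using homeomorphism_apply2[OF hom] by (metis IntD2 vimageD)
        then have "k' s = k' t" using st kT homeomorphism_apply2[OF f] by (metis DiffD1 IntD1)
        then show "s = t" using st homeomorphism_apply2[OF k] by (metis IntD1)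
      qed
      have "k (f (\<psi> x1)) \<in> T" using f1[OF x1] b1 homeomorphism_image1[OF k] by blast
      moreover have "k' (k (f (\<psi> x1))) = f (\<psi> x1)"
        using f1[OF x1] b1 by (intro homeomorphism_apply1[OF k]) simp
      moreover have "f' (f (\<psi> x1)) = \<psi> x1" by (intro homeomorphism_apply1[OF f] \<psi>M x1)
      moreover have "\<psi> x1 \<in> N" using x1 homeomorphism_image1[OF hom] by blast
      ultimately have "k (f (\<psi> x1)) \<in> ?O" by simp
      then show "?O \<noteq> {}" by blast
    qed
  qed
  ultimately show ?thesis using aT L by (simp add: aff_dim_subspace)
qed

context spacelike_fixed_point
begin

text \<open>The right side depends on \<open>A\<close>, the left side only on the group. The span is
  closed, so it contains limits of difference quotients and hence \<open>P\<close>; another limit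
  point is not orthogonal to \<open>p\<close>, so it lies outside \<open>P\<close> and supplies the
  missing dimension.\<close>

lemma span_limit_eq_V:
  assumes x: "x \<noteq> 0" "rp_class x \<in> limit_set \<Gamma>" "rp_class x \<noteq> rp_class p"
  shows "span {y. y \<noteq> 0 \<and> rp_class y \<in> limit_set \<Gamma>} = V"
proof -
  let ?\<Lambda> = "{y. y \<noteq> 0 \<and> rp_class y \<in> limit_set \<Gamma>}"
  have TL: "T v \<in> span ?\<Lambda>" if v: "v \<in> L" for v
  proof -
    obtain d where d: "0 < d"
      and \<gamma>: "\<And>t. \<bar>t\<bar> < d \<Longrightarrow> \<sigma> (w0 + t *\<^sub>R v) \<noteq> 0 \<and> rp_class (\<sigma> (w0 + t *\<^sub>R v)) \<in> limit_set \<Gamma>"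
      using slice_curve[OF par slice L w0 v] by blast
    have mem: "\<sigma> (w0 + t *\<^sub>R v) \<in> span ?\<Lambda>" if "\<bar>t\<bar> < d" for t using \<gamma>[OF that] by (intro span_base) simp
    have lim: "((\<lambda>t. (\<sigma> (w0 + t *\<^sub>R v) - \<sigma> (w0 + 0 *\<^sub>R v)) /\<^sub>R t) \<longlongrightarrow> T v) (at 0)"
      by (rule has_vector_derivative_quotient_tendsto[OF curve_has_vector_derivative[OF der]])
    show ?thesis
    proof (rule Lim_in_closed_set[OF closed_span _ _ lim])
      have "\<forall>\<^sub>F t in at 0. \<bar>t\<bar> < d" using d by (auto simp: eventually_at intro!: exI[of _ d])
      then show "\<forall>\<^sub>F t in at 0. (\<sigma> (w0 + t *\<^sub>R v) - \<sigma> (w0 + 0 *\<^sub>R v)) /\<^sub>R t \<in> span ?\<Lambda>"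
      proof eventually_elim
        case (elim t)
        show ?case using mem[OF elim] mem[of 0] d by (intro span_scale span_diff) simp_all
      qed
    qed simp
  qed
  have "P \<subseteq> span ?\<Lambda>"
    unfolding P_def using TL p_nonzero p_limit by (intro span_minimal) (auto intro: span_base)
  moreover have "x \<in> span ?\<Lambda>" using x by (intro span_base) simp
  ultimately have sub: "span (insert x P) \<subseteq> span ?\<Lambda>" by (intro span_minimal) auto
  have "ads_form p p = 0" by (rule null_p)
  then have "ads_form x p \<noteq> 0"
    using limit_acausal[OF x(2,1) limit_in_cone[OF p_limit p_nonzero] p_nonzero] x(3) by blast
  then have "x \<notin> span P" using orth_p subspace_P by (auto simp: span_eq_iff[THEN iffD2])
  then have "dim (span (insert x P)) = CARD('n) + 1" by (simp add: dim_insert dim_P)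
  then have "dim V \<le> dim (span ?\<Lambda>)" using dim_subset[OF sub] dim_V by simp
  moreover have "span ?\<Lambda> \<subseteq> V" using limit_in_V V_subspace by (intro span_minimal) auto
  ultimately show ?thesis using V_subspace by (intro subspace_dim_equal) auto
qed

end

text \<open>Surjectivity of the action on the set comes from the inclusion applied to the inverse
  element.\<close>

lemma preserves_span_invariant:
  fixes \<Gamma> :: "(real ^ ('n::finite + 2) ^ ('n + 2)) set set"
  assumes \<Gamma>: "subgroup \<Gamma> PO_n_2"
    and inv: "\<And>g A x. g \<in> \<Gamma> \<Longrightarrow> A \<in> g \<Longrightarrow> x \<in> X \<Longrightarrow> A *v x \<in> X"
  shows "preserves \<Gamma> (projectivization (span X) \<inter> AdS)"
proof -
  let ?Q = "projectivization (span X) \<inter> AdS"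
  have span_inv: "A *v x \<in> span X" if "g \<in> \<Gamma>" "A \<in> g" "x \<in> span X" for g A x
  proof -
    have "(*v) A ` span X = span ((*v) A ` X)" by (simp add: linear_span_image)
    also have "\<dots> \<subseteq> span X" using inv that(1,2) by (intro span_mono) blast
    finally show ?thesis using that(3) by blast
  qed
  have Q_iff: "rp_class x \<in> ?Q \<longleftrightarrow> x \<in> span X \<and> ads_form x x < 0" if x: "x \<noteq> 0" for x
  proof
    assume "rp_class x \<in> ?Q"
    then obtain y where y: "rp_class y = rp_class x" "y \<in> span X" "y \<noteq> 0" "rp_class x \<in> AdS"
      by (auto simp: projectivization_def)
    then obtain c where "x = c *\<^sub>R y" using rp_class_eq_iff x by metis
    then show "x \<in> span X \<and> ads_form x x < 0" using y AdS_form_neg[OF x] span_scale by blast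
  qed (use x in \<open>auto simp: projectivization_def AdS_def\<close>)
  have sub: "rp_class (A *v x) \<in> ?Q" if g: "g \<in> \<Gamma>" "A \<in> g" and x: "x \<noteq> 0" "rp_class x \<in> ?Q" for g A x
  proof -
    have AO: "A \<in> carrier O_n_2"
      by (rule PO_n_2_lift(1)[OF subgroup.mem_carrier[OF \<Gamma> g(1)] g(2)])
    show ?thesis
      unfolding Q_iff[OF O_n_2_mult_nonzero[OF AO x(1)]]
      using span_inv[OF g, of x] x(2) unfolding Q_iff[OF x(1)] by (simp add: O_n_2_form[OF AO])
  qed
  show ?thesis
    unfolding preserves_def
  proof (intro ballI equalityI subsetI)
    fix g r assume g: "g \<in> \<Gamma>" and r: "r \<in> act g ` ?Q"
    have gc: "g \<in> carrier PO_n_2" by (rule subgroup.mem_carrier[OF \<Gamma> g])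
    obtain A where A: "A \<in> g" using PO_n_2_lift_exists[OF gc] .
    obtain s where s: "s \<in> ?Q" "r = act g s" using r by blast
    obtain x where x: "x \<noteq> 0" "s = rp_class x" using rp_class_surj .
    show "r \<in> ?Q" using sub[OF g A x(1)] s x act_rp_class[OF gc A x(1)] by simp
  next
    fix g r assume g: "g \<in> \<Gamma>" and r: "r \<in> ?Q"
    have gc: "g \<in> carrier PO_n_2" by (rule subgroup.mem_carrier[OF \<Gamma> g])
    obtain A where A: "A \<in> g" using PO_n_2_lift_exists[OF gc] .
    obtain B where B: "B \<in> inv\<^bsub>PO_n_2\<^esub> g" "A ** B = mat 1" using PO_n_2_inv[OF gc A] by metis
    have ig: "inv\<^bsub>PO_n_2\<^esub> g \<in> \<Gamma>" using \<Gamma> g by (simp add: subgroup.m_inv_closed)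
    obtain x where x: "x \<noteq> 0" "r = rp_class x" using rp_class_surj .
    have AB: "A *v (B *v x) = x" by (simp add: matrix_vector_mul_assoc B)
    then have "B *v x \<noteq> 0" using x(1) by auto
    then have "act g (rp_class (B *v x)) = r" using act_rp_class[OF gc A] AB x(2) by metis
    moreover have "rp_class (B *v x) \<in> ?Q" using sub[OF ig B(1) x(1)] r x(2) by simp
    ultimately show "r \<in> act g ` ?Q" by blast
  qed
qed

theorem theorem1p3:
  fixes \<Gamma> :: "(real ^ ('n::finite + 2) ^ ('n + 2)) set set"
  assumes "AdS_quasi_Fuchsian \<Gamma>"
    and "C1_submanifold_of_boundary (limit_set \<Gamma>)"
  shows "AdS_Fuchsian \<Gamma>"
proof -
  have cc: "AdS_convex_cocompact \<Gamma>" and sph: "limit_set \<Gamma> homeomorphic sphere (0 :: real ^ 'n) 1"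
    using assms(1) by (auto simp: AdS_quasi_Fuchsian_def)
  have bd: "limit_set \<Gamma> \<subseteq> boundary_AdS" using assms(2) by (simp add: C1_submanifold_of_boundary_def)
  obtain d where charts: "\<And>r. r \<in> limit_set \<Gamma> \<Longrightarrow> \<exists>W \<sigma> L. C1_parametrization W \<sigma> \<and>
      r \<in> (rp_class \<circ> \<sigma>) ` W \<and> subspace L \<and> dim L = d \<and> {w \<in> W. rp_class (\<sigma> w) \<in> limit_set \<Gamma>} = W \<inter> L"
    using assms(2) unfolding C1_submanifold_of_boundary_def by blast
  obtain K a where "acausal_cone K a \<Gamma>" using AdS_convex_cocompact_acausal_cone[OF cc] .
  then interpret limit_set_in_boundary K a \<Gamma>
    using bd by (simp add: limit_set_in_boundary_def limit_set_in_boundary_axioms_def)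
  obtain f f' where f: "homeomorphism (limit_set \<Gamma>) (sphere (0 :: real ^ 'n) 1) f f'"
    using sph unfolding homeomorphic_def by blast
  \<comment> \<open>A unit vector and its negative lie on the sphere in every dimension, also when
    it has just two points.\<close>
  have two: "\<exists>s\<in>limit_set \<Gamma>. s \<noteq> r" for r
  proof -
    define b :: "real ^ 'n" where "b = axis undefined 1"
    have b: "b \<in> sphere 0 1" "- b \<in> sphere 0 1" "b \<noteq> - b"
      by (simp_all add: b_def norm_axis_1 eq_neg_iff_add_eq_0 axis_eq_0_iff flip: scaleR_2)
    then have "f' b \<in> limit_set \<Gamma>" "f' (- b) \<in> limit_set \<Gamma>" "f' b \<noteq> f' (- b)"
      using homeomorphism_image2[OF f] homeomorphism_apply2[OF f] by (blast, blast, metis)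
    then show ?thesis by metis
  qed
  then have "limit_set \<Gamma> \<noteq> {}" by blast
  then obtain p0 where p0: "p0 \<in> limit_set \<Gamma>"
    and p0_spacelike: "\<And>\<gamma> u d. (\<gamma> has_vector_derivative u) (at 0) \<Longrightarrow> 0 < d \<Longrightarrow>
      (\<And>t. \<bar>t\<bar> < d \<Longrightarrow> \<gamma> t \<noteq> 0 \<and> rp_class (\<gamma> t) \<in> limit_set \<Gamma>) \<Longrightarrow> rp_class (\<gamma> 0) = p0 \<Longrightarrow>
      ads_form (\<gamma> 0) u = 0 \<Longrightarrow> 0 < ads_form u u \<or> u \<in> span {\<gamma> 0}"
    using spacelike_tangent_point by metis
  obtain W \<sigma> L where par: "C1_parametrization W \<sigma>" and p0W: "p0 \<in> (rp_class \<circ> \<sigma>) ` W"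
    and L: "subspace L" and slice: "{w \<in> W. rp_class (\<sigma> w) \<in> limit_set \<Gamma>} = W \<inter> L"
    using charts[OF p0] by blast
  obtain w1 where w1: "w1 \<in> W" "p0 = rp_class (\<sigma> w1)" using p0W by auto
  then have w1L: "w1 \<in> L" using slice p0 by blast
  let ?f = "rp_class \<circ> \<sigma>"
  have W: "open W" and im: "openin (top_of_set boundary_AdS) (?f ` W)"
    using par unfolding C1_parametrization_def by blast+
  obtain h where h: "homeomorphism W (?f ` W) ?f h" using par unfolding C1_parametrization_def by blast
  obtain D :: "real ^ 'n \<Rightarrow> (real ^ 'n) \<Rightarrow>\<^sub>L (real ^ ('n + 2))" where D: "continuous_on W D"
    and der: "\<And>w. w \<in> W \<Longrightarrow> (\<sigma> has_derivative D w) (at w)"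
    and imm: "\<And>w v. w \<in> W \<Longrightarrow> D w v \<in> span {\<sigma> w} \<Longrightarrow> v = 0"
    using par unfolding C1_parametrization_def by metis
  have dim_L: "dim L + 1 = CARD('n)"
  proof (rule sphere_slice_dimension[OF sph])
    show "homeomorphism (W \<inter> L) (?f ` (W \<inter> L)) ?f h"
      by (rule homeomorphism_of_subsets[OF h]) auto
    obtain U where U: "open U" "?f ` W = boundary_AdS \<inter> U" using im unfolding openin_open by blast
    have "?f ` (W \<inter> L) = limit_set \<Gamma> \<inter> ?f ` W" using slice by auto
    also have "\<dots> = limit_set \<Gamma> \<inter> U" using U(2) bd by blast
    finally show "openin (top_of_set (limit_set \<Gamma>)) (?f ` (W \<inter> L))"
      using U(1) by (simp add: openin_open_Int)
    show "openin (top_of_set L) (W \<inter> L)" using W by (metis inf_commute openin_open_Int)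
    show "W \<inter> L \<noteq> {}" using w1 w1L by blast
  qed (rule L)
  \<comment> \<open>Since \<open>v\<close> is nonzero, the immersion condition excludes that
    \<open>D w1 v\<close> lies on the line of \<open>\<sigma> w1\<close>.\<close>
  have pos: "0 < ads_form (D w1 v) (D w1 v)" if v: "v \<in> L" "v \<noteq> 0" for v
  proof -
    obtain e where e: "0 < e"
      "\<And>t. \<bar>t\<bar> < e \<Longrightarrow> \<sigma> (w1 + t *\<^sub>R v) \<noteq> 0 \<and> rp_class (\<sigma> (w1 + t *\<^sub>R v)) \<in> limit_set \<Gamma>"
      using slice_curve[OF par slice L w1(1) w1L v(1)] by blast
    have "0 < ads_form (D w1 v) (D w1 v) \<or> D w1 v \<in> span {\<sigma> (w1 + 0 *\<^sub>R v)}"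
      using ads_form_derivative_null(2)[OF par w1(1) der[OF w1(1)], of v] w1(2)
      by (intro p0_spacelike[OF curve_has_vector_derivative[OF der[OF w1(1)]] e]) simp_all
    then show ?thesis using imm[OF w1(1), of v] v(2) by auto
  qed
  obtain e where e: "e > 0" "ball w1 e \<subseteq> W"
    and pos_e: "\<And>w v. w \<in> ball w1 e \<Longrightarrow> v \<in> L \<Longrightarrow> v \<noteq> 0 \<Longrightarrow> 0 < ads_form (D w v) (D w v)"
    using definite_on_slice_open[OF D W w1(1) L pos] by blast
  \<comment> \<open>The image of the ball is an open neighbourhood of \<open>p0\<close> in the
    quadric, and \<open>p0\<close> is in the closure of the attracting fixed points; so one of them
    has a parameter \<open>w0\<close> in the ball, where the tangent space is spacelike.\<close>
  have "openin (top_of_set W) (ball w1 e)" using e(2) by (simp add: open_subset)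
  then have "openin (top_of_set (?f ` W)) (?f ` ball w1 e)" by (rule homeomorphism_imp_open_map[OF h])
  then have "openin (top_of_set boundary_AdS) (?f ` ball w1 e)" using im by (rule openin_trans)
  then obtain U where U: "open U" "?f ` ball w1 e = boundary_AdS \<inter> U" unfolding openin_open by blast
  have "p0 \<in> ?f ` ball w1 e" using w1(2) e(1) by (intro image_eqI[of _ _ w1]) simp_all
  then have "p0 \<in> U" using U(2) by blast
  define F where "F = {r. \<exists>g\<in>\<Gamma>. proximal g \<and> attracting_fixed_point g r}"
  have LF: "limit_set \<Gamma> = closure F" by (simp add: limit_set_def F_def)
  then have "p0 \<in> closure F" using p0 by simp
  then obtain r where r: "r \<in> F" "r \<in> U"
    using \<open>p0 \<in> U\<close> open_Int_closure_eq_empty[OF U(1), of F] by blast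
  have r_lim: "r \<in> limit_set \<Gamma>" using r(1) closure_subset[of F] LF by blast
  then have "r \<in> ?f ` ball w1 e" using U(2) bd r(2) by blast
  then obtain w0 where w0: "w0 \<in> ball w1 e" "r = rp_class (\<sigma> w0)" by auto
  then have w0W: "w0 \<in> W" using e(2) by blast
  then have "w0 \<in> {w \<in> W. rp_class (\<sigma> w) \<in> limit_set \<Gamma>}" using r_lim w0(2) by simp
  then have w0L: "w0 \<in> L" unfolding slice by blast
  have \<sigma>0: "\<sigma> w0 \<noteq> 0" using par w0W unfolding C1_parametrization_def by (metis image_eqI)
  obtain g where g: "g \<in> \<Gamma>" "proximal g" "attracting_fixed_point g (rp_class (\<sigma> w0))"
    using r(1) w0(2) by (auto simp: F_def)
  have "ads_form (\<sigma> w0) (\<sigma> w0) = 0" using limit_null r_lim w0(2) \<sigma>0 by blast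
  then obtain A \<mu> q where A: "A \<in> g" "1 < \<bar>\<mu>\<bar>" "A *v \<sigma> w0 = \<mu> *\<^sub>R \<sigma> w0" "A *v q = inverse \<mu> *\<^sub>R q"
    and q: "q \<in> K" "q \<noteq> 0" "ads_form q q = 0" "ads_form (\<sigma> w0) q \<noteq> 0"
    using proximal_eigenvectors[OF g(1,2) \<sigma>0 g(3)] by metis
  interpret spacelike_fixed_point K a \<Gamma> W \<sigma> L w0 "D w0" g A \<mu> q
    by unfold_locales
      (fact par slice L dim_L w0W w0L der[OF w0W] imm[OF w0W] pos_e[OF w0(1)] g(1) A q)+
  obtain s where "s \<in> limit_set \<Gamma>" "s \<noteq> rp_class (\<sigma> w0)" using two by blast
  moreover obtain x where "x \<noteq> 0" "s = rp_class x" using rp_class_surj .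
  ultimately have V: "span {y. y \<noteq> 0 \<and> rp_class y \<in> limit_set \<Gamma>} = V"
    using span_limit_eq_V by blast
  have "preserves \<Gamma> (projectivization (span {y. y \<noteq> 0 \<and> rp_class y \<in> limit_set \<Gamma>}) \<inter> AdS)"
    using limit_set_invariant[OF subgroup_\<Gamma>] O_n_2_mult_nonzero PO_n_2_lift(1) Gamma_carrier
    by (intro preserves_span_invariant[OF subgroup_\<Gamma>]) blast
  then show ?thesis
    using assms(1) V_subspace has_signature_V unfolding AdS_Fuchsian_def V by blast
qed

end
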